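(* Let $\mathcal{C}_d$ be the algebra of covariants of the binary form of degree $d$. Then, as $d\to\infty$, $$ \deg(\mathcal{C}_d)\sim\sqrt{\frac{6}{\pi}}\;\frac{1}{d^{3/2}}, $$ i.e. the ratio of the two sides tends to $1$ as $d\to\infty$.
   Context: For an integer $n\ge 1$, $V_n$ denotes the standard $(n+1)$-dimensional irreducible complex representation of $SL_2=SL_2(\mathbb{C})$ (binary forms of degree $n$). The algebra of covariants of the binary $d$-form is $\mathcal{C}_d\cong\mathbb{C}[V_1\oplus V_d]^{SL_2}$, the algebra of $SL_2$-invariant polynomial functions on $V_1\oplus V_d$. It is graded by the degree of a covariant in the coefficients of the form, i.e. by the degree in the coordinates of $V_d$: $\mathcal{C}_d=(\mathcal{C}_d)_0+(\mathcal{C}_d)_1+\cdots$, with $(\mathcal{C}_d)_0\cong\mathbb{C}$ and every $(\mathcal{C}_d)_i$ finite-dimensional. Its Poincaré series is $\mathcal{P}(\mathcal{C}_d,z)=\sum_{i\ge 0}\dim((\mathcal{C}_d)_i)\,z^i$, a rational function. The transcendence degree over $\mathbb{C}$ of the quotient field of $\mathcal{C}_d$ equals $d$, and the degree of $\mathcal{C}_d$ is $\deg(\mathcal{C}_d):=\lim_{z\to 1}(1-z)^d\,\mathcal{P}(\mathcal{C}_d,z)$. *)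

theory Defs
  imports "HOL-Analysis.Analysis" "HOL-Library.Function_Algebras" "HOL-Library.Landau_Symbols"
begin

text \<open>
  A binary form of degree \<open>n\<close> is given by its coefficients \<open>a 0, \<dots>, a n\<close>; the values of \<open>a\<close> beyond
  index \<open>n\<close> play no role.  The vector space \<open>V\<^sub>n\<close> is the set of functions \<open>binary_form n a\<close>, with
  coordinates \<open>a 0, \<dots>, a n\<close>.
\<close>

definition binary_form :: "nat \<Rightarrow> (nat \<Rightarrow> complex) \<Rightarrow> complex ^ 2 \<Rightarrow> complex" where
  "binary_form n a = (\<lambda>v. \<Sum>i\<le>n. a i * (v $ 1) ^ (n - i) * (v $ 2) ^ i)"

definition SL2 :: "(complex ^ 2 ^ 2) set" where
  "SL2 = {g. det g = 1}"

definition form_action :: "complex ^ 2 ^ 2 \<Rightarrow> (complex ^ 2 \<Rightarrow> complex) \<Rightarrow> complex ^ 2 \<Rightarrow> complex" where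
  "form_action g f = (\<lambda>v. f (matrix_inv g *v v))"

text \<open>
  Functions on \<open>V\<^sub>1 \<oplus> V\<^sub>d\<close> are written as functions of a pair of coefficient sequences.  A polynomial
  function involves only the coordinates \<open>u 0, u 1, a 0, \<dots>, a d\<close>, so distinct elements of
  \<open>polynomial_functions d\<close> are distinct as functions on \<open>V\<^sub>1 \<oplus> V\<^sub>d\<close>.
\<close>

type_synonym coords = "(nat \<Rightarrow> complex) \<times> (nat \<Rightarrow> complex)"

inductive_set polynomial_functions :: "nat \<Rightarrow> (coords \<Rightarrow> complex) set" for d :: nat where
  const: "(\<lambda>_. c) \<in> polynomial_functions d"
| coord_V1: "i \<le> 1 \<Longrightarrow> (\<lambda>(u, a). u i) \<in> polynomial_functions d"
| coord_Vd: "i \<le> d \<Longrightarrow> (\<lambda>(u, a). a i) \<in> polynomial_functions d"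
| add: "F \<in> polynomial_functions d \<Longrightarrow> G \<in> polynomial_functions d \<Longrightarrow>
    (\<lambda>p. F p + G p) \<in> polynomial_functions d"
| mult: "F \<in> polynomial_functions d \<Longrightarrow> G \<in> polynomial_functions d \<Longrightarrow>
    (\<lambda>p. F p * G p) \<in> polynomial_functions d"

definition SL2_invariant :: "nat \<Rightarrow> (coords \<Rightarrow> complex) \<Rightarrow> bool" where
  "SL2_invariant d F \<longleftrightarrow>
     (\<forall>g\<in>SL2. \<forall>u a u' a'.
        binary_form 1 u' = form_action g (binary_form 1 u) \<longrightarrow>
        binary_form d a' = form_action g (binary_form d a) \<longrightarrow>
        F (u', a') = F (u, a))"

definition covariants :: "nat \<Rightarrow> (coords \<Rightarrow> complex) set" where
  "covariants d = {F \<in> polynomial_functions d. SL2_invariant d F}"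

definition covariants_of_degree :: "nat \<Rightarrow> nat \<Rightarrow> (coords \<Rightarrow> complex) set" where
  "covariants_of_degree d i =
     {F \<in> covariants d. \<forall>t u a. F (u, \<lambda>j. t * a j) = t ^ i * F (u, a)}"

interpretation cfun: vector_space "\<lambda>(c :: complex) (F :: 'a \<Rightarrow> complex) x. c * F x"
  by unfold_locales (auto simp: fun_eq_iff algebra_simps)

text \<open>
  The Poincare series converges for \<open>\<bar>z\<bar> < 1\<close>, where it agrees with a rational function; its limit
  at \<open>1\<close> is therefore taken along real \<open>z\<close> tending to \<open>1\<close> from the left.
\<close>

definition poincare_series :: "nat \<Rightarrow> real \<Rightarrow> real" where
  "poincare_series d z = (\<Sum>i. real (cfun.dim (covariants_of_degree d i)) * z ^ i)"

definition degree_covariants :: "nat \<Rightarrow> real" where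
  "degree_covariants d = Lim (at_left 1) (\<lambda>z. (1 - z) ^ d * poincare_series d z)"

end

theory Submission
  imports Defs "HOL-Computational_Algebra.Polynomial" "HOL-Probability.Probability"
    "HOL-Real_Asymp.Real_Asymp"
begin

text \<open>
  A homogeneous covariant of degree \<open>i\<close> is an \<open>SL\<^sub>2\<close>-invariant polynomial function on
  \<open>V\<^sub>1 \<oplus> V\<^sub>d\<close> of degree \<open>i\<close> in the coordinates \<open>a\<close> of \<open>V\<^sub>d\<close>. Since the two unipotent subgroups
  generate \<open>SL\<^sub>2\<close>, invariance means being killed by two derivations, \<open>raising\<close> and \<open>lowering\<close>
  (\<open>SL2_invariant_iff\<close>), which generate an action of the Lie algebra \<open>sl\<^sub>2\<close>. In a module of \<open>sl\<^sub>2\<close>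
  with finitely many weights, the raising operator maps onto every weight space of positive
  weight (\<open>E_surjective_onto_positive_weights\<close>), so the dimension of the invariants is the
  dimension of the weight space \<open>0\<close> minus that of the weight space \<open>2\<close>. Both have bases of
  monomials; the monomials in the coordinates of \<open>V\<^sub>1\<close> cancel, and what remains is the number of
  monomials in \<open>a\<close> of degree \<open>i\<close> and weight \<open>0\<close> or \<open>1\<close>, where \<open>a j\<close> has weight \<open>2j - d\<close>
  (\<open>dim_covariants_of_degree\<close>).
  
  Fourier inversion turns this count into an integral formula of Molien and Weyl for the Poincare
  series (\<open>hilbert_series_eq_integral\<close>), whose integrand contains the product of
  \<open>1 / (1 - z * cis ((2j - d) \<theta>))\<close> over \<open>j \<le> d\<close>. Near \<open>z = 1\<close> only angles of size \<open>1 - z\<close> matter: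
  for \<open>\<theta> = (1 - z) t\<close> each of the \<open>d + 1\<close> factors, multiplied by \<open>1 - z\<close>, tends to
  \<open>1 / (1 - \<i> (2j - d) t)\<close>, and one power of \<open>1 - z\<close> is absorbed by \<open>d\<theta>\<close>. Hence the degree is
  \<open>1 / pi\<close> times the integral over \<open>t\<close> of the product of \<open>1 / (1 + (d - 2j)\<^sup>2 t\<^sup>2)\<close> over \<open>2j < d\<close>
  (\<open>degree_covariants_eq_integral\<close>).
  
  The sum of \<open>(d - 2j)\<^sup>2\<close> over \<open>2j < d\<close> is \<open>d (d + 1) (d + 2) / 6\<close>. After the substitution
  \<open>t = \<tau> / d\<^sup>3\<^sup>/\<^sup>2\<close> the integrand therefore tends to \<open>exp (- \<tau>\<^sup>2 / 6)\<close>
  (\<open>degree_density_integral_asymp\<close>), and the Gaussian integral \<open>sqrt (6 pi)\<close> gives the constant.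
\<close>

section \<open>Kernels and images in vector spaces\<close>

text \<open>
  Linearity is required on \<open>V\<close> only, because the differential operators of the later sections are
  linear on polynomial functions but not on arbitrary functions.
\<close>

lemma (in vector_space) dim_eq_dim_kernel_plus_dim_image:
  assumes V: "subspace V" "V \<subseteq> span S" "finite S"
    and add: "\<And>x y. x \<in> V \<Longrightarrow> y \<in> V \<Longrightarrow> f (x + y) = f x + f y"
    and scale: "\<And>c x. x \<in> V \<Longrightarrow> f (scale c x) = scale c (f x)"
  shows "dim V = dim {v \<in> V. f v = 0} + dim (f ` V)"
proof -
  let ?K = "{v \<in> V. f v = 0}"
  have f0: "f 0 = 0"
    using scale[of 0 0] subspace_0[OF V(1)] by simp
  have sum: "f (\<Sum>b\<in>A. scale (c b) b) = (\<Sum>b\<in>A. scale (c b) (f b))" if "finite A" "A \<subseteq> V" for A c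
    using that
  proof (induction A rule: finite_induct)
    case (insert a A)
    have "(\<Sum>b\<in>A. scale (c b) b) \<in> V"
      by (rule subspace_sum[OF V(1)]) (use insert in \<open>auto intro: subspace_scale[OF V(1)]\<close>)
    then show ?case using insert by (simp add: add scale subspace_scale[OF V(1)])
  qed (simp add: f0)
  have subK: "subspace ?K"
    by (rule subspaceI)
      (use V(1) in \<open>auto simp: f0 add scale subspace_0 subspace_add subspace_scale\<close>)
  obtain A where A: "A \<subseteq> ?K" "independent A" "?K \<subseteq> span A"
    using maximal_independent_subset by blast
  obtain B where B: "A \<subseteq> B" "B \<subseteq> V" "independent B" "V \<subseteq> span B"
    using A(1,2) by (auto intro: maximal_independent_subset_extend[of A V])
  have finB: "finite B"
    using independent_span_bound[OF V(3) B(3)] B(2) V(2) by auto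
  let ?C = "B - A"
  have zero: "\<forall>b\<in>?C. c b = 0" if "(\<Sum>b\<in>?C. scale (c b) (f b)) = 0" for c
  proof -
    let ?v = "\<Sum>b\<in>?C. scale (c b) b"
    have "?v \<in> V"
      by (rule subspace_sum[OF V(1)]) (use B in \<open>auto intro: subspace_scale[OF V(1)]\<close>)
    moreover have "f ?v = 0"
      using sum[of ?C c] finB B(2) that by auto
    ultimately have "?v \<in> span A" using A(3) by auto
    moreover have "finite A" using finB B(1) finite_subset by auto
    ultimately obtain e where e: "?v = (\<Sum>a\<in>A. scale (e a) a)"
      using span_finite[of A] by auto
    \<comment> \<open>A relation over the whole basis \<open>B\<close>: the combination over \<open>?C\<close> minus its expansion in \<open>A\<close>.\<close>
    let ?g = "\<lambda>b. if b \<in> A then - e b else c b"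
    have "(\<Sum>b\<in>B. scale (?g b) b) = (\<Sum>b\<in>?C. scale (?g b) b) + (\<Sum>b\<in>A. scale (?g b) b)"
      by (rule sum.subset_diff) (use B finB in auto)
    also have "(\<Sum>b\<in>?C. scale (?g b) b) = ?v" by (rule sum.cong) auto
    also have "(\<Sum>b\<in>A. scale (?g b) b) = - ?v"
      unfolding e by (simp add: sum_negf)
    finally have "(\<Sum>b\<in>B. scale (?g b) b) = 0" by simp
    then have "?g b = 0" if "b \<in> B" for b
      by (rule independentD[OF B(3) finB order_refl _ that])
    then have "c b = 0" if "b \<in> ?C" for b
      using that by (metis DiffD1 DiffD2)
    then show ?thesis by blast
  qed
  have inj: "inj_on f ?C"
  proof (rule inj_onI, rule ccontr)
    fix x y assume xy: "x \<in> ?C" "y \<in> ?C" "f x = f y" "x \<noteq> y"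
    let ?c = "\<lambda>b. if b = x then 1 :: 'a else if b = y then - 1 else 0"
    have "(\<Sum>b\<in>?C. scale (?c b) (f b)) = (\<Sum>b\<in>{x,y}. scale (?c b) (f b))"
      by (rule sum.mono_neutral_right) (use finB xy in auto)
    also have "\<dots> = 0" using xy by simp
    finally have "?c x = 0" using zero[of ?c] xy by blast
    then show False by simp
  qed
  have "independent (f ` ?C)"
  proof (rule independent_if_scalars_zero)
    show "finite (f ` ?C)" using finB by auto
    fix g x assume g: "(\<Sum>x\<in>f ` ?C. scale (g x) x) = 0" and x: "x \<in> f ` ?C"
    have "(\<Sum>b\<in>?C. scale (g (f b)) (f b)) = 0"
      using g by (simp add: sum.reindex[OF inj])
    then show "g x = 0" using zero[of "g \<circ> f"] x by auto
  qed
  moreover have "f ` V \<subseteq> span (f ` ?C)"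
  proof safe
    fix v assume "v \<in> V"
    then obtain c where c: "v = (\<Sum>b\<in>B. scale (c b) b)"
      using B(4) span_finite[OF finB] by auto
    have "f v = (\<Sum>b\<in>B. scale (c b) (f b))" unfolding c using sum[OF finB B(2)] .
    also have "\<dots> = (\<Sum>b\<in>?C. scale (c b) (f b))"
      by (rule sum.mono_neutral_right) (use finB A(1) in auto)
    also have "\<dots> \<in> span (f ` ?C)"
      by (intro span_sum span_scale span_base) auto
    finally show "f v \<in> span (f ` ?C)" .
  qed
  moreover have "f ` ?C \<subseteq> f ` V" using B(2) by auto
  ultimately have "dim (f ` V) = card (f ` ?C)" using basis_card_eq_dim by metis
  also have "\<dots> = card ?C" using inj by (rule card_image)
  finally have "dim (f ` V) = card ?C" .
  moreover have "card A = dim ?K" using basis_card_eq_dim[OF A(1,3,2)] .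
  moreover have "card B = dim V" using basis_card_eq_dim[OF B(2,4,3)] .
  moreover have "card ?C = card B - card A" "card A \<le> card B"
    using card_Diff_subset[OF finite_subset[OF B(1) finB] B(1)] card_mono[OF finB B(1)] by auto
  ultimately show ?thesis by linarith
qed

lemma (in vector_space) eq_of_subset_of_dim_eq:
  assumes "subspace U" "U \<subseteq> V" "V \<subseteq> span S" "finite S" "dim U = dim V"
  shows "U = V"
proof (rule ccontr)
  assume "U \<noteq> V"
  then obtain v where v: "v \<in> V" "v \<notin> U" using assms by auto
  obtain A where A: "A \<subseteq> U" "independent A" "U \<subseteq> span A"
    using maximal_independent_subset by blast
  have "span A = U" using A assms(1) by (metis span_minimal subset_antisym)
  then have ind: "independent (insert v A)" using v A by (simp add: independent_insert)
  have sub: "insert v A \<subseteq> V" using A v assms by auto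
  obtain B where B: "insert v A \<subseteq> B" "B \<subseteq> V" "independent B" "V \<subseteq> span B"
    by (rule maximal_independent_subset_extend[OF sub ind])
  have finB: "finite B"
    using independent_span_bound[OF assms(4) B(3)] B(2) assms(3) by auto
  have "v \<notin> A" using v A by auto
  then have "A \<subset> B" using B(1) by auto
  then have "card A < card B" by (rule psubset_card_mono[OF finB])
  moreover have "card A = dim U" using basis_card_eq_dim[OF A(1,3,2)] .
  moreover have "card B = dim V" using basis_card_eq_dim[OF B(2,4,3)] .
  ultimately show False using assms by simp
qed

section \<open>Weight modules of the Lie algebra sl2\<close>

text \<open>
  The third generator of \<open>sl\<^sub>2\<close> acts on \<open>W n\<close> as multiplication by \<open>n\<close>, so it is not a parameter of
  its own. Boundedness of the weights takes the place of finite dimension: it makes some power of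
  \<open>E\<close> and of \<open>F\<close> vanish on each weight space.
\<close>

locale sl2_weight_module = vector_space scale
  for scale :: "'a::field_char_0 \<Rightarrow> 'b::ab_group_add \<Rightarrow> 'b" +
  fixes W :: "int \<Rightarrow> 'b set" and E F :: "'b \<Rightarrow> 'b"
  assumes subspace_W: "subspace (W n)"
    and E_mem: "v \<in> W n \<Longrightarrow> E v \<in> W (n + 2)"
    and F_mem: "v \<in> W n \<Longrightarrow> F v \<in> W (n - 2)"
    and E_add: "v \<in> W n \<Longrightarrow> w \<in> W n \<Longrightarrow> E (v + w) = E v + E w"
    and F_add: "v \<in> W n \<Longrightarrow> w \<in> W n \<Longrightarrow> F (v + w) = F v + F w"
    and E_scale: "v \<in> W n \<Longrightarrow> E (scale c v) = scale c (E v)"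
    and F_scale: "v \<in> W n \<Longrightarrow> F (scale c v) = scale c (F v)"
    and commutator: "v \<in> W n \<Longrightarrow> E (F v) = F (E v) + scale (of_int n) v"
    and bounded: "\<exists>N::nat. \<forall>n. \<bar>n\<bar> > int N \<longrightarrow> W n = {0}"
begin

lemma E_0: "E 0 = 0" and F_0: "F 0 = 0"
  using E_scale[of 0 0 0] F_scale[of 0 0 0] subspace_0[OF subspace_W] by auto

lemma Epow_mem: "v \<in> W n \<Longrightarrow> (E ^^ k) v \<in> W (n + 2 * int k)"
  by (induction k) (auto dest: E_mem simp: algebra_simps)

lemma Fpow_mem: "v \<in> W n \<Longrightarrow> (F ^^ k) v \<in> W (n - 2 * int k)"
  by (induction k) (auto dest: F_mem simp: algebra_simps)

lemma Epow_add: "v \<in> W n \<Longrightarrow> w \<in> W n \<Longrightarrow> (E ^^ k) (v + w) = (E ^^ k) v + (E ^^ k) w"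
  by (induction k) (auto simp: E_add[OF Epow_mem Epow_mem])

lemma Epow_scale: "v \<in> W n \<Longrightarrow> (E ^^ k) (scale c v) = scale c ((E ^^ k) v)"
  by (induction k) (auto simp: E_scale[OF Epow_mem])

lemma Epow_eq_0: "\<exists>k. \<forall>v\<in>W n. (E ^^ k) v = 0"
proof -
  obtain N :: nat where N: "\<And>n. \<bar>n\<bar> > int N \<Longrightarrow> W n = {0}" using bounded by auto
  have "W (n + 2 * int (N + nat \<bar>n\<bar> + 1)) = {0}" by (rule N) auto
  then show ?thesis using Epow_mem by blast
qed

lemma Fpow_eq_0: "\<exists>k. \<forall>v\<in>W n. (F ^^ k) v = 0"
proof -
  obtain N :: nat where N: "\<And>n. \<bar>n\<bar> > int N \<Longrightarrow> W n = {0}" using bounded by auto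
  have "W (n - 2 * int (N + nat \<bar>n\<bar> + 1)) = {0}" by (rule N) auto
  then show ?thesis using Fpow_mem by blast
qed

text \<open>
  On a vector of weight \<open>n\<close> this is the relation \<open>[E\<^sup>k, F] = k E\<^sup>k\<^sup>-\<^sup>1 (H + k - 1)\<close>, with \<open>k + 1\<close> in place of
  \<open>k\<close>; it follows by moving \<open>F\<close> past one \<open>E\<close> at a time.
\<close>

lemma Epow_F:
  "v \<in> W n \<Longrightarrow> (E ^^ Suc k) (F v) =
     F ((E ^^ Suc k) v) + scale (of_int (int (Suc k) * (n + int k))) ((E ^^ k) v)"
proof (induction k arbitrary: v n)
  case 0
  then show ?case by (simp add: commutator)
next
  case (Suc k)
  have Ev: "E v \<in> W (n + 2)" by (rule E_mem[OF Suc.prems])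
  have nv: "scale (of_int n) v \<in> W n" by (rule subspace_scale[OF subspace_W Suc.prems])
  have FEv: "F (E v) \<in> W n" using F_mem[OF Ev] by simp
  have "(E ^^ Suc (Suc k)) (F v) = (E ^^ Suc k) (E (F v))"
    by (simp only: funpow_Suc_right o_apply)
  also have "E (F v) = F (E v) + scale (of_int n) v" by (rule commutator[OF Suc.prems])
  also have "(E ^^ Suc k) \<dots> = (E ^^ Suc k) (F (E v)) + scale (of_int n) ((E ^^ Suc k) v)"
    by (simp only: Epow_add[OF FEv nv] Epow_scale[OF Suc.prems])
  also have "(E ^^ Suc k) (F (E v)) = F ((E ^^ Suc k) (E v)) +
      scale (of_int (int (Suc k) * (n + 2 + int k))) ((E ^^ k) (E v))"
    by (rule Suc.IH[OF Ev])
  also have "(E ^^ Suc k) (E v) = (E ^^ Suc (Suc k)) v"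
    by (simp only: funpow_Suc_right o_apply)
  also have "(E ^^ k) (E v) = (E ^^ Suc k) v"
    by (simp only: funpow_Suc_right o_apply)
  finally have "(E ^^ Suc (Suc k)) (F v) = F ((E ^^ Suc (Suc k)) v) +
      scale (of_int (int (Suc k) * (n + 2 + int k)) + of_int n) ((E ^^ Suc k) v)"
    by (simp only: scale_left_distrib add.assoc)
  also have "of_int (int (Suc k) * (n + 2 + int k)) + of_int n =
      (of_int (int (Suc (Suc k)) * (n + int (Suc k))) :: 'a)"
    unfolding of_int_add[symmetric] by (rule arg_cong[of _ _ of_int]) (simp add: ring_distribs)
  finally show ?case .
qed

lemma E_Fpow:
  "v \<in> W n \<Longrightarrow> E v = 0 \<Longrightarrow>
    E ((F ^^ Suc k) v) = scale (of_int (int (Suc k) * (n - int k))) ((F ^^ k) v)"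
proof (induction k)
  case 0
  then show ?case by (simp add: commutator F_0)
next
  case (Suc k)
  have mem: "(F ^^ Suc k) v \<in> W (n - 2 * int (Suc k))" by (rule Fpow_mem[OF Suc.prems(1)])
  have "E ((F ^^ Suc (Suc k)) v) = F (E ((F ^^ Suc k) v)) + scale (of_int (n - 2 * int (Suc k))) ((F ^^ Suc k) v)"
    using commutator[OF mem] by simp
  also have "F (E ((F ^^ Suc k) v)) = scale (of_int (int (Suc k) * (n - int k))) ((F ^^ Suc k) v)"
    unfolding Suc.IH[OF Suc.prems] by (simp add: F_scale[OF Fpow_mem[OF Suc.prems(1)]])
  finally have "E ((F ^^ Suc (Suc k)) v) =
      scale (of_int (int (Suc k) * (n - int k)) + of_int (n - 2 * int (Suc k))) ((F ^^ Suc k) v)"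
    by (simp only: scale_left_distrib)
  also have "of_int (int (Suc k) * (n - int k)) + of_int (n - 2 * int (Suc k)) =
      (of_int (int (Suc (Suc k)) * (n - int (Suc k))) :: 'a)"
    unfolding of_int_add[symmetric] by (rule arg_cong[of _ _ of_int]) (simp add: ring_distribs)
  finally show ?case .
qed

text \<open>
  If \<open>E v = 0\<close>, then applying \<open>E\<close> to \<open>F\<^sup>k\<^sup>+\<^sup>1 v\<close> gives back \<open>F\<^sup>k v\<close> up to the factor \<open>(k + 1) (n - k)\<close>,
  which is not zero for \<open>n < 0\<close>. So all \<open>F\<^sup>k v\<close> are nonzero if \<open>v\<close> is, against boundedness.
\<close>

lemma E_injective_on_negative_weights:
  assumes "v \<in> W n" "n < 0" "E v = 0"
  shows "v = 0"
proof -
  have *: "(F ^^ k) v = 0 \<Longrightarrow> v = 0" for k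
  proof (induction k)
    case (Suc k)
    have "scale (of_int (int (Suc k) * (n - int k))) ((F ^^ k) v) = 0"
      using E_Fpow[OF assms(1,3), of k] Suc.prems E_0 by simp
    moreover have "int (Suc k) * (n - int k) \<noteq> 0" using assms(2) by simp
    ultimately have "(F ^^ k) v = 0"
      by (metis of_int_eq_0_iff scale_eq_0_iff)
    then show ?case by (rule Suc.IH)
  qed simp
  obtain k where "\<forall>v\<in>W n. (F ^^ k) v = 0" using Fpow_eq_0 by blast
  then show ?thesis using assms(1) *[of k] by simp
qed

text \<open>
  In weight \<open>0\<close> the commutator vanishes, so \<open>F v\<close> is a vector of weight \<open>-2\<close> killed by \<open>E\<close>.
\<close>

lemma F_eq_0_of_weight_0:
  assumes "v \<in> W 0" "E v = 0"
  shows "F v = 0"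
  by (rule E_injective_on_negative_weights[of _ "0 - 2"])
    (use assms commutator[OF assms(1)] F_mem[OF assms(1)] F_0 in auto)

text \<open>
  Induction on the order of nilpotency takes the place of complete reducibility. If \<open>E\<^sup>k\<^sup>+\<^sup>1 v = 0\<close>,
  then \<open>E\<^sup>k\<close> kills \<open>v\<close> minus a suitable multiple of \<open>E (F v)\<close>, by \<open>Epow_F\<close>; the multiple exists
  because its denominator \<open>(k + 1) (n + k)\<close> is positive.
\<close>

lemma E_surjective_onto_positive_weights:
  assumes "1 \<le> n"
  shows "E ` W (n - 2) = W n"
proof
  show "E ` W (n - 2) \<subseteq> W n"
  proof safe
    fix v assume "v \<in> W (n - 2)"
    from E_mem[OF this] show "E v \<in> W n" by simp
  qed
  have *: "v \<in> W n \<Longrightarrow> (E ^^ k) v = 0 \<Longrightarrow> v \<in> E ` W (n - 2)" for k v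
  proof (induction k arbitrary: v)
    case 0
    then have "v = E 0" using E_0 by simp
    then show ?case using subspace_0[OF subspace_W] by (rule image_eqI)
  next
    case (Suc k)
    define c :: 'a where "c = of_int (int (Suc k) * (n + int k))"
    have c: "c \<noteq> 0" unfolding c_def of_int_eq_0_iff using assms by simp
    have Fv: "F v \<in> W (n - 2)" by (rule F_mem[OF Suc.prems(1)])
    define u where "u = scale (- inverse c) (F v)"
    have u: "u \<in> W (n - 2)" unfolding u_def by (rule subspace_scale[OF subspace_W Fv])
    have Eu: "E u \<in> W n" using E_mem[OF u] by simp
    have "(E ^^ k) (E u) = (E ^^ Suc k) u" by (simp only: funpow_Suc_right o_apply)
    also have "\<dots> = scale (- inverse c) ((E ^^ Suc k) (F v))"
      unfolding u_def by (rule Epow_scale[OF Fv])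
    also have "(E ^^ Suc k) (F v) = scale c ((E ^^ k) v)"
      unfolding Epow_F[OF Suc.prems(1)] c_def[symmetric] using Suc.prems(2) F_0 by simp
    also have "scale (- inverse c) \<dots> = - (E ^^ k) v"
      using c by simp
    finally have "(E ^^ k) (v + E u) = 0" using Epow_add[OF Suc.prems(1) Eu] by simp
    then obtain w where w: "w \<in> W (n - 2)" "v + E u = E w"
      using Suc.IH[of "v + E u"] subspace_add[OF subspace_W Suc.prems(1) Eu] by auto
    have "E (w - u) = E w + E (scale (- 1) u)"
      using E_add[OF w(1), of "scale (- 1) u"] subspace_scale[OF subspace_W u, of "- 1"] by simp
    also have "E (scale (- 1) u) = - E u" using E_scale[OF u, of "- 1"] by simp
    finally have "E (w - u) = v + E u + - E u" unfolding w(2) .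
    then have "v = E (w - u)" by (simp only: add.assoc add.right_inverse add_0_right)
    then show ?case by (rule image_eqI[OF _ subspace_diff[OF subspace_W w(1) u]])
  qed
  obtain k where "\<forall>v\<in>W n. (E ^^ k) v = 0" using Epow_eq_0 by blast
  then show "W n \<subseteq> E ` W (n - 2)" using *[of _ k] by auto
qed

lemma dim_E_kernel:
  assumes "- 1 \<le> n" "W n \<subseteq> span S" "finite S"
  shows "dim (W n) = dim {v \<in> W n. E v = 0} + dim (W (n + 2))"
proof -
  have "dim (W n) = dim {v \<in> W n. E v = 0} + dim (E ` W n)"
    by (rule dim_eq_dim_kernel_plus_dim_image[OF subspace_W assms(2,3) E_add E_scale])
  also have "E ` W n = W (n + 2)"
    using E_surjective_onto_positive_weights[of "n + 2"] assms(1) by simp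
  finally show ?thesis .
qed

end

section \<open>Derivations of polynomial functions\<close>

abbreviation "polys \<equiv> polynomial_functions"

abbreviation u_coord :: "nat \<Rightarrow> coords \<Rightarrow> complex" where "u_coord j \<equiv> \<lambda>(u, a). u j"
abbreviation a_coord :: "nat \<Rightarrow> coords \<Rightarrow> complex" where "a_coord j \<equiv> \<lambda>(u, a). a j"

lemma poly_scale: "G \<in> polys d \<Longrightarrow> (\<lambda>p. c * G p) \<in> polys d"
  by (rule polynomial_functions.mult[OF polynomial_functions.const])

lemma poly_diff: "F \<in> polys d \<Longrightarrow> G \<in> polys d \<Longrightarrow> (\<lambda>p. F p - G p) \<in> polys d"
  using polynomial_functions.add[OF _ poly_scale[of G d "- 1"]] by simp

lemma poly_power: "F \<in> polys d \<Longrightarrow> (\<lambda>p. F p ^ n) \<in> polys d"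
  by (induction n) (auto intro: polynomial_functions.intros)

lemma poly_prod: "finite I \<Longrightarrow> (\<And>i. i \<in> I \<Longrightarrow> F i \<in> polys d) \<Longrightarrow> (\<lambda>p. \<Prod>i\<in>I. F i p) \<in> polys d"
  by (induction I rule: finite_induct) (auto intro: polynomial_functions.intros)

definition directional_derivative :: "(coords \<Rightarrow> complex) \<Rightarrow> coords \<Rightarrow> coords \<Rightarrow> complex" where
  "directional_derivative F p v =
     deriv (\<lambda>s. F (\<lambda>j. fst p j + s * fst v j, \<lambda>j. snd p j + s * snd v j)) 0"

text \<open>
  A polynomial function is built from the coordinates by sums and products, so along any curve its
  derivative is determined by the base point and the tangent vector. Comparing with the straight
  line through that point identifies it with the directional derivative.
\<close>

lemma poly_chain_rule:
  assumes "F \<in> polys d"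
    and "\<And>j. j \<le> 1 \<Longrightarrow> ((\<lambda>s. fst (\<gamma> s) j) has_field_derivative fst v j) (at t)"
    and "\<And>j. j \<le> d \<Longrightarrow> ((\<lambda>s. snd (\<gamma> s) j) has_field_derivative snd v j) (at t)"
  shows "((\<lambda>s. F (\<gamma> s)) has_field_derivative directional_derivative F (\<gamma> t) v) (at t)"
proof -
  let ?tangent = "\<lambda>\<gamma> p v t. \<gamma> t = p \<and>
    (\<forall>j\<le>1. ((\<lambda>s. fst (\<gamma> s) j) has_field_derivative fst v j) (at t)) \<and>
    (\<forall>j\<le>d. ((\<lambda>s. snd (\<gamma> s) j) has_field_derivative snd v j) (at t))"
  define linearises where "linearises F p L \<longleftrightarrow> (\<forall>(\<gamma>::complex \<Rightarrow> coords) v t. ?tangent \<gamma> p v t \<longrightarrow>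
      ((\<lambda>s. F (\<gamma> s)) has_field_derivative L v) (at t))"
    for F :: "coords \<Rightarrow> complex" and p L
  have linearisesD: "((\<lambda>s. F (\<gamma> s)) has_field_derivative L v) (at t)"
    if "linearises F p L" "?tangent \<gamma> p v t" for F p L v t and \<gamma> :: "complex \<Rightarrow> coords"
    using that unfolding linearises_def by blast
  have "\<exists>L. linearises F p L" for p
    using assms(1)
  proof (induction F)
    case (const c)
    then show ?case unfolding linearises_def by (intro exI[of _ "\<lambda>_. 0"]) auto
  next
    case (coord_V1 i)
    then show ?case unfolding linearises_def
      by (intro exI[of _ "\<lambda>v. fst v i"]) (auto simp: case_prod_beta)
  next
    case (coord_Vd i)
    then show ?case unfolding linearises_def
      by (intro exI[of _ "\<lambda>v. snd v i"]) (auto simp: case_prod_beta)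
  next
    case (add F G)
    from add.IH(1) obtain L where L: "linearises F p L" ..
    from add.IH(2) obtain M where M: "linearises G p M" ..
    have "linearises (\<lambda>p. F p + G p) p (\<lambda>v. L v + M v)"
      unfolding linearises_def
      by (intro allI impI, rule DERIV_add) (rule linearisesD[OF L] linearisesD[OF M], assumption)+
    then show ?case by blast
  next
    case (mult F G)
    from mult.IH(1) obtain L where L: "linearises F p L" ..
    from mult.IH(2) obtain M where M: "linearises G p M" ..
    have "linearises (\<lambda>p. F p * G p) p (\<lambda>v. L v * G p + M v * F p)"
      unfolding linearises_def
    proof (intro allI impI)
      fix \<gamma> :: "complex \<Rightarrow> coords" and v t assume t: "?tangent \<gamma> p v t"
      then show "((\<lambda>s. F (\<gamma> s) * G (\<gamma> s)) has_field_derivative L v * G p + M v * F p) (at t)"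
        using DERIV_mult[OF linearisesD[OF L t] linearisesD[OF M t]] by simp
    qed
    then show ?case by blast
  qed
  then obtain L where L: "linearises F (\<gamma> t) L" ..
  have "((\<lambda>s. F (\<lambda>j. fst (\<gamma> t) j + s * fst v j, \<lambda>j. snd (\<gamma> t) j + s * snd v j))
      has_field_derivative L v) (at 0)"
    by (rule linearisesD[OF L]) (auto intro!: derivative_eq_intros)
  then have "directional_derivative F (\<gamma> t) v = L v"
    unfolding directional_derivative_def by (rule DERIV_imp_deriv)
  moreover have "((\<lambda>s. F (\<gamma> s)) has_field_derivative L v) (at t)"
    by (rule linearisesD[OF L]) (use assms in auto)
  ultimately show ?thesis by simp
qed

lemma directional_derivative_eqI:
  assumes "((\<lambda>s. F (\<lambda>j. fst p j + s * fst v j, \<lambda>j. snd p j + s * snd v j))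
      has_field_derivative D) (at 0)"
  shows "directional_derivative F p v = D"
  unfolding directional_derivative_def using assms by (rule DERIV_imp_deriv)

lemma poly_has_directional_derivative:
  assumes "F \<in> polys d"
  shows "((\<lambda>s. F (\<lambda>j. fst p j + s * fst v j, \<lambda>j. snd p j + s * snd v j))
      has_field_derivative directional_derivative F p v) (at 0)"
proof -
  have lin: "((\<lambda>s. x + s * y) has_field_derivative y) (at 0)" for x y :: complex
    by (auto intro!: derivative_eq_intros)
  show ?thesis
    using poly_chain_rule[OF assms, of "\<lambda>s. (\<lambda>j. fst p j + s * fst v j, \<lambda>j. snd p j + s * snd v j)" v 0]
    by (simp add: lin)
qed

definition lie_derivative :: "(coords \<Rightarrow> coords) \<Rightarrow> (coords \<Rightarrow> complex) \<Rightarrow> coords \<Rightarrow> complex" where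
  "lie_derivative \<xi> F = (\<lambda>p. directional_derivative F p (\<xi> p))"

lemma lie_const: "lie_derivative \<xi> (\<lambda>_. c) = (\<lambda>_. 0)"
  unfolding lie_derivative_def by (rule ext, rule directional_derivative_eqI) (rule DERIV_const)

lemma lie_u_coord: "lie_derivative \<xi> (u_coord j) = (\<lambda>p. fst (\<xi> p) j)"
  unfolding lie_derivative_def by (rule ext, rule directional_derivative_eqI) (auto intro!: derivative_eq_intros)

lemma lie_a_coord: "lie_derivative \<xi> (a_coord j) = (\<lambda>p. snd (\<xi> p) j)"
  unfolding lie_derivative_def by (rule ext, rule directional_derivative_eqI) (auto intro!: derivative_eq_intros)

lemma lie_add:
  assumes "F \<in> polys d" "G \<in> polys d"
  shows "lie_derivative \<xi> (\<lambda>p. F p + G p) = (\<lambda>p. lie_derivative \<xi> F p + lie_derivative \<xi> G p)"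
  unfolding lie_derivative_def
  by (rule ext, rule directional_derivative_eqI)
    (rule DERIV_add[OF poly_has_directional_derivative[OF assms(1)]
        poly_has_directional_derivative[OF assms(2)]])

lemma lie_mult:
  assumes "F \<in> polys d" "G \<in> polys d"
  shows "lie_derivative \<xi> (\<lambda>p. F p * G p) = (\<lambda>p. lie_derivative \<xi> F p * G p + F p * lie_derivative \<xi> G p)"
  unfolding lie_derivative_def
proof (rule ext, rule directional_derivative_eqI)
  fix p
  show "((\<lambda>s. F (\<lambda>j. fst p j + s * fst (\<xi> p) j, \<lambda>j. snd p j + s * snd (\<xi> p) j) *
        G (\<lambda>j. fst p j + s * fst (\<xi> p) j, \<lambda>j. snd p j + s * snd (\<xi> p) j)) has_field_derivative
      directional_derivative F p (\<xi> p) * G p + F p * directional_derivative G p (\<xi> p)) (at 0)"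
    using DERIV_mult[OF poly_has_directional_derivative[OF assms(1), of p "\<xi> p"]
        poly_has_directional_derivative[OF assms(2), of p "\<xi> p"]]
    by (simp add: algebra_simps)
qed

definition derivation :: "nat \<Rightarrow> ((coords \<Rightarrow> complex) \<Rightarrow> coords \<Rightarrow> complex) \<Rightarrow> bool" where
  "derivation d D \<longleftrightarrow> (\<forall>F\<in>polys d. D F \<in> polys d) \<and> (\<forall>c. D (\<lambda>_. c) = (\<lambda>_. 0)) \<and>
     (\<forall>F\<in>polys d. \<forall>G\<in>polys d. D (\<lambda>p. F p + G p) = (\<lambda>p. D F p + D G p) \<and>
        D (\<lambda>p. F p * G p) = (\<lambda>p. D F p * G p + F p * D G p))"

lemma derivationD:
  assumes "derivation d D"
  shows derivation_poly: "F \<in> polys d \<Longrightarrow> D F \<in> polys d"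
    and derivation_const: "D (\<lambda>_. c) = (\<lambda>_. 0)"
    and derivation_add: "F \<in> polys d \<Longrightarrow> G \<in> polys d \<Longrightarrow> D (\<lambda>p. F p + G p) = (\<lambda>p. D F p + D G p)"
    and derivation_mult: "F \<in> polys d \<Longrightarrow> G \<in> polys d \<Longrightarrow>
      D (\<lambda>p. F p * G p) = (\<lambda>p. D F p * G p + F p * D G p)"
  using assms unfolding derivation_def by blast+

lemma derivation_scale:
  assumes "derivation d D" "F \<in> polys d"
  shows "D (\<lambda>p. c * F p) = (\<lambda>p. c * D F p)"
  using derivation_mult[OF assms(1) polynomial_functions.const assms(2)]
  by (simp add: derivation_const[OF assms(1)])

lemma derivation_lie:
  assumes "\<And>j. j \<le> 1 \<Longrightarrow> (\<lambda>p. fst (\<xi> p) j) \<in> polys d"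
    and "\<And>j. j \<le> d \<Longrightarrow> (\<lambda>p. snd (\<xi> p) j) \<in> polys d"
  shows "derivation d (lie_derivative \<xi>)"
proof -
  have "lie_derivative \<xi> F \<in> polys d" if "F \<in> polys d" for F
    using that
  proof (induction F)
    case (const c)
    then show ?case by (simp add: lie_const polynomial_functions.const)
  next
    case (coord_V1 i)
    then show ?case using assms by (simp add: lie_u_coord)
  next
    case (coord_Vd i)
    then show ?case using assms by (simp add: lie_a_coord)
  next
    case (add F G)
    then show ?case by (simp add: lie_add polynomial_functions.add)
  next
    case (mult F G)
    then show ?case by (simp add: lie_mult polynomial_functions.add polynomial_functions.mult)
  qed
  then show ?thesis
    unfolding derivation_def by (auto simp: lie_const lie_add lie_mult)
qed

lemma derivation_commutator:
  assumes "derivation d D" "derivation d D'"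
  shows "derivation d (\<lambda>F p. D (D' F) p - D' (D F) p)"
proof -
  note D = derivationD[OF assms(1)] and D' = derivationD[OF assms(2)]
  show ?thesis
    unfolding derivation_def
    by (auto simp: D D' polynomial_functions.intros poly_diff algebra_simps)
qed

lemma derivation_scaled:
  assumes "derivation d D"
  shows "derivation d (\<lambda>F p. c * D F p)"
  using derivationD[OF assms] unfolding derivation_def
  by (auto simp: poly_scale algebra_simps)

lemma derivation_eqI:
  assumes "derivation d D" "derivation d D'" "F \<in> polys d"
    and "\<And>j. j \<le> 1 \<Longrightarrow> D (u_coord j) = D' (u_coord j)"
    and "\<And>j. j \<le> d \<Longrightarrow> D (a_coord j) = D' (a_coord j)"
  shows "D F = D' F"
  using assms(3)
proof (induction F)
qed (use assms(4,5) in \<open>auto simp: derivationD[OF assms(1)] derivationD[OF assms(2)]\<close>)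

section \<open>The action of sl2 by derivations\<close>

text \<open>
  The coefficients of \<open>x \<partial>f/\<partial>y\<close> for the form \<open>f = \<Sum> a j x\<^sup>n\<^sup>-\<^sup>j y\<^sup>j\<close>.
\<close>

definition raise_coeffs :: "nat \<Rightarrow> (nat \<Rightarrow> complex) \<Rightarrow> nat \<Rightarrow> complex" where
  "raise_coeffs n a j = (if j < n then of_nat (Suc j) * a (Suc j) else 0)"

text \<open>
  The coefficients of \<open>y \<partial>f/\<partial>x\<close> for the form \<open>f = \<Sum> a j x\<^sup>n\<^sup>-\<^sup>j y\<^sup>j\<close>.
\<close>

definition lower_coeffs :: "nat \<Rightarrow> (nat \<Rightarrow> complex) \<Rightarrow> nat \<Rightarrow> complex" where
  "lower_coeffs n a j = (if 0 < j then of_nat (Suc n - j) * a (j - 1) else 0)"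

definition raising :: "nat \<Rightarrow> (coords \<Rightarrow> complex) \<Rightarrow> coords \<Rightarrow> complex" where
  "raising d = lie_derivative (\<lambda>(u, a). (raise_coeffs 1 u, raise_coeffs d a))"

definition lowering :: "nat \<Rightarrow> (coords \<Rightarrow> complex) \<Rightarrow> coords \<Rightarrow> complex" where
  "lowering d = lie_derivative (\<lambda>(u, a). (lower_coeffs 1 u, lower_coeffs d a))"

text \<open>
  A linear combination of three commuting Euler operators: \<open>x\<close> goes with the \<open>sl\<^sub>2\<close>-weight, \<open>y\<close> with the
  degree in \<open>u\<close>, \<open>z\<close> with the degree in \<open>a\<close>. With parameters, one commutator identity covers all
  three gradings, and \<open>grading d 1 0 0\<close> is the third generator of \<open>sl\<^sub>2\<close>.
\<close>

definition grading ::
    "nat \<Rightarrow> complex \<Rightarrow> complex \<Rightarrow> complex \<Rightarrow> (coords \<Rightarrow> complex) \<Rightarrow> coords \<Rightarrow> complex" where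
  "grading d x y z = lie_derivative (\<lambda>(u, a).
     (\<lambda>j. (x * (2 * of_nat j - 1) + y) * u j, \<lambda>j. (x * (2 * of_nat j - of_nat d) + z) * a j))"

lemma raising_coord:
  "raising d (u_coord j) = (\<lambda>(u, a). raise_coeffs 1 u j)"
  "raising d (a_coord j) = (\<lambda>(u, a). raise_coeffs d a j)"
  unfolding raising_def lie_u_coord lie_a_coord by auto

lemma lowering_coord:
  "lowering d (u_coord j) = (\<lambda>(u, a). lower_coeffs 1 u j)"
  "lowering d (a_coord j) = (\<lambda>(u, a). lower_coeffs d a j)"
  unfolding lowering_def lie_u_coord lie_a_coord by auto

lemma grading_coord:
  "grading d x y z (u_coord j) = (\<lambda>(u, a). (x * (2 * of_nat j - 1) + y) * u j)"
  "grading d x y z (a_coord j) = (\<lambda>(u, a). (x * (2 * of_nat j - of_nat d) + z) * a j)"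
  unfolding grading_def lie_u_coord lie_a_coord by auto

lemma scaled_coord_poly:
  "j \<le> 1 \<Longrightarrow> (\<lambda>(u, a). c * u j) \<in> polys d"
  "j \<le> d \<Longrightarrow> (\<lambda>(u, a). c * a j) \<in> polys d"
  using poly_scale[OF polynomial_functions.coord_V1] poly_scale[OF polynomial_functions.coord_Vd]
  by (auto simp: case_prod_unfold)

lemma raise_coeffs_poly:
  "j \<le> 1 \<Longrightarrow> (\<lambda>(u, a). raise_coeffs 1 u j) \<in> polys d"
  "j \<le> d \<Longrightarrow> (\<lambda>(u, a). raise_coeffs d a j) \<in> polys d"
proof -
  show "(\<lambda>(u, a). raise_coeffs 1 u j) \<in> polys d" if "j \<le> 1"
    using that scaled_coord_poly(1)[of "Suc j" "of_nat (Suc j)" d] polynomial_functions.const[of 0 d]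
    by (cases "j < 1") (auto simp: raise_coeffs_def case_prod_unfold)
  show "(\<lambda>(u, a). raise_coeffs d a j) \<in> polys d" if "j \<le> d"
    using that scaled_coord_poly(2)[of "Suc j" d "of_nat (Suc j)"] polynomial_functions.const[of 0 d]
    by (cases "j < d") (auto simp: raise_coeffs_def case_prod_unfold)
qed

lemma lower_coeffs_poly:
  "j \<le> 1 \<Longrightarrow> (\<lambda>(u, a). lower_coeffs 1 u j) \<in> polys d"
  "j \<le> d \<Longrightarrow> (\<lambda>(u, a). lower_coeffs d a j) \<in> polys d"
proof -
  show "(\<lambda>(u, a). lower_coeffs 1 u j) \<in> polys d" if "j \<le> 1"
    using that scaled_coord_poly(1)[of "j - 1" "of_nat (2 - j)" d] polynomial_functions.const[of 0 d]
    by (cases j) (auto simp: lower_coeffs_def case_prod_unfold)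
  show "(\<lambda>(u, a). lower_coeffs d a j) \<in> polys d" if "j \<le> d"
    using that scaled_coord_poly(2)[of "j - 1" d "of_nat (Suc d - j)"] polynomial_functions.const[of 0 d]
    by (cases j) (auto simp: lower_coeffs_def case_prod_unfold)
qed

lemma derivation_raising: "derivation d (raising d)"
  unfolding raising_def
  by (rule derivation_lie) (use raise_coeffs_poly in \<open>simp_all add: case_prod_unfold\<close>)

lemma derivation_lowering: "derivation d (lowering d)"
  unfolding lowering_def
  by (rule derivation_lie) (use lower_coeffs_poly in \<open>simp_all add: case_prod_unfold\<close>)

lemma derivation_grading: "derivation d (grading d x y z)"
  unfolding grading_def
  by (rule derivation_lie)
    (auto simp: case_prod_unfold intro: scaled_coord_poly[unfolded case_prod_unfold])

lemma derivation_scaled_coord: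
  assumes "derivation d D"
  shows "j \<le> 1 \<Longrightarrow> D (\<lambda>(u, a). c * u j) = (\<lambda>p. c * D (u_coord j) p)"
    and "j \<le> d \<Longrightarrow> D (\<lambda>(u, a). c * a j) = (\<lambda>p. c * D (a_coord j) p)"
  using derivation_scale[OF assms polynomial_functions.coord_V1]
    derivation_scale[OF assms polynomial_functions.coord_Vd]
  by (auto simp: case_prod_unfold)

lemma commutator_raising_lowering:
  assumes "F \<in> polys d"
  shows "(\<lambda>p. raising d (lowering d F) p - lowering d (raising d F) p) = grading d 1 0 0 F"
proof (rule derivation_eqI[OF _ derivation_grading assms])
  note R = derivation_scaled_coord[OF derivation_raising, unfolded case_prod_unfold]
    derivationD[OF derivation_raising] raising_coord[unfolded case_prod_unfold]
  note L = derivation_scaled_coord[OF derivation_lowering, unfolded case_prod_unfold]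
    derivationD[OF derivation_lowering] lowering_coord[unfolded case_prod_unfold]
  show "derivation d (\<lambda>F p. raising d (lowering d F) p - lowering d (raising d F) p)"
    by (rule derivation_commutator[OF derivation_raising derivation_lowering])
  have *: "raising d (\<lambda>(u, a). lower_coeffs 1 u j) =
        (\<lambda>(u, a). (if 0 < j then of_nat (2 - j) * of_nat j else 0) * u j)"
      "lowering d (\<lambda>(u, a). raise_coeffs 1 u j) =
        (\<lambda>(u, a). (if j < 1 then of_nat (Suc j) * of_nat (1 - j) else 0) * u j)" if "j \<le> 1" for j
    using le_Suc_eq[of j 0] that
    by (auto simp: lower_coeffs_def raise_coeffs_def R L fun_eq_iff case_prod_unfold)
  show "(\<lambda>p. raising d (lowering d (u_coord j)) p - lowering d (raising d (u_coord j)) p) =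
      grading d 1 0 0 (u_coord j)" if "j \<le> 1" for j
    using that unfolding raising_coord lowering_coord grading_coord *[OF that]
    by (auto simp: fun_eq_iff le_Suc_eq)
  have *: "raising d (\<lambda>(u, a). lower_coeffs d a j) =
        (\<lambda>(u, a). of_nat (Suc d - j) * of_nat j * a j)"
      "lowering d (\<lambda>(u, a). raise_coeffs d a j) =
        (\<lambda>(u, a). of_nat (Suc j) * of_nat (d - j) * a j)" if "j \<le> d" for j
  proof -
    show "raising d (\<lambda>(u, a). lower_coeffs d a j) = (\<lambda>(u, a). of_nat (Suc d - j) * of_nat j * a j)"
      using that
      by (cases j)
        (auto simp: lower_coeffs_def raise_coeffs_def R fun_eq_iff case_prod_unfold)
    show "lowering d (\<lambda>(u, a). raise_coeffs d a j) = (\<lambda>(u, a). of_nat (Suc j) * of_nat (d - j) * a j)"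
      using that
      by (cases "j < d")
        (auto simp: lower_coeffs_def raise_coeffs_def L fun_eq_iff case_prod_unfold)
  qed
  show "(\<lambda>p. raising d (lowering d (a_coord j)) p - lowering d (raising d (a_coord j)) p) =
      grading d 1 0 0 (a_coord j)" if "j \<le> d" for j
  proof -
    obtain k where "d = j + k" using \<open>j \<le> d\<close> le_Suc_ex by blast
    then have "of_nat (Suc d - j) * of_nat j - of_nat (Suc j) * of_nat (d - j) =
        (2 * of_nat j - of_nat d :: complex)"
      by (simp add: algebra_simps)
    then have "of_nat (Suc d - j) * of_nat j * x - of_nat (Suc j) * of_nat (d - j) * x =
        (2 * of_nat j - of_nat d) * x" for x :: complex
      by (metis left_diff_distrib)
    then show ?thesis
      unfolding raising_coord lowering_coord grading_coord *[OF that]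
      by (simp add: case_prod_unfold)
  qed
qed

lemma commutator_grading_raising:
  assumes "F \<in> polys d"
  shows "grading d x y z (raising d F) = (\<lambda>p. raising d (grading d x y z F) p + 2 * x * raising d F p)"
proof -
  note R = derivation_scaled_coord[OF derivation_raising, unfolded case_prod_unfold]
    derivationD[OF derivation_raising] raising_coord[unfolded case_prod_unfold]
  note L = derivation_scaled_coord[OF derivation_grading, unfolded case_prod_unfold]
    derivationD[OF derivation_grading] grading_coord[unfolded case_prod_unfold]
  have *: "(\<lambda>p. grading d x y z (raising d F) p - raising d (grading d x y z F) p) = (\<lambda>p. 2 * x * raising d F p)"
  proof (rule derivation_eqI[OF derivation_commutator[OF derivation_grading derivation_raising]
        derivation_scaled[OF derivation_raising] assms])
    show "(\<lambda>p. grading d x y z (raising d (u_coord j)) p - raising d (grading d x y z (u_coord j)) p) =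
        (\<lambda>p. 2 * x * raising d (u_coord j) p)" if "j \<le> 1" for j
      using that
      by (cases "j < 1";
          (auto simp: raise_coeffs_def R L fun_eq_iff case_prod_unfold; simp add: algebra_simps of_nat_diff))
    show "(\<lambda>p. grading d x y z (raising d (a_coord j)) p - raising d (grading d x y z (a_coord j)) p) =
        (\<lambda>p. 2 * x * raising d (a_coord j) p)" if "j \<le> d" for j
      using that
      by (cases "j < d";
          (auto simp: raise_coeffs_def R L fun_eq_iff case_prod_unfold; simp add: algebra_simps of_nat_diff))
  qed
  show ?thesis
  proof
    fix p
    show "grading d x y z (raising d F) p = raising d (grading d x y z F) p + 2 * x * raising d F p"
      using fun_cong[OF *, of p] by (simp only: diff_eq_eq add.commute)
  qed
qed

lemma commutator_grading_lowering:
  assumes "F \<in> polys d"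
  shows "grading d x y z (lowering d F) = (\<lambda>p. lowering d (grading d x y z F) p - 2 * x * lowering d F p)"
proof -
  note R = derivation_scaled_coord[OF derivation_lowering, unfolded case_prod_unfold]
    derivationD[OF derivation_lowering] lowering_coord[unfolded case_prod_unfold]
  note L = derivation_scaled_coord[OF derivation_grading, unfolded case_prod_unfold]
    derivationD[OF derivation_grading] grading_coord[unfolded case_prod_unfold]
  have *: "(\<lambda>p. grading d x y z (lowering d F) p - lowering d (grading d x y z F) p) = (\<lambda>p. - 2 * x * lowering d F p)"
  proof (rule derivation_eqI[OF derivation_commutator[OF derivation_grading derivation_lowering]
        derivation_scaled[OF derivation_lowering] assms])
    show "(\<lambda>p. grading d x y z (lowering d (u_coord j)) p - lowering d (grading d x y z (u_coord j)) p) =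
        (\<lambda>p. - 2 * x * lowering d (u_coord j) p)" if "j \<le> 1" for j
      using that
      by (cases j;
          (auto simp: lower_coeffs_def R L fun_eq_iff case_prod_unfold; simp add: algebra_simps of_nat_diff))
    show "(\<lambda>p. grading d x y z (lowering d (a_coord j)) p - lowering d (grading d x y z (a_coord j)) p) =
        (\<lambda>p. - 2 * x * lowering d (a_coord j) p)" if "j \<le> d" for j
      using that
      by (cases j;
          (auto simp: lower_coeffs_def R L fun_eq_iff case_prod_unfold; simp add: algebra_simps of_nat_diff))
  qed
  show ?thesis
  proof
    fix p
    show "grading d x y z (lowering d F) p = lowering d (grading d x y z F) p - 2 * x * lowering d F p"
      using fun_cong[OF *, of p] by (simp add: diff_eq_eq)
  qed
qed

section \<open>Monomials\<close>

type_synonym exponent = "nat \<times> nat \<times> (nat \<Rightarrow> nat)"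

definition exponents :: "nat \<Rightarrow> exponent set" where
  "exponents d = {(b, c, \<alpha>). \<alpha> \<in> {..d} \<rightarrow>\<^sub>E UNIV}"

lemma restrict_in_exponents: "(b, c, restrict \<alpha> {..d}) \<in> exponents d"
  by (simp add: exponents_def restrict_PiE_iff)

definition monomial :: "nat \<Rightarrow> exponent \<Rightarrow> coords \<Rightarrow> complex" where
  "monomial d = (\<lambda>(b, c, \<alpha>) (u, a). u 0 ^ b * u 1 ^ c * (\<Prod>j\<le>d. a j ^ \<alpha> j))"

definition a_weight :: "nat \<Rightarrow> (nat \<Rightarrow> nat) \<Rightarrow> int" where
  "a_weight d \<alpha> = (\<Sum>j\<le>d. (2 * int j - int d) * int (\<alpha> j))"

definition weight :: "nat \<Rightarrow> exponent \<Rightarrow> int" where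
  "weight d = (\<lambda>(b, c, \<alpha>). int c - int b + a_weight d \<alpha>)"

definition u_degree :: "exponent \<Rightarrow> nat" where
  "u_degree = (\<lambda>(b, c, \<alpha>). b + c)"

definition a_degree :: "nat \<Rightarrow> exponent \<Rightarrow> nat" where
  "a_degree d = (\<lambda>(b, c, \<alpha>). \<Sum>j\<le>d. \<alpha> j)"

lemma monomial_poly: "monomial d e \<in> polys d"
proof -
  obtain b c \<alpha> where e: "e = (b, c, \<alpha>)" by (cases e)
  have "(\<lambda>p. u_coord 0 p ^ b * u_coord 1 p ^ c * (\<Prod>j\<le>d. a_coord j p ^ \<alpha> j)) \<in> polys d"
    by (intro polynomial_functions.mult poly_power poly_prod polynomial_functions.coord_V1
        polynomial_functions.coord_Vd) auto
  then show ?thesis by (simp add: e monomial_def case_prod_unfold)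
qed

lemma derivation_eigen_mult:
  assumes "derivation d D" "F \<in> polys d" "G \<in> polys d" "D F = (\<lambda>p. x * F p)" "D G = (\<lambda>p. y * G p)"
  shows "D (\<lambda>p. F p * G p) = (\<lambda>p. (x + y) * (F p * G p))"
  using derivation_mult[OF assms(1-3)] assms(4,5) by (simp add: algebra_simps)

lemma derivation_eigen_power:
  assumes "derivation d D" "F \<in> polys d" "D F = (\<lambda>p. x * F p)"
  shows "D (\<lambda>p. F p ^ n) = (\<lambda>p. (of_nat n * x) * F p ^ n)"
proof (induction n)
  case 0
  then show ?case by (simp add: derivation_const[OF assms(1)])
next
  case (Suc n)
  have "D (\<lambda>p. F p * F p ^ n) = (\<lambda>p. (x + of_nat n * x) * (F p * F p ^ n))"
    by (rule derivation_eigen_mult[OF assms(1,2) poly_power[OF assms(2)] assms(3) Suc.IH])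
  moreover have "x + of_nat n * x = of_nat (Suc n) * x" by (simp add: distrib_right)
  ultimately show ?case by simp
qed

lemma derivation_eigen_prod:
  assumes "derivation d D" "finite I" "\<And>i. i \<in> I \<Longrightarrow> F i \<in> polys d"
    and "\<And>i. i \<in> I \<Longrightarrow> D (F i) = (\<lambda>p. x i * F i p)"
  shows "D (\<lambda>p. \<Prod>i\<in>I. F i p) = (\<lambda>p. (\<Sum>i\<in>I. x i) * (\<Prod>i\<in>I. F i p))"
  using assms(2-4)
proof (induction I rule: finite_induct)
  case empty
  then show ?case by (simp add: derivation_const[OF assms(1)])
next
  case (insert i I)
  have "D (\<lambda>p. F i p * (\<Prod>i\<in>I. F i p)) = (\<lambda>p. (x i + (\<Sum>i\<in>I. x i)) * (F i p * (\<Prod>i\<in>I. F i p)))"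
    by (rule derivation_eigen_mult[OF assms(1)]) (use insert in \<open>auto intro: poly_prod\<close>)
  then show ?case using insert by simp
qed

definition grade :: "nat \<Rightarrow> complex \<Rightarrow> complex \<Rightarrow> complex \<Rightarrow> exponent \<Rightarrow> complex" where
  "grade d x y z e = x * of_int (weight d e) + y * of_nat (u_degree e) + z * of_nat (a_degree d e)"

lemma grading_monomial: "grading d x y z (monomial d e) = (\<lambda>p. grade d x y z e * monomial d e p)"
proof -
  obtain b c \<alpha> where e: "e = (b, c, \<alpha>)" by (cases e)
  note D = derivation_grading[of d x y z]
  note grad = grading_coord[unfolded case_prod_unfold]
  have u: "(\<lambda>p. fst p j) \<in> polys d" if "j \<le> 1" for j
    using polynomial_functions.coord_V1[OF that] by (simp add: case_prod_unfold)
  have a: "(\<lambda>p. snd p j) \<in> polys d" if "j \<le> d" for j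
    using polynomial_functions.coord_Vd[OF that] by (simp add: case_prod_unfold)
  let ?A = "\<lambda>p. \<Prod>j\<le>d. snd p j ^ \<alpha> j"
  let ?z = "\<lambda>j. x * (2 * of_nat j - of_nat d) + z"
  have 0: "grading d x y z (\<lambda>p. fst p 0 ^ b) = (\<lambda>p. (of_nat b * (y - x)) * fst p 0 ^ b)"
    by (rule derivation_eigen_power[OF D]) (simp_all add: u grad)
  have 1: "grading d x y z (\<lambda>p. fst p 1 ^ c) = (\<lambda>p. (of_nat c * (x + y)) * fst p 1 ^ c)"
    by (rule derivation_eigen_power[OF D]) (simp_all add: u grad)
  have A: "grading d x y z ?A = (\<lambda>p. (\<Sum>j\<le>d. of_nat (\<alpha> j) * ?z j) * ?A p)"
    by (intro derivation_eigen_prod[OF D] derivation_eigen_power[OF D] poly_power a)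
      (simp_all add: grad)
  have A_poly: "?A \<in> polys d" by (intro poly_prod poly_power a) simp_all
  have u_poly: "(\<lambda>p. fst p 0 ^ b) \<in> polys d" "(\<lambda>p. fst p 1 ^ c) \<in> polys d"
    by (intro poly_power u; simp)+
  have "grading d x y z (\<lambda>p. fst p 0 ^ b * fst p 1 ^ c * ?A p) =
      (\<lambda>p. (of_nat b * (y - x) + of_nat c * (x + y) + (\<Sum>j\<le>d. of_nat (\<alpha> j) * ?z j)) *
        (fst p 0 ^ b * fst p 1 ^ c * ?A p))"
    by (rule derivation_eigen_mult[OF D polynomial_functions.mult[OF u_poly] A_poly
          derivation_eigen_mult[OF D u_poly 0 1] A])
  moreover have "of_nat b * (y - x) + of_nat c * (x + y) + (\<Sum>j\<le>d. of_nat (\<alpha> j) * ?z j) =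
      grade d x y z e"
    by (simp add: e grade_def weight_def u_degree_def a_degree_def a_weight_def
        sum.distrib sum_subtractf sum_distrib_left algebra_simps)
  ultimately show ?thesis by (simp add: e monomial_def case_prod_unfold)
qed

lemma base_digits_eq:
  fixes f g :: "nat \<Rightarrow> nat"
  assumes "\<And>j. j < k \<Longrightarrow> f j < N" "\<And>j. j < k \<Longrightarrow> g j < N"
    and "(\<Sum>j<k. f j * N ^ j) = (\<Sum>j<k. g j * N ^ j)" "j < k"
  shows "f j = g j"
  using assms
proof (induction k arbitrary: f g j)
  case (Suc k)
  have split: "(\<Sum>j<Suc k. h j * N ^ j) = h 0 + N * (\<Sum>j<k. h (Suc j) * N ^ j)" for h
    unfolding sum.lessThan_Suc_shift by (simp add: sum_distrib_left algebra_simps)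
  have eq: "f 0 + N * (\<Sum>j<k. f (Suc j) * N ^ j) = g 0 + N * (\<Sum>j<k. g (Suc j) * N ^ j)"
    using Suc.prems(3) unfolding split .
  have N: "f 0 < N" "g 0 < N" using Suc.prems by auto
  have f0: "f 0 = g 0" using arg_cong[OF eq, of "\<lambda>x. x mod N"] N by simp
  show ?case
  proof (cases j)
    case (Suc i)
    have "f (Suc i) = g (Suc i)"
      by (rule Suc.IH) (use Suc.prems eq f0 N Suc in auto)
    then show ?thesis using Suc by simp
  qed (use f0 in simp)
qed simp

text \<open>
  Kronecker substitution: if \<open>N\<close> exceeds all exponents that occur, then setting the \<open>j\<close>-th coordinate
  to \<open>x\<close> to the power \<open>N\<^sup>j\<close> turns distinct monomials into distinct powers of \<open>x\<close>, the exponents of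
  a monomial becoming the digits in base \<open>N\<close>.
\<close>

lemma monomials_independent:
  assumes S: "finite S" "S \<subseteq> exponents d"
    and zero: "\<And>p. (\<Sum>e\<in>S. c e * monomial d e p) = 0" and e: "e \<in> S"
  shows "c e = 0"
proof -
  \<comment> \<open>Coordinates are numbered \<open>u 0, u 1, a 0, \<dots>, a d\<close>, hence the shift by \<open>2\<close>.\<close>
  define digit :: "exponent \<Rightarrow> nat \<Rightarrow> nat" where
    "digit = (\<lambda>(b, c, \<alpha>) j. if j = 0 then b else if j = 1 then c else \<alpha> (j - 2))"
  define N where "N = Suc (\<Sum>e\<in>S. \<Sum>j<d + 3. digit e j)"
  define code where "code e = (\<Sum>j<d + 3. digit e j * N ^ j)" for e
  have N: "digit e j < N" if "e \<in> S" "j < d + 3" for e j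
  proof -
    have "digit e j \<le> (\<Sum>j<d + 3. digit e j)" by (rule member_le_sum) (use that in auto)
    also have "\<dots> \<le> (\<Sum>e\<in>S. \<Sum>j<d + 3. digit e j)" by (rule member_le_sum) (use that S in auto)
    finally show ?thesis unfolding N_def by simp
  qed
  have inj: "inj_on code S"
  proof (rule inj_onI)
    fix e e' assume ee: "e \<in> S" "e' \<in> S" "code e = code e'"
    obtain b c \<alpha> b' c' \<alpha>' where eq: "e = (b, c, \<alpha>)" "e' = (b', c', \<alpha>')" by (cases e, cases e')
    have dig: "digit e j = digit e' j" if "j < d + 3" for j
      using base_digits_eq[of "d + 3" "digit e" N "digit e'" j] N ee that unfolding code_def by auto
    have "\<alpha> j = \<alpha>' j" if "j \<le> d" for j
      using dig[of "j + 2"] that by (simp add: digit_def eq)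
    moreover have "\<alpha> \<in> {..d} \<rightarrow>\<^sub>E UNIV" "\<alpha>' \<in> {..d} \<rightarrow>\<^sub>E UNIV"
      using ee S(2) by (auto simp: eq exponents_def)
    ultimately have "\<alpha> = \<alpha>'" by (auto intro: PiE_ext)
    then show "e = e'" using dig[of 0] dig[of 1] by (simp add: digit_def eq)
  qed
  have mono: "monomial d e (\<lambda>j. x ^ N ^ j, \<lambda>j. x ^ N ^ (j + 2)) = x ^ code e" for e x
  proof -
    obtain b c \<alpha> where eq: "e = (b, c, \<alpha>)" by (cases e)
    have "code e = b + c * N + (\<Sum>j\<le>d. \<alpha> j * N ^ (j + 2))"
      by (simp add: code_def digit_def eq numeral_3_eq_3 sum.lessThan_Suc_shift
          lessThan_Suc_atMost[symmetric] del: sum.lessThan_Suc)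
    then show ?thesis
      by (simp add: eq monomial_def power_add power_mult[symmetric] power_sum mult.commute)
  qed
  define q where "q = (\<Sum>e\<in>S. monom (c e) (code e))"
  have "poly q x = 0" for x
    using zero[of "(\<lambda>j. x ^ N ^ j, \<lambda>j. x ^ N ^ (j + 2))"]
    by (simp only: q_def poly_sum poly_monom mono)
  then have "q = 0" by (simp add: poly_all_0_iff_0[symmetric])
  then have "0 = coeff q (code e)" by simp
  also have "\<dots> = (\<Sum>e'\<in>S. if e' = e then c e' else 0)"
    unfolding q_def coeff_sum coeff_monom
    by (rule sum.cong) (use inj e in \<open>auto dest: inj_onD\<close>)
  also have "\<dots> = c e" using S e by simp
  finally show ?thesis by simp
qed

lemma cfun_sum_apply: "(\<Sum>i\<in>I. f i) x = (\<Sum>i\<in>I. f i x)" for f :: "'i \<Rightarrow> 'a \<Rightarrow> complex"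
  by (induction I rule: infinite_finite_induct) auto

lemma inj_on_monomial: "inj_on (monomial d) (exponents d)"
proof (rule inj_onI, rule ccontr)
  fix e e' assume e: "e \<in> exponents d" "e' \<in> exponents d" "monomial d e = monomial d e'" "e \<noteq> e'"
  let ?c = "\<lambda>f. if f = e then 1 else - 1 :: complex"
  have "?c e = 0"
    by (rule monomials_independent[of "{e, e'}" d ?c]) (use e in auto)
  then show False by simp
qed

lemma span_monomial_obtain:
  assumes "F \<in> cfun.span (monomial d ` X)" "X \<subseteq> exponents d"
  obtains S c where "finite S" "S \<subseteq> X" "\<And>e. e \<in> S \<Longrightarrow> c e \<noteq> 0"
    "F = (\<lambda>p. \<Sum>e\<in>S. c e * monomial d e p)"
proof -
  obtain t r where t: "finite t" "t \<subseteq> monomial d ` X" "F = (\<Sum>a\<in>t. (\<lambda>x. r a * a x))"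
    using assms(1) unfolding cfun.span_explicit by auto
  define S where "S = {e \<in> X. monomial d e \<in> t \<and> r (monomial d e) \<noteq> 0}"
  have inj: "inj_on (monomial d) S"
    by (rule inj_on_subset[OF inj_on_monomial]) (use assms(2) in \<open>auto simp: S_def\<close>)
  have img: "monomial d ` S = {a \<in> t. r a \<noteq> 0}" using t(2) by (auto simp: S_def)
  have "finite S" by (rule finite_imageD[OF _ inj]) (use img t(1) in simp)
  moreover have "F = (\<lambda>p. \<Sum>e\<in>S. r (monomial d e) * monomial d e p)"
  proof
    fix p
    have "F p = (\<Sum>a\<in>t. r a * a p)" unfolding t(3) by (simp add: cfun_sum_apply)
    also have "\<dots> = (\<Sum>a\<in>monomial d ` S. r a * a p)"
      by (rule sum.mono_neutral_right) (use t(1) img in auto)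
    also have "\<dots> = (\<Sum>e\<in>S. r (monomial d e) * monomial d e p)"
      by (simp add: sum.reindex[OF inj])
    finally show "F p = (\<Sum>e\<in>S. r (monomial d e) * monomial d e p)" .
  qed
  ultimately show thesis by (intro that[of S "r \<circ> monomial d"]) (auto simp: S_def)
qed

lemma sum_monomials_in_span:
  assumes "finite S" "S \<subseteq> X"
  shows "(\<lambda>p. \<Sum>e\<in>S. c e * monomial d e p) \<in> cfun.span (monomial d ` X)"
proof -
  have "(\<Sum>e\<in>S. (\<lambda>p. c e * monomial d e p)) \<in> cfun.span (monomial d ` X)"
    by (intro cfun.span_sum cfun.span_scale cfun.span_base) (use assms in auto)
  also have "(\<Sum>e\<in>S. (\<lambda>p. c e * monomial d e p)) = (\<lambda>p. \<Sum>e\<in>S. c e * monomial d e p)"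
    by (rule ext) (rule cfun_sum_apply)
  finally show ?thesis .
qed

lemma independent_monomials:
  assumes "finite X" "X \<subseteq> exponents d"
  shows "cfun.independent (monomial d ` X)"
proof (rule cfun.independent_if_scalars_zero)
  have inj: "inj_on (monomial d) X" by (rule inj_on_subset[OF inj_on_monomial assms(2)])
  fix f g assume *: "(\<Sum>v\<in>monomial d ` X. (\<lambda>x. f v * v x)) = 0" and g: "g \<in> monomial d ` X"
  then obtain e where e: "e \<in> X" "g = monomial d e" by blast
  have "(\<Sum>e\<in>X. f (monomial d e) * monomial d e p) = 0" for p
    using fun_cong[OF *, of p] by (simp add: cfun_sum_apply sum.reindex[OF inj])
  then have "f (monomial d e) = 0"
    by (rule monomials_independent[OF assms, where c = "\<lambda>e. f (monomial d e)"]) (rule e(1))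
  then show "f g = 0" using e(2) by simp
qed (use assms in simp)

lemma monomial_mult:
  assumes "e \<in> exponents d" "e' \<in> exponents d"
  obtains e'' where "e'' \<in> exponents d" "(\<lambda>p. monomial d e p * monomial d e' p) = monomial d e''"
proof -
  obtain b c \<alpha> b' c' \<alpha>' where eq: "e = (b, c, \<alpha>)" "e' = (b', c', \<alpha>')" by (cases e, cases e')
  show thesis
  proof (rule that[of "(b + b', c + c', restrict (\<lambda>j. \<alpha> j + \<alpha>' j) {..d})"])
    show "(\<lambda>p. monomial d e p * monomial d e' p) =
        monomial d (b + b', c + c', restrict (\<lambda>j. \<alpha> j + \<alpha>' j) {..d})"
      by (rule ext) (simp add: eq monomial_def power_add prod.distrib case_prod_unfold)
  qed (rule restrict_in_exponents)
qed

lemma span_monomials_mult: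
  assumes "F \<in> cfun.span (monomial d ` exponents d)" "G \<in> cfun.span (monomial d ` exponents d)"
  shows "(\<lambda>p. F p * G p) \<in> cfun.span (monomial d ` exponents d)"
proof -
  obtain S c where S: "finite S" "S \<subseteq> exponents d" "F = (\<lambda>p. \<Sum>e\<in>S. c e * monomial d e p)"
    by (rule span_monomial_obtain[OF assms(1) order_refl]) blast
  obtain T b where T: "finite T" "T \<subseteq> exponents d" "G = (\<lambda>p. \<Sum>e\<in>T. b e * monomial d e p)"
    by (rule span_monomial_obtain[OF assms(2) order_refl]) blast
  let ?s = "\<Sum>e\<in>S. \<Sum>e'\<in>T. (\<lambda>p. (c e * b e') * (monomial d e p * monomial d e' p))"
  have "?s \<in> cfun.span (monomial d ` exponents d)"
  proof (intro cfun.span_sum cfun.span_scale)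
    fix e e' assume "e \<in> S" "e' \<in> T"
    then have "e \<in> exponents d" "e' \<in> exponents d" using S(2) T(2) by auto
    then obtain e'' where "e'' \<in> exponents d" "(\<lambda>p. monomial d e p * monomial d e' p) = monomial d e''"
      by (rule monomial_mult)
    then show "(\<lambda>p. monomial d e p * monomial d e' p) \<in> cfun.span (monomial d ` exponents d)"
      by (auto intro: cfun.span_base)
  qed
  also have "?s = (\<lambda>p. F p * G p)"
  proof
    fix p
    show "?s p = F p * G p"
      unfolding S(3) T(3) cfun_sum_apply sum_product
      by (intro sum.cong refl) (simp add: mult.assoc mult.left_commute)
  qed
  finally show ?thesis .
qed

lemma poly_in_span_monomials:
  assumes "F \<in> polys d"
  shows "F \<in> cfun.span (monomial d ` exponents d)"
  using assms
proof (induction F)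
  case (const c)
  let ?e = "(0, 0, restrict (\<lambda>_. 0) {..d})"
  have "(\<lambda>p. c * monomial d ?e p) \<in> cfun.span (monomial d ` exponents d)"
    by (intro cfun.span_scale cfun.span_base imageI restrict_in_exponents)
  then show ?case by (simp add: monomial_def case_prod_unfold)
next
  case (coord_V1 i)
  let ?e = "(if i = 0 then 1 else 0, if i = 0 then 0 else 1, restrict (\<lambda>_. 0) {..d})"
  have "u_coord i = monomial d ?e" using coord_V1 le_Suc_eq[of i 0]
    by (auto simp: monomial_def fun_eq_iff)
  moreover have "monomial d ?e \<in> cfun.span (monomial d ` exponents d)"
    by (intro cfun.span_base imageI restrict_in_exponents)
  ultimately show ?case by metis
next
  case (coord_Vd i)
  let ?e = "(0, 0, restrict (\<lambda>j. if j = i then 1 else 0) {..d})"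
  have "(\<Prod>j\<le>d. a j ^ restrict (\<lambda>j. if j = i then 1 else 0) {..d} j) = a i" for a :: "nat \<Rightarrow> complex"
  proof -
    have "(\<Prod>j\<le>d. a j ^ restrict (\<lambda>j. if j = i then 1 else 0) {..d} j) =
        (\<Prod>j\<le>d. if j = i then a j else 1)"
      by (rule prod.cong) auto
    then show ?thesis using coord_Vd by simp
  qed
  then have "a_coord i = monomial d ?e"
    by (simp add: monomial_def fun_eq_iff del: restrict_apply)
  moreover have "monomial d ?e \<in> cfun.span (monomial d ` exponents d)"
    by (intro cfun.span_base imageI restrict_in_exponents)
  ultimately show ?case by metis
next
  case (add F G)
  then show ?case using cfun.span_add[OF add.IH] by (simp add: plus_fun_def)
next
  case (mult F G)
  then show ?case by (intro span_monomials_mult)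
qed

section \<open>Weight spaces of polynomial functions\<close>

lemma subspace_poly: "cfun.subspace (polys d)"
proof (rule cfun.subspaceI)
  show "0 \<in> polys d" using polynomial_functions.const[of 0 d] by (simp add: zero_fun_def)
  show "F + G \<in> polys d" if "F \<in> polys d" "G \<in> polys d" for F G
    using polynomial_functions.add[OF that] by (simp add: plus_fun_def)
  show "(\<lambda>x. c * F x) \<in> polys d" if "F \<in> polys d" for c F
    by (rule poly_scale[OF that])
qed

lemma span_monomials_poly: "F \<in> cfun.span (monomial d ` X) \<Longrightarrow> F \<in> polys d"
  using cfun.span_minimal[OF _ subspace_poly, of "monomial d ` X" d] monomial_poly by blast

lemma derivation_sum:
  assumes "derivation d D" "finite S" "\<And>e. e \<in> S \<Longrightarrow> G e \<in> polys d"
  shows "D (\<lambda>p. \<Sum>e\<in>S. c e * G e p) = (\<lambda>p. \<Sum>e\<in>S. c e * D (G e) p) \<and>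
    (\<lambda>p. \<Sum>e\<in>S. c e * G e p) \<in> polys d"
  using assms(2,3)
proof (induction S rule: finite_induct)
  case empty
  show ?case by (simp add: derivation_const[OF assms(1)] polynomial_functions.const)
next
  case (insert e S)
  let ?H = "\<lambda>p. \<Sum>e\<in>S. c e * G e p"
  have G: "G e \<in> polys d" and cG: "(\<lambda>p. c e * G e p) \<in> polys d"
    using insert.prems by (auto intro: poly_scale)
  have H: "?H \<in> polys d" "D ?H = (\<lambda>p. \<Sum>e\<in>S. c e * D (G e) p)" using insert by auto
  have "D (\<lambda>p. c e * G e p + ?H p) = (\<lambda>p. c e * D (G e) p + (\<Sum>e\<in>S. c e * D (G e) p))"
    unfolding derivation_add[OF assms(1) cG H(1)] derivation_scale[OF assms(1) G] H(2) ..
  moreover have "(\<lambda>p. c e * G e p + ?H p) \<in> polys d" by (rule polynomial_functions.add[OF cG H(1)])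
  ultimately show ?case using insert.hyps by simp
qed

lemma derivation_span:
  assumes D: "derivation d D" and X: "X \<subseteq> exponents d"
    and T: "\<And>e. e \<in> X \<Longrightarrow> D (monomial d e) \<in> cfun.span T" and F: "F \<in> cfun.span (monomial d ` X)"
  shows "D F \<in> cfun.span T"
proof -
  obtain S c where S: "finite S" "S \<subseteq> X" "F = (\<lambda>p. \<Sum>e\<in>S. c e * monomial d e p)"
    by (rule span_monomial_obtain[OF F X]) blast
  have "D F = (\<lambda>p. \<Sum>e\<in>S. c e * D (monomial d e) p)"
    unfolding S(3) by (rule conjunct1[OF derivation_sum[OF D S(1) monomial_poly]])
  also have "\<dots> = (\<Sum>e\<in>S. (\<lambda>p. c e * D (monomial d e) p))"
    by (rule ext) (simp add: cfun_sum_apply)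
  also have "\<dots> \<in> cfun.span T"
    by (intro cfun.span_sum cfun.span_scale T) (use S in auto)
  finally show ?thesis .
qed

lemma grading_eigenvalue:
  assumes S: "finite S" "S \<subseteq> exponents d" "\<And>e. e \<in> S \<Longrightarrow> c e \<noteq> 0"
    and F: "F = (\<lambda>p. \<Sum>e\<in>S. c e * monomial d e p)"
    and eigen: "grading d x y z F = (\<lambda>p. k * F p)" and e: "e \<in> S"
  shows "grade d x y z e = k"
proof -
  have g: "grading d x y z F = (\<lambda>p. \<Sum>e\<in>S. c e * grading d x y z (monomial d e) p)"
    unfolding F by (rule conjunct1[OF derivation_sum[OF derivation_grading S(1) monomial_poly]])
  have "(\<Sum>e\<in>S. (c e * (grade d x y z e - k)) * monomial d e p) = 0" for p
  proof -
    have "(\<Sum>e\<in>S. c e * (grade d x y z e * monomial d e p)) = k * (\<Sum>e\<in>S. c e * monomial d e p)"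
      using fun_cong[OF g, of p] fun_cong[OF eigen, of p] unfolding grading_monomial F by simp
    then show ?thesis
      by (simp add: algebra_simps sum_subtractf sum_distrib_left)
  qed
  then have "c e * (grade d x y z e - k) = 0"
    using monomials_independent[OF S(1,2), of "\<lambda>e. c e * (grade d x y z e - k)"] e by blast
  then show ?thesis using S(3)[OF e] by simp
qed

text \<open>
  The gradings are diagonal in the basis of monomials, so a joint eigenvector involves only the
  monomials with its eigenvalues. In this way the commutator relations alone show where the image of
  a monomial under \<open>raising\<close> or \<open>lowering\<close> lies.
\<close>

lemma joint_eigenvector_in_span:
  assumes F: "F \<in> polys d"
    and eigen: "\<And>x y z. grading d x y z F =
      (\<lambda>p. (x * of_int n + y * of_nat m + z * of_nat i) * F p)"
  shows "F \<in> cfun.span (monomial d ` {e \<in> exponents d. weight d e = n \<and> u_degree e = m \<and> a_degree d e = i})"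
proof -
  obtain S c where S: "finite S" "S \<subseteq> exponents d" "\<And>e. e \<in> S \<Longrightarrow> c e \<noteq> 0"
      "F = (\<lambda>p. \<Sum>e\<in>S. c e * monomial d e p)"
    by (rule span_monomial_obtain[OF poly_in_span_monomials[OF F] order_refl]) blast
  have "weight d e = n \<and> u_degree e = m \<and> a_degree d e = i" if "e \<in> S" for e
    using grading_eigenvalue[OF S eigen[of 1 0 0] that] grading_eigenvalue[OF S eigen[of 0 1 0] that]
      grading_eigenvalue[OF S eigen[of 0 0 1] that] by (simp add: grade_def)
  then have "S \<subseteq> {e \<in> exponents d. weight d e = n \<and> u_degree e = m \<and> a_degree d e = i}"
    using S(2) by auto
  then show ?thesis unfolding S(4) by (rule sum_monomials_in_span[OF S(1)])
qed

lemma raising_monomial: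
  "raising d (monomial d e) \<in> cfun.span (monomial d ` {e' \<in> exponents d.
     weight d e' = weight d e + 2 \<and> u_degree e' = u_degree e \<and> a_degree d e' = a_degree d e})"
proof (rule joint_eigenvector_in_span)
  show "raising d (monomial d e) \<in> polys d"
    by (rule derivation_poly[OF derivation_raising monomial_poly])
  fix x y z
  have *: "raising d (\<lambda>p. grade d x y z e * monomial d e p) = (\<lambda>p. grade d x y z e * raising d (monomial d e) p)"
    by (rule derivation_scale[OF derivation_raising monomial_poly])
  show "grading d x y z (raising d (monomial d e)) = (\<lambda>p. (x * of_int (weight d e + 2) +
      y * of_nat (u_degree e) + z * of_nat (a_degree d e)) * raising d (monomial d e) p)"
    unfolding commutator_grading_raising[OF monomial_poly] grading_monomial *
    by (rule ext) (simp add: grade_def algebra_simps)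
qed

lemma lowering_monomial:
  "lowering d (monomial d e) \<in> cfun.span (monomial d ` {e' \<in> exponents d.
     weight d e' = weight d e - 2 \<and> u_degree e' = u_degree e \<and> a_degree d e' = a_degree d e})"
proof (rule joint_eigenvector_in_span)
  show "lowering d (monomial d e) \<in> polys d"
    by (rule derivation_poly[OF derivation_lowering monomial_poly])
  fix x y z
  have *: "lowering d (\<lambda>p. grade d x y z e * monomial d e p) = (\<lambda>p. grade d x y z e * lowering d (monomial d e) p)"
    by (rule derivation_scale[OF derivation_lowering monomial_poly])
  show "grading d x y z (lowering d (monomial d e)) = (\<lambda>p. (x * of_int (weight d e - 2) +
      y * of_nat (u_degree e) + z * of_nat (a_degree d e)) * lowering d (monomial d e) p)"
    unfolding commutator_grading_lowering[OF monomial_poly] grading_monomial *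
    by (rule ext) (simp add: grade_def algebra_simps)
qed

text \<open>
  Bounding the degree in \<open>u\<close>, instead of fixing it, collects covariants of all orders up to \<open>M\<close> in one
  finite-dimensional space.
\<close>

definition bounded_exponents :: "nat \<Rightarrow> nat \<Rightarrow> nat \<Rightarrow> int \<Rightarrow> exponent set" where
  "bounded_exponents d M i n =
     {e \<in> exponents d. u_degree e \<le> M \<and> a_degree d e = i \<and> weight d e = n}"

definition weight_space :: "nat \<Rightarrow> nat \<Rightarrow> nat \<Rightarrow> int \<Rightarrow> (coords \<Rightarrow> complex) set" where
  "weight_space d M i n = cfun.span (monomial d ` bounded_exponents d M i n)"

lemma bounded_exponents_subset: "bounded_exponents d M i n \<subseteq> exponents d"
  by (auto simp: bounded_exponents_def)

lemma finite_bounded_exponents: "finite (bounded_exponents d M i n)"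
proof (rule finite_subset)
  show "bounded_exponents d M i n \<subseteq> {..M} \<times> {..M} \<times> ({..d} \<rightarrow>\<^sub>E {..i})"
  proof
    fix e assume e: "e \<in> bounded_exponents d M i n"
    obtain b c \<alpha> where eq: "e = (b, c, \<alpha>)" by (cases e)
    have "\<alpha> \<in> {..d} \<rightarrow>\<^sub>E UNIV" "b + c \<le> M" "(\<Sum>j\<le>d. \<alpha> j) = i"
      using e by (auto simp: bounded_exponents_def u_degree_def a_degree_def exponents_def eq)
    moreover have "\<alpha> j \<le> i" if "j \<le> d" for j
      using member_le_sum[of j "{..d}" \<alpha>] that calculation(3) by simp
    ultimately show "e \<in> {..M} \<times> {..M} \<times> ({..d} \<rightarrow>\<^sub>E {..i})"
      by (simp add: eq PiE_iff)
  qed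
qed (auto intro: finite_PiE)

lemma dim_weight_space: "cfun.dim (weight_space d M i n) = card (bounded_exponents d M i n)"
  unfolding weight_space_def
  using cfun.dim_span_eq_card_independent[OF independent_monomials[OF finite_bounded_exponents bounded_exponents_subset]]
    card_image[OF inj_on_subset[OF inj_on_monomial bounded_exponents_subset]] by metis

lemma abs_a_weight_le: "\<bar>a_weight d \<alpha>\<bar> \<le> int d * int (\<Sum>j\<le>d. \<alpha> j)"
proof -
  have "\<bar>a_weight d \<alpha>\<bar> \<le> (\<Sum>j\<le>d. \<bar>(2 * int j - int d) * int (\<alpha> j)\<bar>)"
    unfolding a_weight_def by (rule sum_abs)
  also have "\<dots> \<le> (\<Sum>j\<le>d. int d * int (\<alpha> j))"
    by (rule sum_mono) (auto simp: abs_mult intro!: mult_right_mono)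
  finally show ?thesis by (simp add: sum_distrib_left)
qed

lemma weight_space_poly: "F \<in> weight_space d M i n \<Longrightarrow> F \<in> polys d"
  unfolding weight_space_def by (rule span_monomials_poly)

lemma grading_weight_space:
  assumes "F \<in> weight_space d M i n"
  shows "grading d x 0 z F = (\<lambda>p. (x * of_int n + z * of_nat i) * F p)"
proof -
  obtain S c where S: "finite S" "S \<subseteq> bounded_exponents d M i n"
      "F = (\<lambda>p. \<Sum>e\<in>S. c e * monomial d e p)"
    by (rule span_monomial_obtain[OF assms[unfolded weight_space_def] bounded_exponents_subset]) blast
  have "grading d x 0 z F = (\<lambda>p. \<Sum>e\<in>S. c e * grading d x 0 z (monomial d e) p)"
    unfolding S(3) by (rule conjunct1[OF derivation_sum[OF derivation_grading S(1) monomial_poly]])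
  also have "\<dots> = (\<lambda>p. \<Sum>e\<in>S. c e * ((x * of_int n + z * of_nat i) * monomial d e p))"
    by (intro ext sum.cong refl)
      (use S(2) in \<open>auto simp: grading_monomial grade_def bounded_exponents_def\<close>)
  also have "\<dots> = (\<lambda>p. (x * of_int n + z * of_nat i) * F p)"
    unfolding S(3) by (intro ext) (simp add: sum_distrib_left mult.left_commute)
  finally show ?thesis .
qed

lemma sl2_weight_module_weight_space:
  "sl2_weight_module (\<lambda>c F x. c * F x) (weight_space d M i) (raising d) (lowering d)"
proof (unfold sl2_weight_module_def, intro conjI)
  show "vector_space (\<lambda>c (F :: coords \<Rightarrow> complex) x. c * F x)" by (rule cfun.vector_space_axioms)
  show "sl2_weight_module_axioms (\<lambda>c F x. c * F x) (weight_space d M i) (raising d) (lowering d)"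
  proof
    fix n F G c
    show "cfun.subspace (weight_space d M i n)"
      unfolding weight_space_def by (rule cfun.subspace_span)
    assume F: "F \<in> weight_space d M i n"
    note Fp = weight_space_poly[OF F]
    show "raising d F \<in> weight_space d M i (n + 2)"
      unfolding weight_space_def
      by (rule derivation_span[OF derivation_raising bounded_exponents_subset _ F[unfolded weight_space_def]],
          rule subsetD[OF cfun.span_mono raising_monomial])
        (auto simp: bounded_exponents_def)
    show "lowering d F \<in> weight_space d M i (n - 2)"
      unfolding weight_space_def
      by (rule derivation_span[OF derivation_lowering bounded_exponents_subset _ F[unfolded weight_space_def]],
          rule subsetD[OF cfun.span_mono lowering_monomial])
        (auto simp: bounded_exponents_def)
    show "raising d (\<lambda>x. c * F x) = (\<lambda>x. c * raising d F x)"
      by (rule derivation_scale[OF derivation_raising Fp])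
    show "lowering d (\<lambda>x. c * F x) = (\<lambda>x. c * lowering d F x)"
      by (rule derivation_scale[OF derivation_lowering Fp])
    show "raising d (lowering d F) = lowering d (raising d F) + (\<lambda>x. of_int n * F x)"
    proof
      fix p
      show "raising d (lowering d F) p = (lowering d (raising d F) + (\<lambda>x. of_int n * F x)) p"
        using fun_cong[OF commutator_raising_lowering[OF Fp], of p]
        unfolding grading_weight_space[OF F] by (simp add: diff_eq_eq)
    qed
    assume "G \<in> weight_space d M i n"
    note Gp = weight_space_poly[OF this]
    show "raising d (F + G) = raising d F + raising d G"
      using derivation_add[OF derivation_raising Fp Gp] by (simp add: plus_fun_def)
    show "lowering d (F + G) = lowering d F + lowering d G"
      using derivation_add[OF derivation_lowering Fp Gp] by (simp add: plus_fun_def)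
  next
    have "weight_space d M i n = {0}" if "int (M + d * i) < \<bar>n\<bar>" for n
    proof -
      have "bounded_exponents d M i n = {}"
      proof (rule ccontr)
        assume "bounded_exponents d M i n \<noteq> {}"
        then obtain b c \<alpha> where "(b, c, \<alpha>) \<in> bounded_exponents d M i n" by auto
        then show False using that abs_a_weight_le[of d \<alpha>]
          by (auto simp: bounded_exponents_def weight_def u_degree_def a_degree_def)
      qed
      then show ?thesis by (simp add: weight_space_def)
    qed
    then show "\<exists>N::nat. \<forall>n. int N < \<bar>n\<bar> \<longrightarrow> weight_space d M i n = {0}" by blast
  qed
qed

section \<open>Counting invariants\<close>

definition coeff_exponents :: "nat \<Rightarrow> nat \<Rightarrow> (nat \<Rightarrow> nat) set" where
  "coeff_exponents d i = {\<alpha> \<in> {..d} \<rightarrow>\<^sub>E UNIV. (\<Sum>j\<le>d. \<alpha> j) = i}"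

lemma finite_coeff_exponents: "finite (coeff_exponents d i)"
proof (rule finite_subset)
  show "coeff_exponents d i \<subseteq> {..d} \<rightarrow>\<^sub>E {..i}"
  proof
    fix \<alpha> assume a: "\<alpha> \<in> coeff_exponents d i"
    then have "\<alpha> j \<le> i" if "j \<le> d" for j
      using member_le_sum[of j "{..d}" \<alpha>] that by (simp add: coeff_exponents_def)
    then show "\<alpha> \<in> {..d} \<rightarrow>\<^sub>E {..i}" using a by (simp add: coeff_exponents_def PiE_iff)
  qed
qed (auto intro: finite_PiE)

lemma bounded_exponents_iff:
  "(b, c, \<alpha>) \<in> bounded_exponents d M i n \<longleftrightarrow>
     \<alpha> \<in> coeff_exponents d i \<and> b + c \<le> M \<and> int c - int b + a_weight d \<alpha> = n"
  by (auto simp: bounded_exponents_def coeff_exponents_def exponents_def u_degree_def a_degree_def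
      weight_def)

lemma sum_reflect: "(\<Sum>j\<le>d. f (d - j)) = (\<Sum>j\<le>d. f j)" for f :: "nat \<Rightarrow> 'a::comm_monoid_add"
  by (rule sum.reindex_bij_witness[of _ "\<lambda>j. d - j" "\<lambda>j. d - j"]) auto

text \<open>
  Exchanging \<open>a j\<close> with \<open>a (d - j)\<close> changes the sign of the weight.
\<close>

lemma card_nonneg_weight_eq_card_nonpos_weight:
  "card {\<alpha> \<in> coeff_exponents d i. a_weight d \<alpha> \<ge> 0} = card {\<alpha> \<in> coeff_exponents d i. a_weight d \<alpha> \<le> 0}"
proof -
  define r where "r \<alpha> = restrict (\<lambda>j. \<alpha> (d - j)) {..d}" for \<alpha> :: "nat \<Rightarrow> nat"
  have mem: "r \<alpha> \<in> coeff_exponents d i" if "\<alpha> \<in> coeff_exponents d i" for \<alpha>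
    using that sum_reflect[of \<alpha> d] by (simp add: coeff_exponents_def r_def restrict_PiE_iff)
  have rr: "r (r \<alpha>) = \<alpha>" if "\<alpha> \<in> coeff_exponents d i" for \<alpha>
  proof
    fix j show "r (r \<alpha>) j = \<alpha> j"
      using that by (cases "j \<le> d") (auto simp: r_def coeff_exponents_def PiE_iff extensional_def)
  qed
  have wt: "a_weight d (r \<alpha>) = - a_weight d \<alpha>" for \<alpha>
  proof -
    have "a_weight d (r \<alpha>) = (\<Sum>j\<le>d. - ((2 * int (d - j) - int d) * int (\<alpha> (d - j))))"
      unfolding a_weight_def by (rule sum.cong) (auto simp: r_def of_nat_diff algebra_simps)
    also have "\<dots> = (\<Sum>j\<le>d. - ((2 * int j - int d) * int (\<alpha> j)))" by (rule sum_reflect)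
    finally show ?thesis by (simp add: a_weight_def sum_negf)
  qed
  show ?thesis
    by (rule bij_betw_same_card[OF bij_betw_byWitness[where f = r and f' = r]]) (auto simp: mem rr wt)
qed

text \<open>
  Replacing a factor \<open>u 0\<close> by \<open>u 1\<close> raises the weight by \<open>2\<close>; it matches the monomials of weight \<open>0\<close>
  divisible by \<open>u 0\<close> with those of weight \<open>2\<close> divisible by \<open>u 1\<close>. The unmatched ones consist of a
  monomial in \<open>a\<close>, of weight at most \<open>0\<close> or at least \<open>2\<close>, and the power of \<open>u 1\<close> or \<open>u 0\<close> that
  corrects the weight; for \<open>d * i \<le> M\<close> this power is within the bound. By symmetry the difference
  of the two counts is the number of monomials in \<open>a\<close> of weight \<open>0\<close> or \<open>1\<close>.
\<close>

lemma card_weight_0_minus_card_weight_2: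
  assumes "d * i \<le> M"
  shows "card (bounded_exponents d M i 0) =
    card (bounded_exponents d M i 2) + card {\<alpha> \<in> coeff_exponents d i. a_weight d \<alpha> \<in> {0, 1}}"
proof -
  let ?A = "coeff_exponents d i"
  let ?B0 = "bounded_exponents d M i 0" and ?B2 = "bounded_exponents d M i 2"
  have bound: "\<bar>a_weight d \<alpha>\<bar> \<le> int M" if "\<alpha> \<in> ?A" for \<alpha>
  proof -
    have "(\<Sum>j\<le>d. \<alpha> j) = i" using that by (simp add: coeff_exponents_def)
    then have "\<bar>a_weight d \<alpha>\<bar> \<le> int (d * i)"
      using abs_a_weight_le[of d \<alpha>] by (simp only: of_nat_mult)
    then show ?thesis using assms by linarith
  qed
  have fin: "finite ?B0" "finite ?B2" by (rule finite_bounded_exponents)+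
  have "card {e \<in> ?B0. fst e \<noteq> 0} = card {e \<in> ?B2. fst (snd e) \<noteq> 0}"
    by (rule bij_betw_same_card[OF bij_betw_byWitness[where
            f = "\<lambda>(b, c, \<alpha>). (b - 1, c + 1, \<alpha>)" and f' = "\<lambda>(b, c, \<alpha>). (b + 1, c - 1, \<alpha>)"]])
      (auto simp: bounded_exponents_iff)
  moreover have "card {e \<in> ?B0. fst e = 0} = card {\<alpha> \<in> ?A. a_weight d \<alpha> \<le> 0}"
    by (rule bij_betw_same_card[OF bij_betw_byWitness[where
            f = "\<lambda>(b, c, \<alpha>). \<alpha>" and f' = "\<lambda>\<alpha>. (0, nat (- a_weight d \<alpha>), \<alpha>)"]])
      (use bound in \<open>fastforce simp: bounded_exponents_iff\<close>)+
  moreover have "card {e \<in> ?B2. fst (snd e) = 0} = card {\<alpha> \<in> ?A. a_weight d \<alpha> \<ge> 2}"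
    by (rule bij_betw_same_card[OF bij_betw_byWitness[where
            f = "\<lambda>(b, c, \<alpha>). \<alpha>" and f' = "\<lambda>\<alpha>. (nat (a_weight d \<alpha> - 2), 0, \<alpha>)"]])
      (use bound in \<open>fastforce simp: bounded_exponents_iff\<close>)+
  moreover have "card ?B0 = card {e \<in> ?B0. fst e \<noteq> 0} + card {e \<in> ?B0. fst e = 0}"
    using fin by (subst card_Un_disjoint[symmetric]) (auto intro!: arg_cong[where f = card])
  moreover have "card ?B2 = card {e \<in> ?B2. fst (snd e) \<noteq> 0} + card {e \<in> ?B2. fst (snd e) = 0}"
    using fin by (subst card_Un_disjoint[symmetric]) (auto intro!: arg_cong[where f = card])
  moreover have "card {\<alpha> \<in> ?A. a_weight d \<alpha> \<ge> 0} =
      card {\<alpha> \<in> ?A. a_weight d \<alpha> \<ge> 2} + card {\<alpha> \<in> ?A. a_weight d \<alpha> \<in> {0, 1}}"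
    using finite_coeff_exponents
    by (subst card_Un_disjoint[symmetric]) (auto intro!: arg_cong[where f = card])
  ultimately show ?thesis using card_nonneg_weight_eq_card_nonpos_weight[of d i] by linarith
qed

definition invariant_space :: "nat \<Rightarrow> nat \<Rightarrow> nat \<Rightarrow> (coords \<Rightarrow> complex) set" where
  "invariant_space d M i = {F \<in> weight_space d M i 0. raising d F = 0}"

lemma dim_invariant_space:
  assumes "d * i \<le> M"
  shows "cfun.dim (invariant_space d M i) = card {\<alpha> \<in> coeff_exponents d i. a_weight d \<alpha> \<in> {0, 1}}"
proof -
  interpret sl2: sl2_weight_module "\<lambda>c F x. c * F x" "weight_space d M i" "raising d" "lowering d"
    by (rule sl2_weight_module_weight_space)
  have "cfun.dim (weight_space d M i 0) =
      cfun.dim {F \<in> weight_space d M i 0. raising d F = 0} + cfun.dim (weight_space d M i (0 + 2))"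
    by (rule sl2.dim_E_kernel[where S = "monomial d ` bounded_exponents d M i 0"])
      (auto simp: weight_space_def finite_bounded_exponents)
  then show ?thesis
    unfolding invariant_space_def dim_weight_space
    using card_weight_0_minus_card_weight_2[OF assms] by simp
qed

section \<open>From the Lie algebra to the group\<close>

lemma poly_cong:
  assumes "F \<in> polys d" "\<And>j. j \<le> 1 \<Longrightarrow> u j = u' j" "\<And>j. j \<le> d \<Longrightarrow> a j = a' j"
  shows "F (u, a) = F (u', a')"
  using assms(1) by (induction F) (use assms(2,3) in auto)

definition form_value :: "nat \<Rightarrow> (nat \<Rightarrow> complex) \<Rightarrow> complex \<Rightarrow> complex \<Rightarrow> complex" where
  "form_value n a x y = (\<Sum>i\<le>n. a i * x ^ (n - i) * y ^ i)"

lemma form_value_inject: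
  assumes "\<And>x y. form_value n a x y = form_value n b x y" "j \<le> n"
  shows "a j = b j"
proof -
  have "(\<Sum>i\<le>n. a i * y ^ i) = (\<Sum>i\<le>n. b i * y ^ i)" for y
    using assms(1)[of 1 y] by (simp add: form_value_def)
  then have "\<forall>i\<le>n. a i = b i" using polyfun_eq_coeffs[of a n b] by blast
  then show ?thesis using assms(2) by blast
qed

definition raise_flow :: "nat \<Rightarrow> complex \<Rightarrow> (nat \<Rightarrow> complex) \<Rightarrow> nat \<Rightarrow> complex" where
  "raise_flow n s a j = (\<Sum>k\<le>n. of_nat (k choose j) * s ^ (k - j) * a k)"

definition lower_flow :: "nat \<Rightarrow> complex \<Rightarrow> (nat \<Rightarrow> complex) \<Rightarrow> nat \<Rightarrow> complex" where
  "lower_flow n s a j = (\<Sum>k\<le>n. of_nat ((n - k) choose (n - j)) * s ^ (j - k) * a k)"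

lemma form_value_raise_flow: "form_value n (raise_flow n s a) x y = form_value n a x (s * x + y)"
proof -
  have *: "x ^ (n - k) * (y + s * x) ^ k = (\<Sum>j\<le>n. of_nat (k choose j) * s ^ (k - j) * x ^ (n - j) * y ^ j)"
    if "k \<le> n" for k
  proof -
    have "x ^ (n - k) * (y + s * x) ^ k = (\<Sum>j\<le>k. x ^ (n - k) * (of_nat (k choose j) * y ^ j * (s * x) ^ (k - j)))"
      by (simp add: binomial_ring sum_distrib_left)
    also have "\<dots> = (\<Sum>j\<le>k. of_nat (k choose j) * s ^ (k - j) * x ^ (n - j) * y ^ j)"
    proof (rule sum.cong[OF refl])
      fix j assume "j \<in> {..k}"
      then have "x ^ (n - j) = x ^ (n - k) * x ^ (k - j)" using that by (simp add: power_add[symmetric])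
      then show "x ^ (n - k) * (of_nat (k choose j) * y ^ j * (s * x) ^ (k - j)) =
          of_nat (k choose j) * s ^ (k - j) * x ^ (n - j) * y ^ j"
        by (simp add: power_mult_distrib)
    qed
    also have "\<dots> = (\<Sum>j\<le>n. of_nat (k choose j) * s ^ (k - j) * x ^ (n - j) * y ^ j)"
      by (rule sum.mono_neutral_left) (use that in \<open>auto simp: binomial_eq_0\<close>)
    finally show ?thesis .
  qed
  have "form_value n a x (s * x + y) = (\<Sum>k\<le>n. a k * (x ^ (n - k) * (y + s * x) ^ k))"
    unfolding form_value_def by (intro sum.cong refl) (simp add: add.commute mult.assoc)
  also have "\<dots> = (\<Sum>k\<le>n. \<Sum>j\<le>n. a k * (of_nat (k choose j) * s ^ (k - j) * x ^ (n - j) * y ^ j))"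
    by (intro sum.cong refl) (simp add: * sum_distrib_left)
  also have "\<dots> = (\<Sum>j\<le>n. \<Sum>k\<le>n. a k * (of_nat (k choose j) * s ^ (k - j) * x ^ (n - j) * y ^ j))"
    by (rule sum.swap)
  also have "\<dots> = form_value n (raise_flow n s a) x y"
    unfolding form_value_def raise_flow_def sum_distrib_right
    by (intro sum.cong refl) (simp add: mult_ac)
  finally show ?thesis by simp
qed

lemma form_value_lower_flow: "form_value n (lower_flow n s a) x y = form_value n a (x + s * y) y"
proof -
  have *: "(s * y + x) ^ (n - k) * y ^ k = (\<Sum>j\<le>n. of_nat ((n - k) choose (n - j)) * s ^ (j - k) * x ^ (n - j) * y ^ j)"
    if "k \<le> n" for k
  proof -
    have "(x + s * y) ^ (n - k) * y ^ k =
        (\<Sum>l\<le>n - k. of_nat ((n - k) choose l) * x ^ l * (s * y) ^ (n - k - l) * y ^ k)"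
      by (simp add: binomial_ring sum_distrib_right)
    also have "\<dots> = (\<Sum>l\<le>n. of_nat ((n - k) choose l) * x ^ l * (s * y) ^ (n - k - l) * y ^ k)"
      by (rule sum.mono_neutral_left) (auto simp: binomial_eq_0)
    also have "\<dots> = (\<Sum>j\<le>n. of_nat ((n - k) choose (n - j)) * x ^ (n - j) * (s * y) ^ (n - k - (n - j)) * y ^ k)"
      by (rule sum_reflect[symmetric])
    also have "\<dots> = (\<Sum>j\<le>n. of_nat ((n - k) choose (n - j)) * s ^ (j - k) * x ^ (n - j) * y ^ j)"
    proof (rule sum.cong[OF refl])
      fix j assume j: "j \<in> {..n}"
      show "of_nat ((n - k) choose (n - j)) * x ^ (n - j) * (s * y) ^ (n - k - (n - j)) * y ^ k =
          of_nat ((n - k) choose (n - j)) * s ^ (j - k) * x ^ (n - j) * y ^ j"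
      proof (cases "k \<le> j")
        case True
        then have "y ^ j = y ^ (j - k) * y ^ k" by (simp add: power_add[symmetric])
        moreover have "n - k - (n - j) = j - k" using True j by auto
        ultimately show ?thesis by (simp add: power_mult_distrib)
      next
        case False
        then show ?thesis using that j by (simp add: binomial_eq_0)
      qed
    qed
    finally show ?thesis by (simp add: add.commute)
  qed
  have "form_value n a (x + s * y) y = (\<Sum>k\<le>n. a k * ((s * y + x) ^ (n - k) * y ^ k))"
    unfolding form_value_def by (intro sum.cong refl) (simp add: add.commute mult.assoc)
  also have "\<dots> = (\<Sum>k\<le>n. \<Sum>j\<le>n. a k * (of_nat ((n - k) choose (n - j)) * s ^ (j - k) * x ^ (n - j) * y ^ j))"
    by (intro sum.cong refl) (simp add: * sum_distrib_left)
  also have "\<dots> = (\<Sum>j\<le>n. \<Sum>k\<le>n. a k * (of_nat ((n - k) choose (n - j)) * s ^ (j - k) * x ^ (n - j) * y ^ j))"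
    by (rule sum.swap)
  also have "\<dots> = form_value n (lower_flow n s a) x y"
    unfolding form_value_def lower_flow_def sum_distrib_right
    by (intro sum.cong refl) (simp add: mult_ac)
  finally show ?thesis by simp
qed

lemma Suc_times_binomial_Suc: "Suc k * (n choose Suc k) = (n - k) * (n choose k)"
  by (metis binomial_absorption binomial_absorb_comp)

lemma raise_flow_deriv:
  assumes "j \<le> n"
  shows "((\<lambda>s. raise_flow n s a j) has_field_derivative raise_coeffs n (raise_flow n s a) j) (at s)"
proof -
  have "((\<lambda>s. raise_flow n s a j) has_field_derivative
      (\<Sum>k\<le>n. of_nat (k choose j) * (of_nat (k - j) * s ^ (k - j - 1)) * a k)) (at s)"
    unfolding raise_flow_def by (auto intro!: derivative_eq_intros sum.cong)
  also have "(\<Sum>k\<le>n. of_nat (k choose j) * (of_nat (k - j) * s ^ (k - j - 1)) * a k) =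
      (\<Sum>k\<le>n. of_nat (Suc j) * (of_nat (k choose Suc j) * s ^ (k - Suc j) * a k))"
  proof (intro sum.cong refl)
    fix k
    have "(of_nat (k choose j) * of_nat (k - j) :: complex) = of_nat (Suc j * (k choose Suc j))"
      unfolding Suc_times_binomial_Suc by simp
    also have "\<dots> = of_nat (Suc j) * of_nat (k choose Suc j)" by (rule of_nat_mult)
    finally show "of_nat (k choose j) * (of_nat (k - j) * s ^ (k - j - 1)) * a k =
        of_nat (Suc j) * (of_nat (k choose Suc j) * s ^ (k - Suc j) * a k)"
      by (simp add: mult.assoc[symmetric] del: of_nat_Suc)
  qed
  also have "\<dots> = of_nat (Suc j) * raise_flow n s a (Suc j)"
    unfolding raise_flow_def by (simp add: sum_distrib_left)
  also have "\<dots> = raise_coeffs n (raise_flow n s a) j"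
    using assms by (auto simp: raise_coeffs_def raise_flow_def binomial_eq_0)
  finally show ?thesis .
qed

lemma lower_flow_deriv:
  assumes "j \<le> n"
  shows "((\<lambda>s. lower_flow n s a j) has_field_derivative lower_coeffs n (lower_flow n s a) j) (at s)"
proof -
  have "((\<lambda>s. lower_flow n s a j) has_field_derivative
      (\<Sum>k\<le>n. of_nat ((n - k) choose (n - j)) * (of_nat (j - k) * s ^ (j - k - 1)) * a k)) (at s)"
    unfolding lower_flow_def by (auto intro!: derivative_eq_intros sum.cong)
  also have "(\<Sum>k\<le>n. of_nat ((n - k) choose (n - j)) * (of_nat (j - k) * s ^ (j - k - 1)) * a k) =
      (\<Sum>k\<le>n. of_nat (Suc (n - j)) * (of_nat ((n - k) choose Suc (n - j)) * s ^ (j - 1 - k) * a k))"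
  proof (intro sum.cong refl)
    fix k assume k: "k \<in> {..n}"
    have "(of_nat ((n - k) choose (n - j)) * of_nat (j - k) :: complex) =
        of_nat (Suc (n - j) * ((n - k) choose Suc (n - j)))"
      unfolding Suc_times_binomial_Suc using assms k
      by (cases "k \<le> j") (simp_all add: binomial_eq_0)
    also have "\<dots> = of_nat (Suc (n - j)) * of_nat ((n - k) choose Suc (n - j))" by (rule of_nat_mult)
    finally show "of_nat ((n - k) choose (n - j)) * (of_nat (j - k) * s ^ (j - k - 1)) * a k =
        of_nat (Suc (n - j)) * (of_nat ((n - k) choose Suc (n - j)) * s ^ (j - 1 - k) * a k)"
      by (simp add: mult.assoc[symmetric] del: of_nat_Suc)
  qed
  also have "\<dots> = lower_coeffs n (lower_flow n s a) j"
  proof (cases j)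
    case 0
    then show ?thesis by (simp add: lower_coeffs_def binomial_eq_0)
  next
    case (Suc i)
    then have "Suc (n - j) = n - i" "Suc n - j = n - i" using assms by auto
    then show ?thesis
      using Suc by (simp add: lower_coeffs_def lower_flow_def sum_distrib_left del: of_nat_Suc)
  qed
  finally show ?thesis .
qed

definition substitution :: "complex \<Rightarrow> complex \<Rightarrow> complex \<Rightarrow> complex \<Rightarrow> nat \<Rightarrow> (nat \<Rightarrow> complex) \<Rightarrow> (nat \<Rightarrow> complex) \<Rightarrow> bool" where
  "substitution p q r t n a a' \<longleftrightarrow>
     (\<forall>x y. form_value n a' x y = form_value n a (p * x + q * y) (r * x + t * y))"

definition invariant_under :: "nat \<Rightarrow> (coords \<Rightarrow> complex) \<Rightarrow> complex \<Rightarrow> complex \<Rightarrow> complex \<Rightarrow> complex \<Rightarrow> bool" where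
  "invariant_under d F p q r t \<longleftrightarrow>
     (\<forall>u a u' a'. substitution p q r t 1 u u' \<longrightarrow> substitution p q r t d a a' \<longrightarrow> F (u', a') = F (u, a))"

lemma substitution_raise_flow: "substitution 1 0 s 1 n a (raise_flow n s a)"
  by (simp add: substitution_def form_value_raise_flow)

lemma substitution_lower_flow: "substitution 1 s 0 1 n a (lower_flow n s a)"
  by (simp add: substitution_def form_value_lower_flow)

lemma invariant_under_cong:
  assumes "F \<in> polys d" "\<And>u a. \<exists>u' a'. substitution p q r t 1 u u' \<and> substitution p q r t d a a' \<and> F (u', a') = F (u, a)"
  shows "invariant_under d F p q r t"
  unfolding invariant_under_def
proof (intro allI impI)
  fix u a u' a' assume sub: "substitution p q r t 1 u u'" "substitution p q r t d a a'"
  obtain u'' a'' where *: "substitution p q r t 1 u u''" "substitution p q r t d a a''"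
      "F (u'', a'') = F (u, a)" using assms(2) by blast
  have "F (u', a') = F (u'', a'')"
    by (rule poly_cong[OF assms(1)]; rule form_value_inject)
      (use sub * in \<open>simp_all add: substitution_def\<close>)
  then show "F (u', a') = F (u, a)" using *(3) by simp
qed

lemma raise_flow_0: "j \<le> n \<Longrightarrow> raise_flow n 0 a j = a j"
  using form_value_inject[of n "raise_flow n 0 a" a j] by (simp add: form_value_raise_flow)

lemma lower_flow_0: "j \<le> n \<Longrightarrow> lower_flow n 0 a j = a j"
  using form_value_inject[of n "lower_flow n 0 a" a j] by (simp add: form_value_lower_flow)

lemma poly_along_raise_flow:
  assumes "F \<in> polys d"
  shows "((\<lambda>s. F (raise_flow 1 s u, raise_flow d s a)) has_field_derivative
    raising d F (raise_flow 1 s u, raise_flow d s a)) (at s)"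
  unfolding raising_def lie_derivative_def
  using poly_chain_rule[OF assms, of "\<lambda>s. (raise_flow 1 s u, raise_flow d s a)"
      "(raise_coeffs 1 (raise_flow 1 s u), raise_coeffs d (raise_flow d s a))" s]
  by (simp add: raise_flow_deriv[of _ 1, simplified] raise_flow_deriv)

lemma poly_along_lower_flow:
  assumes "F \<in> polys d"
  shows "((\<lambda>s. F (lower_flow 1 s u, lower_flow d s a)) has_field_derivative
    lowering d F (lower_flow 1 s u, lower_flow d s a)) (at s)"
  unfolding lowering_def lie_derivative_def
  using poly_chain_rule[OF assms, of "\<lambda>s. (lower_flow 1 s u, lower_flow d s a)"
      "(lower_coeffs 1 (lower_flow 1 s u), lower_coeffs d (lower_flow d s a))" s]
  by (simp add: lower_flow_deriv[of _ 1, simplified] lower_flow_deriv)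

text \<open>
  The substitutions \<open>y := y + s x\<close> form a one-parameter group, realised on coefficients by
  \<open>raise_flow\<close>, with infinitesimal generator \<open>raising\<close>. So \<open>raising d F\<close> is the derivative of \<open>F\<close> along
  the orbits of that group.
\<close>

lemma raising_eq_0_iff:
  assumes F: "F \<in> polys d"
  shows "raising d F = 0 \<longleftrightarrow> (\<forall>s. invariant_under d F 1 0 s 1)"
proof
  assume 0: "raising d F = 0"
  have "F (raise_flow 1 s u, raise_flow d s a) = F (u, a)" for s u a
  proof -
    have "F (raise_flow 1 s u, raise_flow d s a) = F (raise_flow 1 0 u, raise_flow d 0 a)"
    proof -
      have "((\<lambda>s. F (raise_flow 1 s u, raise_flow d s a)) has_field_derivative 0) (at r)" for r
        using poly_along_raise_flow[OF F, of u a r] by (simp add: 0)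
      then have "(\<lambda>s. F (raise_flow 1 s u, raise_flow d s a)) constant_on UNIV"
        by (rule has_field_derivative_0_imp_constant_on[OF _ connected_UNIV open_UNIV])
      then show ?thesis unfolding constant_on_def by auto
    qed
    also have "\<dots> = F (u, a)" by (rule poly_cong[OF F]) (simp_all only: raise_flow_0)
    finally show ?thesis .
  qed
  then show "\<forall>s. invariant_under d F 1 0 s 1"
    using invariant_under_cong[OF F] substitution_raise_flow by metis
next
  assume inv: "\<forall>s. invariant_under d F 1 0 s 1"
  show "raising d F = 0"
  proof
    fix p :: coords
    obtain u a where p: "p = (u, a)" by (cases p)
    have "F (raise_flow 1 s u, raise_flow d s a) = F (u, a)" for s
      using inv substitution_raise_flow unfolding invariant_under_def by blast
    then have "((\<lambda>_. F (u, a)) has_field_derivative raising d F (raise_flow 1 0 u, raise_flow d 0 a)) (at 0)"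
      using poly_along_raise_flow[OF F, of u a 0] by simp
    then have "raising d F (raise_flow 1 0 u, raise_flow d 0 a) = 0"
      using DERIV_unique[OF _ DERIV_const] by blast
    moreover have "raising d F (raise_flow 1 0 u, raise_flow d 0 a) = raising d F (u, a)"
      by (rule poly_cong[OF derivation_poly[OF derivation_raising F]]) (simp_all only: raise_flow_0)
    ultimately show "raising d F p = 0 p" by (simp add: p)
  qed
qed

lemma lowering_eq_0_iff:
  assumes F: "F \<in> polys d"
  shows "lowering d F = 0 \<longleftrightarrow> (\<forall>s. invariant_under d F 1 s 0 1)"
proof
  assume 0: "lowering d F = 0"
  have "F (lower_flow 1 s u, lower_flow d s a) = F (u, a)" for s u a
  proof -
    have "F (lower_flow 1 s u, lower_flow d s a) = F (lower_flow 1 0 u, lower_flow d 0 a)"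
    proof -
      have "((\<lambda>s. F (lower_flow 1 s u, lower_flow d s a)) has_field_derivative 0) (at r)" for r
        using poly_along_lower_flow[OF F, of u a r] by (simp add: 0)
      then have "(\<lambda>s. F (lower_flow 1 s u, lower_flow d s a)) constant_on UNIV"
        by (rule has_field_derivative_0_imp_constant_on[OF _ connected_UNIV open_UNIV])
      then show ?thesis unfolding constant_on_def by auto
    qed
    also have "\<dots> = F (u, a)" by (rule poly_cong[OF F]) (simp_all only: lower_flow_0)
    finally show ?thesis .
  qed
  then show "\<forall>s. invariant_under d F 1 s 0 1"
    using invariant_under_cong[OF F] substitution_lower_flow by metis
next
  assume inv: "\<forall>s. invariant_under d F 1 s 0 1"
  show "lowering d F = 0"
  proof
    fix p :: coords
    obtain u a where p: "p = (u, a)" by (cases p)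
    have "F (lower_flow 1 s u, lower_flow d s a) = F (u, a)" for s
      using inv substitution_lower_flow unfolding invariant_under_def by blast
    then have "((\<lambda>_. F (u, a)) has_field_derivative lowering d F (lower_flow 1 0 u, lower_flow d 0 a)) (at 0)"
      using poly_along_lower_flow[OF F, of u a 0] by simp
    then have "lowering d F (lower_flow 1 0 u, lower_flow d 0 a) = 0"
      using DERIV_unique[OF _ DERIV_const] by blast
    moreover have "lowering d F (lower_flow 1 0 u, lower_flow d 0 a) = lowering d F (u, a)"
      by (rule poly_cong[OF derivation_poly[OF derivation_lowering F]]) (simp_all only: lower_flow_0)
    ultimately show "lowering d F p = 0 p" by (simp add: p)
  qed
qed

lemma invariant_under_raise_first:
  assumes "invariant_under d F 1 0 s 1" "invariant_under d F p q r t"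
  shows "invariant_under d F p q (s * p + r) (s * q + t)"
  unfolding invariant_under_def
proof (intro allI impI)
  fix u a u' a'
  assume sub: "substitution p q (s * p + r) (s * q + t) 1 u u'" "substitution p q (s * p + r) (s * q + t) d a a'"
  have "F (raise_flow 1 s u, raise_flow d s a) = F (u, a)"
    using assms(1) substitution_raise_flow unfolding invariant_under_def by blast
  moreover have "substitution p q r t 1 (raise_flow 1 s u) u'" "substitution p q r t d (raise_flow d s a) a'"
    using sub unfolding substitution_def form_value_raise_flow by (simp_all add: algebra_simps)
  ultimately show "F (u', a') = F (u, a)"
    using assms(2) unfolding invariant_under_def by metis
qed

lemma invariant_under_lower_first:
  assumes "invariant_under d F 1 s 0 1" "invariant_under d F p q r t"
  shows "invariant_under d F (p + s * r) (q + s * t) r t"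
  unfolding invariant_under_def
proof (intro allI impI)
  fix u a u' a'
  assume sub: "substitution (p + s * r) (q + s * t) r t 1 u u'" "substitution (p + s * r) (q + s * t) r t d a a'"
  have "F (lower_flow 1 s u, lower_flow d s a) = F (u, a)"
    using assms(1) substitution_lower_flow unfolding invariant_under_def by blast
  moreover have "substitution p q r t 1 (lower_flow 1 s u) u'" "substitution p q r t d (lower_flow d s a) a'"
    using sub unfolding substitution_def form_value_lower_flow by (simp_all add: algebra_simps)
  ultimately show "F (u', a') = F (u, a)"
    using assms(2) unfolding invariant_under_def by metis
qed

text \<open>
  For \<open>r \<noteq> 0\<close> the matrix with rows \<open>(p, q)\<close> and \<open>(r, t)\<close> is the product of the unipotent matrices with
  rows \<open>(1, (p - 1) / r)\<close>, \<open>(0, 1)\<close>; \<open>(1, 0)\<close>, \<open>(r, 1)\<close>; and \<open>(1, (t - 1) / r)\<close>, \<open>(0, 1)\<close>. For \<open>r = 0\<close>,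
  adding the first row to the second leads back to that case.
\<close>

lemma invariant_under_unimodular:
  assumes L: "\<And>s. invariant_under d F 1 0 s 1" and U: "\<And>s. invariant_under d F 1 s 0 1"
    and det: "p * t - q * r = 1"
  shows "invariant_under d F p q r t"
proof -
  have *: "invariant_under d F p q r t" if "r \<noteq> 0" "p * t - q * r = 1" for p q r t
  proof -
    have "invariant_under d F 1 ((t - 1) / r) (r * 1 + 0) (r * ((t - 1) / r) + 1)"
      by (rule invariant_under_raise_first[OF L U])
    then have "invariant_under d F 1 ((t - 1) / r) r t" using that by simp
    then have "invariant_under d F (1 + (p - 1) / r * r) ((t - 1) / r + (p - 1) / r * t) r t"
      by (rule invariant_under_lower_first[OF U])
    moreover have "(t - 1) / r + (p - 1) / r * t = q"
    proof -
      have "(t - 1) + (p - 1) * t = q * r" using that(2) by (simp add: algebra_simps)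
      then show ?thesis using that(1) by (simp add: divide_simps)
    qed
    ultimately show ?thesis using that(1) by simp
  qed
  show ?thesis
  proof (cases "r = 0")
    case True
    then have "p \<noteq> 0" using det by auto
    moreover have "p * (q + t) - q * p = 1" using det True by (simp add: algebra_simps)
    ultimately have "invariant_under d F p q p (q + t)" by (rule *)
    then have "invariant_under d F p q (- 1 * p + p) (- 1 * q + (q + t))"
      by (rule invariant_under_raise_first[OF L])
    then show ?thesis using True by simp
  qed (rule *[OF _ det])
qed

lemma matrix_inv_eqI:
  fixes A B :: "'a::field ^ 'n ^ 'n"
  assumes "A ** B = mat 1"
  shows "matrix_inv A = B"
proof -
  have BA: "B ** A = mat 1" using assms matrix_left_right_inverse by blast
  show ?thesis unfolding matrix_inv_def
  proof (rule some_equality)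
    fix C assume "A ** C = mat 1 \<and> C ** A = mat 1"
    then have "C = (B ** A) ** C" "B = B ** (A ** C)" by (simp_all add: BA)
    then show "C = B" by (metis matrix_mul_assoc)
  qed (simp add: assms BA)
qed

lemma binary_form_eq_form_value: "binary_form n a v = form_value n a (v $ 1) (v $ 2)"
  by (simp add: binary_form_def form_value_def)

lemma form_action_iff_substitution:
  "binary_form n a' = form_action g (binary_form n a) \<longleftrightarrow>
   substitution (matrix_inv g $ 1 $ 1) (matrix_inv g $ 1 $ 2) (matrix_inv g $ 2 $ 1) (matrix_inv g $ 2 $ 2) n a a'"
proof -
  have "(\<forall>v :: complex ^ 2. P (v $ 1) (v $ 2)) \<longleftrightarrow> (\<forall>x y. P x y)" for P
  proof
    assume *: "\<forall>v :: complex ^ 2. P (v $ 1) (v $ 2)"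
    show "\<forall>x y. P x y"
      using *[THEN spec, of "vector [_, _]"] by (simp add: vector_2)
  qed simp
  from this[of "\<lambda>x y. form_value n a' x y =
      form_value n a (matrix_inv g $ 1 $ 1 * x + matrix_inv g $ 1 $ 2 * y)
        (matrix_inv g $ 2 $ 1 * x + matrix_inv g $ 2 $ 2 * y)"]
  show ?thesis
    by (simp add: fun_eq_iff form_action_def binary_form_eq_form_value substitution_def
        matrix_vector_mult_def sum_2)
qed

lemma SL2_invariant_iff:
  assumes F: "F \<in> polys d"
  shows "SL2_invariant d F \<longleftrightarrow> raising d F = 0 \<and> lowering d F = 0"
proof -
  have inv_iff: "SL2_invariant d F \<longleftrightarrow> (\<forall>g\<in>SL2. invariant_under d F (matrix_inv g $ 1 $ 1)
      (matrix_inv g $ 1 $ 2) (matrix_inv g $ 2 $ 1) (matrix_inv g $ 2 $ 2))"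
    unfolding SL2_invariant_def invariant_under_def form_action_iff_substitution by blast
  show ?thesis
    unfolding raising_eq_0_iff[OF F] lowering_eq_0_iff[OF F] inv_iff
  proof (intro iffI conjI allI ballI)
    fix s
    assume *: "\<forall>g\<in>SL2. invariant_under d F (matrix_inv g $ 1 $ 1)
      (matrix_inv g $ 1 $ 2) (matrix_inv g $ 2 $ 1) (matrix_inv g $ 2 $ 2)"
    \<comment> \<open>The action substitutes the inverse matrix, so the substitution by \<open>s\<close> comes from the matrix with \<open>- s\<close>.\<close>
    let ?m = "\<lambda>p q r t. vector [vector [p, q], vector [r, t]] :: complex ^ 2 ^ 2"
    have inv: "matrix_inv (?m p q r t) = ?m p' q' r' t'"
      if "p * p' + q * r' = 1" "p * q' + q * t' = 0" "r * p' + t * r' = 0" "r * q' + t * t' = 1"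
      for p q r t p' q' r' t'
      by (rule matrix_inv_eqI)
        (use that in \<open>simp add: vec_eq_iff matrix_matrix_mult_def mat_def forall_2 sum_2\<close>)
    have "?m 1 0 (- s) 1 \<in> SL2" "?m 1 (- s) 0 1 \<in> SL2" by (simp_all add: SL2_def det_2)
    moreover have "matrix_inv (?m 1 0 (- s) 1) = ?m 1 0 s 1" "matrix_inv (?m 1 (- s) 0 1) = ?m 1 s 0 1"
      by (rule inv; simp)+
    ultimately show "invariant_under d F 1 0 s 1" "invariant_under d F 1 s 0 1"
      using * by (force simp: vector_2)+
  next
    fix g :: "complex ^ 2 ^ 2"
    assume *: "(\<forall>s. invariant_under d F 1 0 s 1) \<and> (\<forall>s. invariant_under d F 1 s 0 1)" and g: "g \<in> SL2"
    have "invertible g" using g by (simp add: SL2_def invertible_det_nz)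
    then obtain h where "g ** h = mat 1" unfolding invertible_def by blast
    then have "det (g ** matrix_inv g) = 1" using matrix_inv_eqI[of g h] by (simp add: det_I)
    then have "det (matrix_inv g) = 1" using g by (simp add: det_mul SL2_def)
    then have det: "matrix_inv g $ 1 $ 1 * matrix_inv g $ 2 $ 2 -
        matrix_inv g $ 1 $ 2 * matrix_inv g $ 2 $ 1 = 1" by (simp add: det_2)
    show "invariant_under d F (matrix_inv g $ 1 $ 1)
      (matrix_inv g $ 1 $ 2) (matrix_inv g $ 2 $ 1) (matrix_inv g $ 2 $ 2)"
      by (rule invariant_under_unimodular[OF _ _ det]) (use * in simp_all)
  qed
qed

lemma lowering_invariant_space:
  "F \<in> invariant_space d M i \<Longrightarrow> lowering d F = 0"
  unfolding invariant_space_def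
  using sl2_weight_module.F_eq_0_of_weight_0[OF sl2_weight_module_weight_space] by blast

text \<open>
  The weight of an invariant is \<open>0\<close> because the weight operator is the commutator of \<open>raising\<close> and
  \<open>lowering\<close>; homogeneity in \<open>a\<close>, differentiated at \<open>t = 1\<close>, is an eigenvalue equation for a grading.
  So only monomials of weight \<open>0\<close> and degree \<open>i\<close> in \<open>a\<close> occur, and finitely many of them have
  bounded degree in \<open>u\<close>.
\<close>

lemma covariants_of_degree_eq_union:
  "covariants_of_degree d i = (\<Union>M. invariant_space d M i)"
proof (intro equalityI subsetI)
  fix F assume "F \<in> covariants_of_degree d i"
  then have F: "F \<in> polys d" and inv: "SL2_invariant d F"
    and hom: "\<And>t u a. F (u, \<lambda>j. t * a j) = t ^ i * F (u, a)"
    by (auto simp: covariants_of_degree_def covariants_def)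
  have E: "raising d F = 0" and L: "lowering d F = 0" using inv SL2_invariant_iff[OF F] by auto
  have 0: "raising d 0 = 0" "lowering d 0 = 0"
    using derivation_const[OF derivation_raising, of d 0] derivation_const[OF derivation_lowering, of d 0]
    by (simp_all add: zero_fun_def)
  have H: "grading d 1 0 0 F = (\<lambda>p. 0 * F p)"
    using commutator_raising_lowering[OF F] by (simp add: E L 0)
  have A: "grading d 0 0 1 F = (\<lambda>p. of_nat i * F p)"
    unfolding grading_def lie_derivative_def
  proof (rule ext, rule directional_derivative_eqI)
    fix p :: coords
    obtain u a where p: "p = (u, a)" by (cases p)
    have "(\<lambda>s. F (u, \<lambda>j. a j + s * a j)) = (\<lambda>s. (1 + s) ^ i * F (u, a))"
      using hom[of u "1 + _" a] by (simp add: distrib_right)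
    moreover have "((\<lambda>s. (1 + s) ^ i * F (u, a)) has_field_derivative of_nat i * F (u, a)) (at 0)"
      by (auto intro!: derivative_eq_intros)
    ultimately show "((\<lambda>s. F
        (\<lambda>j. fst p j + s * fst (case p of (u, a) \<Rightarrow>
            (\<lambda>j. (0 * (2 * of_nat j - 1) + 0) * u j, \<lambda>j. (0 * (2 * of_nat j - of_nat d) + 1) * a j)) j,
         \<lambda>j. snd p j + s * snd (case p of (u, a) \<Rightarrow>
            (\<lambda>j. (0 * (2 * of_nat j - 1) + 0) * u j, \<lambda>j. (0 * (2 * of_nat j - of_nat d) + 1) * a j)) j))
        has_field_derivative of_nat i * F p) (at 0)"
      by (simp add: p)
  qed
  obtain S c where S: "finite S" "S \<subseteq> exponents d" "\<And>e. e \<in> S \<Longrightarrow> c e \<noteq> 0"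
      "F = (\<lambda>p. \<Sum>e\<in>S. c e * monomial d e p)"
    by (rule span_monomial_obtain[OF poly_in_span_monomials[OF F] order_refl]) blast
  have deg: "weight d e = 0 \<and> a_degree d e = i" if "e \<in> S" for e
    using grading_eigenvalue[OF S H that] grading_eigenvalue[OF S A that] by (simp add: grade_def)
  let ?M = "\<Sum>e\<in>S. u_degree e"
  have "S \<subseteq> bounded_exponents d ?M i 0"
    using S(2) deg member_le_sum[OF _ _ S(1), of _ u_degree] by (auto simp: bounded_exponents_def)
  then have "F \<in> invariant_space d ?M i"
    unfolding invariant_space_def weight_space_def S(4)
    using E[unfolded S(4)] sum_monomials_in_span[OF S(1)] by blast
  then show "F \<in> (\<Union>M. invariant_space d M i)" by blast
next
  fix F assume "F \<in> (\<Union>M. invariant_space d M i)"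
  then obtain M where M: "F \<in> invariant_space d M i" by blast
  then have W: "F \<in> weight_space d M i 0" and E: "raising d F = 0"
    by (auto simp: invariant_space_def)
  have F: "F \<in> polys d" by (rule weight_space_poly[OF W])
  have "SL2_invariant d F" using SL2_invariant_iff[OF F] E lowering_invariant_space[OF M] by simp
  moreover have "F (u, \<lambda>j. t * a j) = t ^ i * F (u, a)" for t u a
  proof -
    obtain S c where S: "finite S" "S \<subseteq> bounded_exponents d M i 0"
        "F = (\<lambda>p. \<Sum>e\<in>S. c e * monomial d e p)"
      by (rule span_monomial_obtain[OF W[unfolded weight_space_def] bounded_exponents_subset]) blast
    have "monomial d e (u, \<lambda>j. t * a j) = t ^ i * monomial d e (u, a)" if "e \<in> S" for e
    proof -
      obtain b c \<alpha> where e: "e = (b, c, \<alpha>)" by (cases e)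
      have "(\<Sum>j\<le>d. \<alpha> j) = i"
        using S(2) that by (auto simp: e bounded_exponents_def a_degree_def)
      then show ?thesis
        by (simp add: e monomial_def power_mult_distrib prod.distrib power_sum[symmetric])
    qed
    then show ?thesis unfolding S(3) by (simp add: sum_distrib_left mult.left_commute)
  qed
  ultimately show "F \<in> covariants_of_degree d i"
    using F by (simp add: covariants_of_degree_def covariants_def)
qed

text \<open>
  The spaces \<open>invariant_space d M i\<close> increase with \<open>M\<close>, and their dimension is constant from
  \<open>M = d * i\<close> on, so the union is attained there.
\<close>

theorem dim_covariants_of_degree:
  "cfun.dim (covariants_of_degree d i) = card {\<alpha> \<in> coeff_exponents d i. a_weight d \<alpha> \<in> {0, 1}}"
proof -
  have mono: "invariant_space d (d * i) i \<subseteq> invariant_space d M i" if "d * i \<le> M" for M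
  proof -
    have "weight_space d (d * i) i 0 \<subseteq> weight_space d M i 0"
      unfolding weight_space_def
      by (intro cfun.span_mono image_mono) (use that in \<open>auto simp: bounded_exponents_def\<close>)
    then show ?thesis by (auto simp: invariant_space_def)
  qed
  have sub: "cfun.subspace (invariant_space d (d * i) i)"
  proof (rule cfun.subspaceI)
    interpret sl2: sl2_weight_module "\<lambda>c F x. c * F x" "weight_space d (d * i) i" "raising d" "lowering d"
      by (rule sl2_weight_module_weight_space)
    note W = sl2.subspace_W
    show "0 \<in> invariant_space d (d * i) i"
      by (simp add: invariant_space_def sl2.E_0 cfun.subspace_0[OF W])
    show "F + G \<in> invariant_space d (d * i) i"
      if "F \<in> invariant_space d (d * i) i" "G \<in> invariant_space d (d * i) i" for F G
      using that sl2.E_add[of F 0 G] cfun.subspace_add[OF W] by (simp add: invariant_space_def)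
    show "(\<lambda>x. c * F x) \<in> invariant_space d (d * i) i"
      if "F \<in> invariant_space d (d * i) i" for c F
      using that sl2.E_scale[of F 0 c] cfun.subspace_scale[OF W, of F 0 c]
      by (auto simp: invariant_space_def fun_eq_iff)
  qed
  have eq: "invariant_space d M i = invariant_space d (d * i) i" if "d * i \<le> M" for M
  proof (rule sym, rule cfun.eq_of_subset_of_dim_eq[OF sub mono[OF that]])
    show "invariant_space d M i \<subseteq> cfun.span (monomial d ` bounded_exponents d M i 0)"
      by (auto simp: invariant_space_def weight_space_def)
    show "finite (monomial d ` bounded_exponents d M i 0)" by (intro finite_imageI finite_bounded_exponents)
    show "cfun.dim (invariant_space d (d * i) i) = cfun.dim (invariant_space d M i)"
      using dim_invariant_space[OF order_refl] dim_invariant_space[OF that] by simp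
  qed
  have "invariant_space d M i \<subseteq> invariant_space d (d * i) i" for M
  proof -
    have "weight_space d M i 0 \<subseteq> weight_space d (max M (d * i)) i 0"
      unfolding weight_space_def
      by (intro cfun.span_mono image_mono) (auto simp: bounded_exponents_def)
    then have "invariant_space d M i \<subseteq> invariant_space d (max M (d * i)) i"
      by (auto simp: invariant_space_def)
    then show ?thesis using eq[of "max M (d * i)"] by simp
  qed
  then have "covariants_of_degree d i = invariant_space d (d * i) i"
    unfolding covariants_of_degree_eq_union by blast
  then show ?thesis using dim_invariant_space[OF order_refl] by simp
qed

section \<open>The Poincare series as an integral\<close>

lemma summable_on_prod_powers:
  fixes r :: "nat \<Rightarrow> real"
  assumes r: "\<And>j. j \<le> d \<Longrightarrow> 0 \<le> r j \<and> r j < 1"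
  shows "(\<lambda>\<alpha>. \<Prod>j\<le>d. r j ^ \<alpha> j) summable_on ({..d} \<rightarrow>\<^sub>E UNIV)"
proof (rule nonneg_bdd_above_summable_on)
  show "0 \<le> (\<Prod>j\<le>d. r j ^ \<alpha> j)" for \<alpha> :: "nat \<Rightarrow> nat"
    by (rule prod_nonneg) (use r in auto)
  have "(\<Sum>\<alpha>\<in>S. \<Prod>j\<le>d. r j ^ \<alpha> j) \<le> (\<Prod>j\<le>d. 1 / (1 - r j))"
    if S: "finite S" "S \<subseteq> {..d} \<rightarrow>\<^sub>E UNIV" for S
  proof -
    let ?N = "\<Sum>\<alpha>\<in>S. \<Sum>j\<le>d. \<alpha> j"
    have "\<alpha> j \<le> ?N" if "\<alpha> \<in> S" "j \<le> d" for \<alpha> j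
    proof -
      have "\<alpha> j \<le> (\<Sum>j\<le>d. \<alpha> j)" by (rule member_le_sum) (use that in auto)
      also have "\<dots> \<le> ?N" by (rule member_le_sum) (use that S in auto)
      finally show ?thesis .
    qed
    then have sub: "S \<subseteq> {..d} \<rightarrow>\<^sub>E {..?N}"
      using S(2) by (auto simp: PiE_iff)
    have "(\<Sum>\<alpha>\<in>S. \<Prod>j\<le>d. r j ^ \<alpha> j) \<le> (\<Sum>\<alpha>\<in>{..d} \<rightarrow>\<^sub>E {..?N}. \<Prod>j\<le>d. r j ^ \<alpha> j)"
      by (rule sum_mono2[OF _ sub]) (use r in \<open>auto intro!: finite_PiE prod_nonneg\<close>)
    also have "\<dots> = (\<Prod>j\<le>d. \<Sum>k\<le>?N. r j ^ k)"
      by (rule prod_sum_PiE[symmetric]) auto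
    also have "\<dots> \<le> (\<Prod>j\<le>d. 1 / (1 - r j))"
    proof (rule prod_mono)
      fix j assume "j \<in> {..d}"
      then have rj: "0 \<le> r j" "r j < 1" using r by auto
      have "(\<Sum>k\<le>?N. r j ^ k) \<le> (\<Sum>k. r j ^ k)"
        by (rule sum_le_suminf) (use rj in \<open>auto intro: summable_geometric\<close>)
      also have "\<dots> = 1 / (1 - r j)" using rj by (intro suminf_geometric) auto
      finally show "0 \<le> (\<Sum>k\<le>?N. r j ^ k) \<and> (\<Sum>k\<le>?N. r j ^ k) \<le> 1 / (1 - r j)"
        using rj by (auto intro!: sum_nonneg)
    qed
    finally show ?thesis .
  qed
  then show "bdd_above (sum (\<lambda>\<alpha>. \<Prod>j\<le>d. r j ^ \<alpha> j) ` {F. F \<subseteq> {..d} \<rightarrow>\<^sub>E UNIV \<and> finite F})"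
    by (intro bdd_aboveI[of _ "\<Prod>j\<le>d. 1 / (1 - r j)"]) auto
qed

text \<open>
  The left-hand terms are the complete homogeneous symmetric polynomials in \<open>y\<close>: the product of the
  geometric series is multiplied out and sorted by degree.
\<close>

lemma complete_homogeneous_sums:
  fixes y :: "nat \<Rightarrow> complex"
  assumes y: "\<And>j. j \<le> d \<Longrightarrow> norm (y j) < 1"
  shows "(\<lambda>i. \<Sum>\<alpha>\<in>coeff_exponents d i. \<Prod>j\<le>d. y j ^ \<alpha> j) sums (\<Prod>j\<le>d. 1 / (1 - y j))"
proof -
  let ?Q = "{..d} \<rightarrow>\<^sub>E (UNIV :: nat set)"
  let ?f = "\<lambda>\<alpha>. \<Prod>j\<le>d. y j ^ \<alpha> j"
  have "(\<lambda>\<alpha>. norm (?f \<alpha>)) summable_on ?Q"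
    using summable_on_prod_powers[of d "\<lambda>j. norm (y j)"] y by (simp add: prod_norm[symmetric] norm_power)
  then have "?f summable_on ?Q" by (rule abs_summable_summable)
  then have "(?f has_sum infsum ?f ?Q) ?Q" by (rule has_sum_infsum)
  also have "infsum ?f ?Q = (\<Prod>j\<le>d. \<Sum>\<^sub>\<infinity>k. y j ^ k)"
  proof (rule infsum_prod_PiE_abs)
    fix j assume "j \<in> {..d}"
    then have "summable (\<lambda>k. norm (y j ^ k))" using y by (simp add: norm_power summable_geometric)
    then show "(\<lambda>k. norm (y j ^ k)) summable_on UNIV"
      by (intro norm_summable_imp_summable_on) simp
  qed simp
  also have "\<dots> = (\<Prod>j\<le>d. 1 / (1 - y j))"
  proof (rule prod.cong[OF refl])
    fix j assume "j \<in> {..d}"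
    then have j: "norm (y j) < 1" using y by simp
    then have "summable (\<lambda>k. norm (y j ^ k))" by (simp add: norm_power summable_geometric)
    then have "((\<lambda>k. y j ^ k) has_sum (\<Sum>k. y j ^ k)) UNIV"
      by (intro norm_summable_imp_has_sum) (auto intro: summable_sums summable_geometric[OF j])
    then show "(\<Sum>\<^sub>\<infinity>k. y j ^ k) = 1 / (1 - y j)"
      using suminf_geometric[OF j] by (simp add: infsumI)
  qed
  finally have "(?f has_sum (\<Prod>j\<le>d. 1 / (1 - y j))) ?Q" .
  also have "?this \<longleftrightarrow> ((\<lambda>(i, \<alpha>). ?f \<alpha>) has_sum (\<Prod>j\<le>d. 1 / (1 - y j))) (Sigma UNIV (coeff_exponents d))"
    by (rule has_sum_reindex_bij_witness[of _ snd "\<lambda>\<alpha>. (\<Sum>j\<le>d. \<alpha> j, \<alpha>)"])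
      (auto simp: coeff_exponents_def)
  finally have "((\<lambda>(i, \<alpha>). ?f \<alpha>) has_sum (\<Prod>j\<le>d. 1 / (1 - y j))) (Sigma UNIV (coeff_exponents d))" .
  then have "((\<lambda>i. \<Sum>\<alpha>\<in>coeff_exponents d i. ?f \<alpha>) has_sum (\<Prod>j\<le>d. 1 / (1 - y j))) UNIV"
    by (rule has_sum_Sigma') (auto intro: has_sum_finite finite_coeff_exponents)
  then show ?thesis by (rule has_sum_imp_sums)
qed

lemma summable_card_coeff_exponents:
  assumes "0 \<le> z" "z < 1"
  shows "summable (\<lambda>i. real (card (coeff_exponents d i)) * z ^ i)"
proof -
  have "(\<lambda>i. \<Sum>\<alpha>\<in>coeff_exponents d i. \<Prod>j\<le>d. complex_of_real z ^ \<alpha> j) sums (\<Prod>j\<le>d. 1 / (1 - complex_of_real z))"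
    by (rule complete_homogeneous_sums) (use assms in simp)
  also have "(\<lambda>i. \<Sum>\<alpha>\<in>coeff_exponents d i. \<Prod>j\<le>d. complex_of_real z ^ \<alpha> j) =
      (\<lambda>i. complex_of_real (real (card (coeff_exponents d i)) * z ^ i))"
    by (simp add: power_sum[symmetric] coeff_exponents_def)
  finally show ?thesis using summable_complex_of_real sums_summable by blast
qed

lemma prod_cis: "finite I \<Longrightarrow> (\<Prod>j\<in>I. cis (f j)) = cis (\<Sum>j\<in>I. f j)"
  by (induction I rule: finite_induct) (auto simp: cis_mult)

lemma prod_weighted_powers:
  assumes "\<alpha> \<in> coeff_exponents d i"
  shows "(\<Prod>j\<le>d. (z * cis (of_int (2 * int j - int d) * \<theta>)) ^ \<alpha> j) = z ^ i * cis (of_int (a_weight d \<alpha>) * \<theta>)"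
proof -
  have "(\<Prod>j\<le>d. (z * cis (of_int (2 * int j - int d) * \<theta>)) ^ \<alpha> j) =
      (\<Prod>j\<le>d. z ^ \<alpha> j) * (\<Prod>j\<le>d. cis (of_int ((2 * int j - int d) * int (\<alpha> j)) * \<theta>))"
    unfolding prod.distrib[symmetric]
  proof (intro prod.cong refl)
    fix j
    have "real (\<alpha> j) * (of_int (2 * int j - int d) * \<theta>) = of_int ((2 * int j - int d) * int (\<alpha> j)) * \<theta>"
      by simp
    then show "(z * cis (of_int (2 * int j - int d) * \<theta>)) ^ \<alpha> j =
        z ^ \<alpha> j * cis (of_int ((2 * int j - int d) * int (\<alpha> j)) * \<theta>)"
      by (simp only: power_mult_distrib Complex.DeMoivre)
  qed
  also have "(\<Prod>j\<le>d. z ^ \<alpha> j) = z ^ i"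
    using assms by (simp add: power_sum[symmetric] coeff_exponents_def)
  also have "(\<Prod>j\<le>d. cis (of_int ((2 * int j - int d) * int (\<alpha> j)) * \<theta>)) = cis (of_int (a_weight d \<alpha>) * \<theta>)"
    unfolding a_weight_def of_int_sum sum_distrib_right by (rule prod_cis) simp
  finally show ?thesis .
qed

lemma even_a_weight_iff:
  assumes "\<alpha> \<in> coeff_exponents d i"
  shows "even (a_weight d \<alpha>) \<longleftrightarrow> even (d * i)"
proof -
  have "(\<Sum>j\<le>d. \<alpha> j) = i" using assms by (simp add: coeff_exponents_def)
  then have "a_weight d \<alpha> = 2 * (\<Sum>j\<le>d. int j * int (\<alpha> j)) - int (d * i)"
    unfolding a_weight_def
    by (simp add: left_diff_distrib sum_subtractf sum_distrib_left[symmetric] mult.assoc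
        flip: of_nat_sum)
  then show ?thesis by simp
qed

lemma integral_cis_half_circle:
  "integral\<^sup>L lborel (\<lambda>\<theta>. indicator {- pi / 2..pi / 2} \<theta> *\<^sub>R cis (2 * of_int k * \<theta>)) = (if k = 0 then of_real pi else 0)"
proof (cases "k = 0")
  case True
  have "integral\<^sup>L lborel (\<lambda>\<theta>. indicator {- pi / 2..pi / 2} \<theta> *\<^sub>R (1::complex)) = of_real (pi / 2) - of_real (- pi / 2)"
    by (rule integral_FTC_atLeastAtMost) (auto intro!: derivative_eq_intros simp: has_vector_derivative_def scaleR_conv_of_real)
  then show ?thesis using True by simp
next
  case False
  let ?F = "\<lambda>\<theta>::real. cis (2 * of_int k * \<theta>) / (2 * of_int k * \<i>)"
  have "(?F has_vector_derivative cis (2 * of_int k * \<theta>)) (at \<theta> within {- pi / 2..pi / 2})" for \<theta>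
  proof -
    have "((\<lambda>\<theta>. exp (\<i> * complex_of_real (2 * of_int k * \<theta>)) / (2 * of_int k * \<i>)) has_vector_derivative
        exp (\<i> * complex_of_real (2 * of_int k * \<theta>))) (at \<theta> within {- pi / 2..pi / 2})"
      using False by (auto intro!: derivative_eq_intros has_vector_derivative_real_field simp: field_simps)
    then show ?thesis by (simp add: cis_conv_exp)
  qed
  then have "integral\<^sup>L lborel (\<lambda>\<theta>. indicator {- pi / 2..pi / 2} \<theta> *\<^sub>R cis (2 * of_int k * \<theta>)) = ?F (pi / 2) - ?F (- pi / 2)"
    by (intro integral_FTC_atLeastAtMost continuous_intros) auto
  also have "?F (pi / 2) = ?F (- pi / 2)"
  proof -
    have "sin (of_int k * pi) = 0" by (simp add: sin_zero_iff_int2)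
    then show ?thesis by (simp add: cis.ctr mult.commute)
  qed
  finally show ?thesis using False by simp
qed

text \<open>
  This is \<open>1 / det (1 - \<zeta> g)\<close> for the diagonal element \<open>g\<close> of \<open>SU\<^sub>2\<close> with eigenvalues \<open>cis \<theta>\<close> and
  \<open>cis (- \<theta>)\<close>, acting on \<open>V\<^sub>d\<close>.
\<close>

definition molien_product :: "nat \<Rightarrow> complex \<Rightarrow> real \<Rightarrow> complex" where
  "molien_product d \<zeta> \<theta> = (\<Prod>j\<le>d. 1 / (1 - \<zeta> * cis (of_int (2 * int j - int d) * \<theta>)))"

text \<open>
  The integral of \<open>(1 + cis (- \<theta>))\<close> times the product over the whole circle, folded onto the half circle
  \<open>\<bar>\<theta>\<bar> \<le> pi / 2\<close>: replacing \<open>\<theta>\<close> by \<open>\<theta> + pi\<close> changes the sign of \<open>cis (- \<theta>)\<close> and multiplies \<open>z\<close> by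
  \<open>(- 1) ^ d\<close>. This leaves \<open>\<theta> = 0\<close> as the only point where all factors become singular for
  \<open>z \<rightarrow> 1\<close>.
\<close>

definition molien_integrand :: "nat \<Rightarrow> real \<Rightarrow> real \<Rightarrow> complex" where
  "molien_integrand d z \<theta> = (1 + cis (- \<theta>)) * molien_product d (of_real z) \<theta> +
     (1 - cis (- \<theta>)) * molien_product d ((- 1) ^ d * of_real z) \<theta>"

lemma molien_product_sums:
  assumes "norm \<zeta> < 1"
  shows "(\<lambda>i. \<Sum>\<alpha>\<in>coeff_exponents d i. \<zeta> ^ i * cis (of_int (a_weight d \<alpha>) * \<theta>)) sums molien_product d \<zeta> \<theta>"
proof -
  have "(\<lambda>i. \<Sum>\<alpha>\<in>coeff_exponents d i. \<Prod>j\<le>d. (\<zeta> * cis (of_int (2 * int j - int d) * \<theta>)) ^ \<alpha> j)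
      sums (\<Prod>j\<le>d. 1 / (1 - \<zeta> * cis (of_int (2 * int j - int d) * \<theta>)))"
    by (rule complete_homogeneous_sums) (use assms in \<open>simp add: norm_mult\<close>)
  also have "(\<lambda>i. \<Sum>\<alpha>\<in>coeff_exponents d i. \<Prod>j\<le>d. (\<zeta> * cis (of_int (2 * int j - int d) * \<theta>)) ^ \<alpha> j) =
      (\<lambda>i. \<Sum>\<alpha>\<in>coeff_exponents d i. \<zeta> ^ i * cis (of_int (a_weight d \<alpha>) * \<theta>))"
    by (intro ext sum.cong refl prod_weighted_powers)
  finally show ?thesis by (simp add: molien_product_def)
qed

text \<open>
  Integrated over the half circle, the left-hand side detects \<open>a_weight d \<alpha> div 2 = 0\<close>, that is, the
  weights \<open>0\<close> and \<open>1\<close> at once. The right-hand side is what sums to Molien products; the sign depends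
  on the degree of \<open>\<alpha>\<close> alone because all weights in degree \<open>i\<close> have the parity of \<open>d * i\<close>.
\<close>

lemma half_weight_term:
  assumes "\<alpha> \<in> coeff_exponents d i"
  shows "2 * cis (2 * of_int (a_weight d \<alpha> div 2) * \<theta>) =
    (1 + cis (- \<theta>)) * cis (of_int (a_weight d \<alpha>) * \<theta>) +
    (1 - cis (- \<theta>)) * ((- 1) ^ (d * i) * cis (of_int (a_weight d \<alpha>) * \<theta>))"
proof (cases "even (a_weight d \<alpha>)")
  case True
  then obtain k where k: "a_weight d \<alpha> = 2 * k" by blast
  have "even (d * i)" using True even_a_weight_iff[OF assms] by simp
  then show ?thesis unfolding k by (simp add: ring_distribs)
next
  case False
  then obtain k where k: "a_weight d \<alpha> = 2 * k + 1" by (auto elim: oddE)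
  have "odd (d * i)" using False even_a_weight_iff[OF assms] by simp
  then have "(- 1) ^ (d * i) = (- 1 :: complex)" by simp
  moreover have "cis (- \<theta>) * cis (of_int (2 * k + 1) * \<theta>) = cis (2 * of_int k * \<theta>)"
    by (simp add: cis_mult ring_distribs)
  moreover have "(2 * k + 1) div 2 = k" by simp
  ultimately show ?thesis unfolding k by (simp add: ring_distribs)
qed

lemma molien_integrand_sums:
  assumes "0 \<le> z" "z < 1"
  shows "(\<lambda>i. \<Sum>\<alpha>\<in>coeff_exponents d i. of_real (z ^ i) * (2 * cis (2 * of_int (a_weight d \<alpha> div 2) * \<theta>)))
    sums molien_integrand d z \<theta>"
proof -
  let ?c = "\<lambda>\<alpha>. cis (of_int (a_weight d \<alpha>) * \<theta>)"
  let ?\<epsilon> = "(- 1) ^ d :: complex"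
  have "(\<lambda>i. (1 + cis (- \<theta>)) * (\<Sum>\<alpha>\<in>coeff_exponents d i. of_real z ^ i * ?c \<alpha>) +
      (1 - cis (- \<theta>)) * (\<Sum>\<alpha>\<in>coeff_exponents d i. (?\<epsilon> * of_real z) ^ i * ?c \<alpha>))
      sums molien_integrand d z \<theta>"
    unfolding molien_integrand_def
    by (intro sums_add sums_mult molien_product_sums) (use assms in \<open>simp_all add: norm_mult norm_power\<close>)
  moreover have "(1 + cis (- \<theta>)) * (\<Sum>\<alpha>\<in>coeff_exponents d i. of_real z ^ i * ?c \<alpha>) +
      (1 - cis (- \<theta>)) * (\<Sum>\<alpha>\<in>coeff_exponents d i. (?\<epsilon> * of_real z) ^ i * ?c \<alpha>) =
      (\<Sum>\<alpha>\<in>coeff_exponents d i. of_real (z ^ i) * (2 * cis (2 * of_int (a_weight d \<alpha> div 2) * \<theta>)))" for i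
    unfolding sum_distrib_left sum.distrib[symmetric]
  proof (intro sum.cong refl)
    fix \<alpha> assume \<alpha>: "\<alpha> \<in> coeff_exponents d i"
    show "(1 + cis (- \<theta>)) * (of_real z ^ i * ?c \<alpha>) + (1 - cis (- \<theta>)) * ((?\<epsilon> * of_real z) ^ i * ?c \<alpha>) =
        of_real (z ^ i) * (2 * cis (2 * of_int (a_weight d \<alpha> div 2) * \<theta>))"
      unfolding half_weight_term[OF \<alpha>]
      by (simp add: power_mult_distrib power_mult[symmetric] distrib_left mult.left_commute mult.commute)
  qed
  ultimately show ?thesis by simp
qed

lemma hilbert_series_eq_integral:
  assumes z: "0 \<le> z" "z < 1"
  shows "(\<lambda>i. complex_of_real (real (card {\<alpha> \<in> coeff_exponents d i. a_weight d \<alpha> \<in> {0, 1}}) * z ^ i)) sums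
    (of_real (1 / (2 * pi)) * (\<integral>\<theta>. indicator {- pi / 2..pi / 2} \<theta> *\<^sub>R molien_integrand d z \<theta> \<partial>lborel))"
proof -
  let ?A = "coeff_exponents d"
  let ?I = "{- pi / 2..pi / 2} :: real set"
  let ?t = "\<lambda>\<alpha> \<theta>. cis (2 * of_int (a_weight d \<alpha> div 2) * \<theta>)"
  define g where "g i \<theta> = (\<Sum>\<alpha>\<in>?A i. of_real (z ^ i) * (2 * ?t \<alpha> \<theta>))" for i \<theta>
  define f where "f i \<theta> = indicator ?I \<theta> *\<^sub>R g i \<theta>" for i \<theta>
  let ?c = "\<lambda>i. 2 * (real (card (?A i)) * z ^ i)"
  have g_le: "norm (g i \<theta>) \<le> ?c i" for i \<theta>
  proof -
    have "norm (g i \<theta>) \<le> (\<Sum>\<alpha>\<in>?A i. norm (of_real (z ^ i) * (2 * ?t \<alpha> \<theta>)))"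
      unfolding g_def by (rule norm_sum)
    then show ?thesis using z by (simp add: norm_mult norm_power)
  qed
  have f_le: "norm (f i \<theta>) \<le> indicator ?I \<theta> * ?c i" for i \<theta>
    unfolding f_def using g_le[of i \<theta>] by (simp add: indicator_def)
  have c_summable: "summable ?c"
    by (intro summable_mult summable_card_coeff_exponents z)
  have int_t: "integrable lborel (\<lambda>\<theta>. indicator ?I \<theta> *\<^sub>R ?t \<alpha> \<theta>)" for \<alpha>
    unfolding set_integrable_def[symmetric]
    by (rule borel_integrable_atLeastAtMost') (intro continuous_intros)
  have f_eq: "f i \<theta> = (\<Sum>\<alpha>\<in>?A i. of_real (z ^ i) * 2 * (indicator ?I \<theta> *\<^sub>R ?t \<alpha> \<theta>))" for i \<theta>
    unfolding f_def g_def scaleR_sum_right by (intro sum.cong refl) simp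
  have int_f: "integrable lborel (f i)" for i
    unfolding f_eq by (intro Bochner_Integration.integrable_sum integrable_mult_right int_t)
  have integral_f: "integral\<^sup>L lborel (f i) =
      of_real (2 * pi) * of_real (real (card {\<alpha> \<in> ?A i. a_weight d \<alpha> \<in> {0, 1}}) * z ^ i)" for i
  proof -
    have "integral\<^sup>L lborel (f i) = (\<Sum>\<alpha>\<in>?A i. of_real (z ^ i) * 2 * integral\<^sup>L lborel (\<lambda>\<theta>. indicator ?I \<theta> *\<^sub>R ?t \<alpha> \<theta>))"
      unfolding f_eq
      by (subst Bochner_Integration.integral_sum)
        (intro integrable_mult_right int_t, intro sum.cong refl integral_mult_right_zero)
    also have "\<dots> = (\<Sum>\<alpha>\<in>?A i. if a_weight d \<alpha> \<in> {0, 1} then of_real (z ^ i) * 2 * of_real pi else 0)"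
    proof (intro sum.cong refl)
      fix \<alpha>
      have "a_weight d \<alpha> div 2 = 0 \<longleftrightarrow> a_weight d \<alpha> \<in> {0, 1}" by auto
      then show "of_real (z ^ i) * 2 * integral\<^sup>L lborel (\<lambda>\<theta>. indicator ?I \<theta> *\<^sub>R ?t \<alpha> \<theta>) =
          (if a_weight d \<alpha> \<in> {0, 1} then of_real (z ^ i) * 2 * of_real pi else 0)"
        unfolding integral_cis_half_circle by auto
    qed
    also have "\<dots> = of_real (2 * pi) * of_real (real (card {\<alpha> \<in> ?A i. a_weight d \<alpha> \<in> {0, 1}}) * z ^ i)"
      using finite_coeff_exponents[of d i] by (simp add: sum.If_cases Int_def)
    finally show ?thesis .
  qed
  have sum_f: "(\<Sum>i. f i \<theta>) = indicator ?I \<theta> *\<^sub>R molien_integrand d z \<theta>" for \<theta>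
  proof -
    have "(\<lambda>i. g i \<theta>) sums molien_integrand d z \<theta>"
      unfolding g_def by (rule molien_integrand_sums[OF z])
    then show ?thesis unfolding f_def by (intro sums_unique[symmetric] sums_scaleR_right)
  qed
  have "(\<lambda>i. integral\<^sup>L lborel (f i)) sums (\<integral>\<theta>. (\<Sum>i. f i \<theta>) \<partial>lborel)"
  proof (rule sums_integral[OF int_f])
    have "summable (\<lambda>i. norm (f i \<theta>))" for \<theta>
      by (rule summable_comparison_test'[OF summable_mult[OF c_summable, of "indicator ?I \<theta>"]])
        (use f_le in simp)
    then show "AE \<theta> in lborel. summable (\<lambda>i. norm (f i \<theta>))" by simp
    have "norm (\<integral>\<theta>. norm (f i \<theta>) \<partial>lborel) \<le> ?c i * pi" for i
    proof -
      have "(\<integral>\<theta>. norm (f i \<theta>) \<partial>lborel) \<le> (\<integral>\<theta>. indicator ?I \<theta> * ?c i \<partial>lborel)"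
        by (intro integral_mono f_le integrable_norm int_f) simp
      also have "\<dots> = ?c i * pi" by simp
      finally show ?thesis by simp
    qed
    then show "summable (\<lambda>i. \<integral>\<theta>. norm (f i \<theta>) \<partial>lborel)"
      by (intro summable_comparison_test'[OF summable_mult2[OF c_summable]]) auto
  qed
  then have "(\<lambda>i. of_real (1 / (2 * pi)) * integral\<^sup>L lborel (f i)) sums
      (of_real (1 / (2 * pi)) * (\<integral>\<theta>. indicator ?I \<theta> *\<^sub>R molien_integrand d z \<theta> \<partial>lborel))"
    unfolding sum_f by (rule sums_mult)
  then show ?thesis unfolding integral_f by simp
qed

section \<open>The degree as an integral\<close>

lemma abs_sin_ge_half:
  fixes x :: real
  assumes "\<bar>x\<bar> \<le> pi / 2"
  shows "\<bar>x\<bar> / 2 \<le> \<bar>sin x\<bar>"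
proof -
  have *: "x / 2 \<le> sin x" if "0 \<le> x" "x \<le> pi / 2" for x :: real
  proof -
    have "(\<Sum>m<3. sin_coeff m * x ^ m) = x" by (simp add: numeral_3_eq_3 sin_coeff_def)
    then have "\<bar>sin x - x\<bar> \<le> x ^ 3 / 6"
      using Maclaurin_sin_bound[of x 3] that by (simp add: eval_nat_numeral field_simps)
    moreover have "x ^ 3 / 6 \<le> x / 2"
    proof -
      have "pi \<le> 32 / 10" using pi_approx(2) by simp
      then have "x \<le> 16 / 10" using that by linarith
      then have "x * x \<le> 16 / 10 * (16 / 10)" using that by (intro mult_mono) auto
      then have "x * (x * x) \<le> x * 3" using that by (intro mult_left_mono) auto
      then show ?thesis by (simp add: power3_eq_cube mult.assoc)
    qed
    ultimately show ?thesis by linarith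
  qed
  show ?thesis
  proof (cases "0 \<le> x")
    case True
    then show ?thesis using *[of x] assms by auto
  next
    case False
    then show ?thesis using *[of "- x"] assms by auto
  qed
qed

text \<open>
  Each factor of the denominator has modulus at least \<open>1 / s\<close>, and two consecutive ones cannot both be
  close to that, since their angles differ by \<open>2 \<theta>\<close>: the sum of their moduli is at least
  \<open>norm (cis (2 \<theta>) - 1) = 2 \<bar>sin \<theta>\<bar> \<ge> \<bar>\<theta>\<bar>\<close>. A single such pair only gives decay of order
  \<open>1 / \<bar>s \<theta>\<bar>\<close>; the two disjoint pairs available for \<open>d \<ge> 3\<close> give an integrable bound.
\<close>

lemma molien_product_bound:
  assumes d: "3 \<le> d" and s: "1 \<le> s" and \<zeta>: "norm \<zeta> = 1 - 1 / s" and \<theta>: "\<bar>\<theta>\<bar> \<le> pi / 2"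
  shows "norm (molien_product d \<zeta> \<theta>) / s ^ (d + 1) \<le> 5 / (1 + (s * \<theta>)\<^sup>2)"
proof -
  define A where "A j = s * norm (1 - \<zeta> * cis (of_int (2 * int j - int d) * \<theta>))" for j
  have A1: "1 \<le> A j" for j
  proof -
    have "1 - norm (\<zeta> * cis (of_int (2 * int j - int d) * \<theta>)) \<le> norm (1 - \<zeta> * cis (of_int (2 * int j - int d) * \<theta>))"
      using norm_triangle_ineq2[of 1 "\<zeta> * cis (of_int (2 * int j - int d) * \<theta>)"] by simp
    then have "1 / s \<le> norm (1 - \<zeta> * cis (of_int (2 * int j - int d) * \<theta>))"
      using \<zeta> by (simp add: norm_mult)
    then show ?thesis using s by (simp add: A_def field_simps)
  qed
  have pair: "1 \<le> A j * A (Suc j)" "\<bar>s * \<theta>\<bar> / 2 \<le> A j * A (Suc j)" for j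
  proof -
    let ?a = "1 - \<zeta> * cis (of_int (2 * int j - int d) * \<theta>)"
    let ?b = "1 - \<zeta> * cis (of_int (2 * int (Suc j) - int d) * \<theta>)"
    have "of_int (2 * int (Suc j) - int d) * \<theta> = 2 * \<theta> + of_int (2 * int j - int d) * \<theta>"
      by (simp add: algebra_simps)
    then have "cis (of_int (2 * int (Suc j) - int d) * \<theta>) = cis (2 * \<theta>) * cis (of_int (2 * int j - int d) * \<theta>)"
      by (simp only: cis_mult)
    then have "cis (2 * \<theta>) - 1 = cis (2 * \<theta>) * ?a - ?b"
      by (simp add: algebra_simps)
    then have "norm (cis (2 * \<theta>) - 1) \<le> norm (cis (2 * \<theta>) * ?a) + norm ?b"
      by (metis norm_triangle_ineq4)
    then have ab: "norm (cis (2 * \<theta>) - 1) \<le> norm ?a + norm ?b" by (simp add: norm_mult)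
    have "cis (2 * \<theta>) - 1 = cis \<theta> * (cis \<theta> - cis (- \<theta>))"
      by (simp add: right_diff_distrib cis_mult)
    also have "cis \<theta> - cis (- \<theta>) = 2 * \<i> * of_real (sin \<theta>)"
      by (simp add: complex_eq_iff)
    finally have "cis (2 * \<theta>) - 1 = cis \<theta> * (2 * \<i> * of_real (sin \<theta>))" .
    then have "norm (cis (2 * \<theta>) - 1) = 2 * \<bar>sin \<theta>\<bar>" by (simp add: norm_mult)
    then have "\<bar>\<theta>\<bar> \<le> norm ?a + norm ?b" using abs_sin_ge_half[OF \<theta>] ab by linarith
    then have "s * \<bar>\<theta>\<bar> \<le> A j + A (Suc j)"
      unfolding A_def distrib_left[symmetric] using s by (intro mult_left_mono) simp_all
    moreover have "\<bar>s * \<theta>\<bar> = s * \<bar>\<theta>\<bar>" using s by (simp add: abs_mult)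
    moreover have "A j * 1 \<le> A j * A (Suc j)" "1 * A (Suc j) \<le> A j * A (Suc j)"
      using A1[of j] A1[of "Suc j"] by (intro mult_left_mono mult_right_mono; simp)+
    ultimately show "1 \<le> A j * A (Suc j)" "\<bar>s * \<theta>\<bar> / 2 \<le> A j * A (Suc j)"
      using A1[of j] by linarith+
  qed
  have "(1 + (s * \<theta>)\<^sup>2) / 5 \<le> (A 0 * A 1) * (A 2 * A 3)"
  proof (cases "\<bar>s * \<theta>\<bar> \<le> 2")
    case True
    then have "\<bar>s * \<theta>\<bar>\<^sup>2 \<le> 2\<^sup>2" by (intro power_mono) auto
    then have "(s * \<theta>)\<^sup>2 \<le> 4" by (simp only: power2_abs) simp
    moreover have "1 * 1 \<le> (A 0 * A 1) * (A 2 * A 3)"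
      using pair(1)[of 0] pair(1)[of 2] by (intro mult_mono) (auto simp: eval_nat_numeral)
    ultimately show ?thesis by simp
  next
    case False
    then have "2\<^sup>2 \<le> \<bar>s * \<theta>\<bar>\<^sup>2" by (intro power_mono) auto
    moreover have "(\<bar>s * \<theta>\<bar> / 2) * (\<bar>s * \<theta>\<bar> / 2) \<le> (A 0 * A 1) * (A 2 * A 3)"
      using pair[of 0] pair[of 2] by (intro mult_mono) (auto simp: eval_nat_numeral)
    ultimately show ?thesis by (simp add: power2_eq_square)
  qed
  also have "(A 0 * A 1) * (A 2 * A 3) = (\<Prod>j\<le>3. A j)" by (simp add: eval_nat_numeral)
  also have "\<dots> \<le> (\<Prod>j\<le>d. A j)"
    using d A1 by (intro prod_mono2) (auto intro: order_trans[OF zero_le_one])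
  also have "\<dots> = s ^ (d + 1) / norm (molien_product d \<zeta> \<theta>)"
    unfolding A_def molien_product_def
    by (simp add: prod.distrib prod_dividef norm_divide prod_norm[symmetric])
  finally have le: "(1 + (s * \<theta>)\<^sup>2) / 5 \<le> s ^ (d + 1) / norm (molien_product d \<zeta> \<theta>)" .
  have pos: "0 < 1 + (s * \<theta>)\<^sup>2" by (simp add: add_pos_nonneg)
  then have "0 < (1 + (s * \<theta>)\<^sup>2) / 5" by simp
  then have "0 < s ^ (d + 1) / norm (molien_product d \<zeta> \<theta>)" using le by (rule less_le_trans)
  then have "norm (molien_product d \<zeta> \<theta>) > 0" by (simp add: zero_less_divide_iff)
  then show ?thesis using le pos s by (simp add: field_simps)
qed

lemma molien_integrand_bound:
  assumes "3 \<le> d" "1 \<le> s" "\<bar>t / s\<bar> \<le> pi / 2"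
  shows "norm (molien_integrand d (1 - 1 / s) (t / s)) / s ^ (d + 1) \<le> 20 / (1 + t\<^sup>2)"
proof -
  let ?z = "1 - 1 / s" and ?\<theta> = "t / s"
  have z: "0 \<le> ?z" using assms by simp
  have "norm (molien_integrand d ?z ?\<theta>) \<le> 2 * norm (molien_product d (of_real ?z) ?\<theta>) +
      2 * norm (molien_product d ((- 1) ^ d * of_real ?z) ?\<theta>)"
    unfolding molien_integrand_def
    by (rule order_trans[OF norm_triangle_ineq], unfold norm_mult, intro add_mono mult_right_mono
        order_trans[OF norm_triangle_ineq] order_trans[OF norm_triangle_ineq4]) simp_all
  then have "norm (molien_integrand d ?z ?\<theta>) / s ^ (d + 1) \<le>
      (2 * norm (molien_product d (of_real ?z) ?\<theta>) +
       2 * norm (molien_product d ((- 1) ^ d * of_real ?z) ?\<theta>)) / s ^ (d + 1)"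
    by (rule divide_right_mono) (use assms(2) in simp)
  also have "\<dots> = 2 * (norm (molien_product d (of_real ?z) ?\<theta>) / s ^ (d + 1)) +
      2 * (norm (molien_product d ((- 1) ^ d * of_real ?z) ?\<theta>) / s ^ (d + 1))"
    by (simp only: add_divide_distrib times_divide_eq_right)
  also have "\<dots> \<le> 2 * (5 / (1 + (s * ?\<theta>)\<^sup>2)) + 2 * (5 / (1 + (s * ?\<theta>)\<^sup>2))"
    by (intro add_mono mult_left_mono molien_product_bound assms)
      (use z in \<open>simp_all only: norm_mult norm_power norm_of_real norm_minus_cancel norm_one abs_of_nonneg power_one mult_1 zero_le_numeral\<close>)
  also have "\<dots> = 20 / (1 + t\<^sup>2)" using assms(2) by simp
  finally show ?thesis .
qed

lemma scaled_factor_tendsto: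
  fixes c :: real
  shows "((\<lambda>s. complex_of_real s * (1 - complex_of_real (1 - 1 / s) * cis (c / s))) \<longlongrightarrow> 1 - \<i> * of_real c) at_top"
proof -
  have Re: "((\<lambda>s. s * (1 - (1 - 1 / s) * cos (c / s))) \<longlongrightarrow> 1) at_top"
  proof (cases "c = 0")
    case True
    have "\<forall>\<^sub>F s in at_top. 1 = s * (1 - (1 - 1 / s) * cos (c / s))"
      using eventually_gt_at_top[of 0] by eventually_elim (simp add: True)
    then show ?thesis by (rule Lim_transform_eventually[OF tendsto_const])
  next
    case False
    then show ?thesis by real_asymp
  qed
  have Im: "((\<lambda>s. s * (- ((1 - 1 / s) * sin (c / s)))) \<longlongrightarrow> - c) at_top"
  proof (cases "c = 0")
    case False
    then show ?thesis by real_asymp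
  qed simp
  show ?thesis
    by (rule tendsto_complex_iff[THEN iffD2]) (use Re Im in simp)
qed

lemma molien_product_scaled_tendsto:
  "((\<lambda>s. molien_product d (of_real (1 - 1 / s)) (t / s) / of_real s ^ (d + 1)) \<longlongrightarrow>
     (\<Prod>j\<le>d. 1 / (1 - \<i> * of_real (of_int (2 * int j - int d) * t)))) at_top"
proof -
  have "((\<lambda>s. \<Prod>j\<le>d. 1 / (complex_of_real s * (1 - complex_of_real (1 - 1 / s) * cis ((of_int (2 * int j - int d) * t) / s))))
      \<longlongrightarrow> (\<Prod>j\<le>d. 1 / (1 - \<i> * of_real (of_int (2 * int j - int d) * t)))) at_top"
  proof (intro tendsto_prod tendsto_divide tendsto_const scaled_factor_tendsto)
    fix j
    have "Re (1 - \<i> * of_real (of_int (2 * int j - int d) * t)) = 1" by simp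
    then show "1 - \<i> * of_real (of_int (2 * int j - int d) * t) \<noteq> 0"
      by (metis one_neq_zero zero_complex.sel(1))
  qed
  moreover have "(\<Prod>j\<le>d. 1 / (complex_of_real s * (1 - complex_of_real (1 - 1 / s) * cis ((of_int (2 * int j - int d) * t) / s)))) =
      molien_product d (of_real (1 - 1 / s)) (t / s) / of_real s ^ (d + 1)" for s
    unfolding molien_product_def by (simp add: prod_dividef prod.distrib)
  ultimately show ?thesis by simp
qed

text \<open>
  The factors for \<open>j\<close> and \<open>d - j\<close> are complex conjugates, and a middle factor equals \<open>1\<close>.
\<close>

lemma prod_symmetric_weights:
  "(\<Prod>j\<le>d. 1 - \<i> * of_real (of_int (2 * int j - int d) * t)) =
     complex_of_real (\<Prod>j | 2 * j < d. 1 + ((real d - 2 * real j) * t)\<^sup>2)"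
proof -
  let ?f = "\<lambda>j. 1 - \<i> * complex_of_real (of_int (2 * int j - int d) * t)"
  let ?A = "{j. 2 * j < d}" and ?Z = "{j. 2 * j = d}" and ?B = "{j. j \<le> d \<and> d < 2 * j}"
  have fin: "finite ?A" "finite ?Z" "finite ?B"
    by (rule finite_subset[of _ "{..d}"]; auto)+
  have "{..d} = (?A \<union> ?Z) \<union> ?B" by auto
  then have "(\<Prod>j\<le>d. ?f j) = (\<Prod>j\<in>?A \<union> ?Z. ?f j) * (\<Prod>j\<in>?B. ?f j)"
    using fin by (subst prod.union_disjoint[symmetric]) auto
  also have "(\<Prod>j\<in>?A \<union> ?Z. ?f j) = (\<Prod>j\<in>?A. ?f j) * (\<Prod>j\<in>?Z. ?f j)"
    using fin by (subst prod.union_disjoint[symmetric]) auto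
  also have "(\<Prod>j\<in>?Z. ?f j) = 1"
    by (rule prod.neutral) auto
  also have "(\<Prod>j\<in>?B. ?f j) = (\<Prod>j\<in>?A. ?f (d - j))"
    by (rule prod.reindex_bij_witness[of _ "\<lambda>j. d - j" "\<lambda>j. d - j"]) auto
  also have "(\<Prod>j\<in>?A. ?f j) * 1 * (\<Prod>j\<in>?A. ?f (d - j)) = (\<Prod>j\<in>?A. ?f j * ?f (d - j))"
    by (simp add: prod.distrib)
  also have "\<dots> = (\<Prod>j\<in>?A. complex_of_real (1 + ((real d - 2 * real j) * t)\<^sup>2))"
  proof (intro prod.cong refl)
    fix j assume "j \<in> ?A"
    then have w: "of_int (2 * int (d - j) - int d) = real d - 2 * real j"
        "of_int (2 * int j - int d) = - (real d - 2 * real j)" by (auto simp: of_nat_diff)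
    show "?f j * ?f (d - j) = complex_of_real (1 + ((real d - 2 * real j) * t)\<^sup>2)"
      unfolding w by (simp only: complex_eq_iff) (simp add: power2_eq_square algebra_simps)
  qed
  finally show ?thesis by simp
qed

definition degree_density :: "nat \<Rightarrow> real \<Rightarrow> real" where
  "degree_density d t = 1 / (\<Prod>j | 2 * j < d. 1 + ((real d - 2 * real j) * t)\<^sup>2)"

lemma borel_measurable_cis [measurable]: "cis \<in> borel_measurable borel"
  by (intro borel_measurable_continuous_onI continuous_intros)

lemma borel_measurable_molien_integrand:
  "(\<lambda>t. molien_integrand d z (t / s)) \<in> borel_measurable borel"
  unfolding molien_integrand_def molien_product_def by measurable

text \<open>
  Here \<open>s = 1 / (1 - z)\<close> and \<open>\<theta> = t / s\<close>. In the limit the first summand of the integrand acquires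
  the factor \<open>1 + cis 0 = 2\<close>, while the second one, whose Molien product obeys the same bound, is
  killed by \<open>1 - cis (- t / s)\<close>.
\<close>

lemma molien_integral_tendsto:
  assumes d: "3 \<le> d"
  shows "((\<lambda>s. of_real (1 / s) ^ d * (\<integral>\<theta>. indicator {- pi / 2..pi / 2} \<theta> *\<^sub>R molien_integrand d (1 - 1 / s) \<theta> \<partial>lborel))
     \<longlongrightarrow> of_real (2 * (\<integral>t. degree_density d t \<partial>lborel))) at_top"
proof -
  let ?I = "{- pi / 2..pi / 2} :: real set"
  define H where "H s t = indicator ?I (t / s) *\<^sub>R (molien_integrand d (1 - 1 / s) (t / s) / of_real s ^ (d + 1))" for s t :: real
  have "((\<lambda>s. integral\<^sup>L lborel (H s)) \<longlongrightarrow> (\<integral>t. complex_of_real (2 * degree_density d t) \<partial>lborel)) at_top"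
  proof (rule integral_dominated_convergence_at_top)
    show "H s \<in> borel_measurable lborel" for s
      unfolding H_def using borel_measurable_molien_integrand[of d _ s] by measurable
    show "(\<lambda>t. complex_of_real (2 * degree_density d t)) \<in> borel_measurable lborel"
      unfolding degree_density_def by measurable
    have "integrable lborel (\<lambda>t::real. inverse (1 + t\<^sup>2))"
      using integrable_inverse_1_plus_square by (simp add: set_integrable_def)
    then show "integrable lborel (\<lambda>t::real. 20 / (1 + t\<^sup>2))"
      by (simp add: divide_inverse)
    show "\<forall>\<^sub>F s in at_top. AE t in lborel. norm (H s t) \<le> 20 / (1 + t\<^sup>2)"
      using eventually_ge_at_top[of 1]
    proof eventually_elim
      case (elim s)
      have "norm (H s t) \<le> 20 / (1 + t\<^sup>2)" for t
      proof (cases "t / s \<in> ?I")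
        case True
        then have "\<bar>t / s\<bar> \<le> pi / 2" by auto
        then show ?thesis
          using molien_integrand_bound[OF d elim, of t] elim True
          by (simp add: H_def norm_divide norm_power norm_mult)
      qed (simp add: H_def)
      then show ?case by simp
    qed
    have "((\<lambda>s. H s t) \<longlongrightarrow> complex_of_real (2 * degree_density d t)) at_top" for t
    proof -
      let ?P = "\<lambda>\<zeta> s. molien_product d \<zeta> (t / s) / of_real s ^ (d + 1)"
      let ?L = "\<Prod>j\<le>d. 1 / (1 - \<i> * of_real (of_int (2 * int j - int d) * t))"
      have cis: "((\<lambda>s. cis (- (t / s))) \<longlongrightarrow> cis 0) at_top"
      proof (rule continuous_on_tendsto_compose[of UNIV cis])
        show "continuous_on UNIV cis" by (intro continuous_intros)
        show "((\<lambda>s. - (t / s)) \<longlongrightarrow> 0) at_top"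
          using tendsto_minus[OF real_tendsto_divide_at_top[OF tendsto_const[of t] filterlim_ident]] by simp
      qed simp_all
      have inI: "\<forall>\<^sub>F s in at_top. 1 \<le> s \<and> \<bar>t / s\<bar> \<le> pi / 2"
      proof -
        have "\<forall>\<^sub>F s in at_top. \<bar>t\<bar> \<le> s \<and> 1 \<le> s"
          by (intro eventually_conj eventually_ge_at_top)
        then show ?thesis
        proof eventually_elim
          case (elim s)
          then have "\<bar>t / s\<bar> \<le> 1" by (auto simp: field_simps)
          then show ?case using elim pi_ge_two by linarith
        qed
      qed
      have first: "((\<lambda>s. (1 + cis (- (t / s))) * ?P (of_real (1 - 1 / s)) s) \<longlongrightarrow> (1 + cis 0) * ?L) at_top"
        by (intro tendsto_mult tendsto_add tendsto_const cis molien_product_scaled_tendsto)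
      have second: "((\<lambda>s. (1 - cis (- (t / s))) * ?P ((- 1) ^ d * of_real (1 - 1 / s)) s) \<longlongrightarrow> 0) at_top"
      proof (rule Lim_null_comparison)
        show "((\<lambda>s. norm (1 - cis (- (t / s))) * (5 / (1 + t\<^sup>2))) \<longlongrightarrow> 0) at_top"
        proof -
          have "((\<lambda>s. norm (1 - cis (- (t / s))) * (5 / (1 + t\<^sup>2))) \<longlongrightarrow> norm (1 - cis 0) * (5 / (1 + t\<^sup>2))) at_top"
            by (intro tendsto_mult tendsto_norm tendsto_diff tendsto_const cis)
          then show ?thesis by simp
        qed
        show "\<forall>\<^sub>F s in at_top. norm ((1 - cis (- (t / s))) * ?P ((- 1) ^ d * of_real (1 - 1 / s)) s)
            \<le> norm (1 - cis (- (t / s))) * (5 / (1 + t\<^sup>2))"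
          using inI
        proof eventually_elim
          case (elim s)
          have "norm ((- 1) ^ d * complex_of_real (1 - 1 / s)) = 1 - 1 / s"
            using elim by (simp add: norm_mult norm_power del: of_real_diff)
          from molien_product_bound[OF d conjunct1[OF elim] this conjunct2[OF elim]]
          have "norm (?P ((- 1) ^ d * of_real (1 - 1 / s)) s) \<le> 5 / (1 + t\<^sup>2)"
            using elim by (simp add: norm_divide norm_power norm_mult)
          then show ?case unfolding norm_mult by (intro mult_left_mono) simp_all
        qed
      qed
      have "((\<lambda>s. (1 + cis (- (t / s))) * ?P (of_real (1 - 1 / s)) s +
          (1 - cis (- (t / s))) * ?P ((- 1) ^ d * of_real (1 - 1 / s)) s) \<longlongrightarrow> (1 + cis 0) * ?L + 0) at_top"
        by (rule tendsto_add[OF first second])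
      moreover have "(1 + cis 0) * ?L + 0 = complex_of_real (2 * degree_density d t)"
        by (simp add: prod_dividef prod_symmetric_weights[simplified] degree_density_def)
      moreover have "\<forall>\<^sub>F s in at_top. (1 + cis (- (t / s))) * ?P (of_real (1 - 1 / s)) s +
          (1 - cis (- (t / s))) * ?P ((- 1) ^ d * of_real (1 - 1 / s)) s = H s t"
        using inI
      proof eventually_elim
        case (elim s)
        then have "t / s \<in> ?I" using abs_le_D1[of "t / s"] abs_le_D2[of "t / s"] by fastforce
        then show ?case by (simp add: H_def molien_integrand_def add_divide_distrib)
      qed
      ultimately show ?thesis by (auto elim: Lim_transform_eventually)
    qed
    then show "AE t in lborel. ((\<lambda>s. H s t) \<longlongrightarrow> complex_of_real (2 * degree_density d t)) at_top" by simp
  qed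
  moreover have "\<forall>\<^sub>F s in at_top. integral\<^sup>L lborel (H s) =
      of_real (1 / s) ^ d * (\<integral>\<theta>. indicator ?I \<theta> *\<^sub>R molien_integrand d (1 - 1 / s) \<theta> \<partial>lborel)"
    using eventually_gt_at_top[of 0]
  proof eventually_elim
    case (elim s)
    let ?g = "\<lambda>\<theta>. indicator ?I \<theta> *\<^sub>R molien_integrand d (1 - 1 / s) \<theta>"
    have "integral\<^sup>L lborel (H s) = (\<integral>t. of_real (1 / s) ^ (d + 1) * ?g (t / s) \<partial>lborel)"
      by (intro Bochner_Integration.integral_cong refl) (simp add: H_def power_one_over divide_simps)
    also have "\<dots> = of_real (1 / s) ^ (d + 1) * (\<integral>t. ?g (t / s) \<partial>lborel)"
      by (rule integral_mult_right_zero)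
    also have "(\<integral>\<theta>. ?g \<theta> \<partial>lborel) = (1 / s) *\<^sub>R (\<integral>t. ?g (t / s) \<partial>lborel)"
      using lborel_integral_real_affine[of "1 / s" ?g 0] elim by simp
    then have "of_real (1 / s) ^ (d + 1) * (\<integral>t. ?g (t / s) \<partial>lborel) = of_real (1 / s) ^ d * (\<integral>\<theta>. ?g \<theta> \<partial>lborel)"
      by (simp add: scaleR_conv_of_real)
    finally show ?case .
  qed
  ultimately have "((\<lambda>s. of_real (1 / s) ^ d * (\<integral>\<theta>. indicator ?I \<theta> *\<^sub>R molien_integrand d (1 - 1 / s) \<theta> \<partial>lborel))
     \<longlongrightarrow> (\<integral>t. complex_of_real (2 * degree_density d t) \<partial>lborel)) at_top"
    by (rule Lim_transform_eventually)
  then show ?thesis by (simp add: integral_complex_of_real del: of_real_mult)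
qed

section \<open>The degree for large d\<close>

lemma sum_squares_half: "(\<Sum>j | 2 * j < d. (real d - 2 * real j)\<^sup>2) = real d * (real d + 1) * (real d + 2) / 6"
proof (induction d rule: nat_less_induct)
  case (1 d)
  consider "d = 0" | "d = 1" | e where "d = e + 2" by (metis One_nat_def Suc_eq_plus1 add_2_eq_Suc' not0_implies_Suc)
  then show ?case
  proof cases
    case 1
    then show ?thesis by simp
  next
    case 2
    then have "{j. 2 * j < d} = {0}" by auto
    then show ?thesis using 2 by simp
  next
    case 3
    have "{j. 2 * j < d} = insert 0 (Suc ` {j. 2 * j < e})"
    proof safe
      fix j assume "2 * j < d" "j \<notin> Suc ` {j. 2 * j < e}"
      then show "j = 0" using 3 by (cases j) auto
    qed (use 3 in auto)
    moreover have "finite {j. 2 * j < e}" by (rule finite_subset[of _ "{..e}"]) auto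
    ultimately have "(\<Sum>j | 2 * j < d. (real d - 2 * real j)\<^sup>2) =
        (real d)\<^sup>2 + (\<Sum>j | 2 * j < e. (real e - 2 * real j)\<^sup>2)"
      using 3 by (simp add: sum.reindex)
    also have "(\<Sum>j | 2 * j < e. (real e - 2 * real j)\<^sup>2) = real e * (real e + 1) * (real e + 2) / 6"
      using "1.IH" 3 by simp
    finally show ?thesis using 3 by (simp add: power2_eq_square field_simps)
  qed
qed

lemma prod_ge_1_plus_sum:
  fixes x :: "'i \<Rightarrow> real"
  assumes "finite I" "\<And>i. i \<in> I \<Longrightarrow> 0 \<le> x i"
  shows "1 + (\<Sum>i\<in>I. x i) \<le> (\<Prod>i\<in>I. 1 + x i)"
  using assms
proof (induction I rule: finite_induct)
  case (insert i I)
  have "1 + (x i + sum x I) \<le> (1 + x i) * (1 + sum x I)"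
    using insert.prems by (simp add: algebra_simps sum_nonneg)
  also have "\<dots> \<le> (1 + x i) * (\<Prod>i\<in>I. 1 + x i)"
    using insert by (intro mult_left_mono) auto
  finally show ?case using insert.hyps by simp
qed simp

text \<open>
  This is \<open>x - x\<^sup>2 \<le> ln (1 + x) \<le> x\<close>, summed over the factors: a product of many factors close to \<open>1\<close>
  depends asymptotically only on \<open>\<Sum>i\<in>I. x i\<close>.
\<close>

lemma prod_1_plus_bounds:
  fixes x :: "'i \<Rightarrow> real"
  assumes "finite I" "\<And>i. i \<in> I \<Longrightarrow> 0 \<le> x i" "\<And>i. i \<in> I \<Longrightarrow> x i \<le> M"
  shows "exp ((1 - M) * (\<Sum>i\<in>I. x i)) \<le> (\<Prod>i\<in>I. 1 + x i)" "(\<Prod>i\<in>I. 1 + x i) \<le> exp (\<Sum>i\<in>I. x i)"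
proof -
  have "exp ((1 - M) * (\<Sum>i\<in>I. x i)) = (\<Prod>i\<in>I. exp ((1 - M) * x i))"
    using assms(1) by (simp add: exp_sum sum_distrib_left)
  also have "\<dots> \<le> (\<Prod>i\<in>I. 1 + x i)"
  proof (rule prod_mono)
    fix i assume i: "i \<in> I"
    have x: "0 \<le> x i" "x i \<le> M" using assms i by auto
    \<comment> \<open>For \<open>x i > 1\<close> the intermediate bound \<open>x i - (x i)\<^sup>2\<close> is negative, so it is below the logarithm trivially.\<close>
    have "(1 - M) * x i \<le> x i - x i * x i"
      using mult_right_mono[OF x(2) x(1)] by (simp add: algebra_simps)
    also have "\<dots> \<le> ln (1 + x i)"
      using ln_one_plus_pos_lower_bound[of "x i"] x
      by (cases "x i \<le> 1") (auto simp: power2_eq_square intro: order_trans[OF _ ln_ge_zero] mult_left_mono[of 1 "x i" "x i", simplified])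
    finally have "exp ((1 - M) * x i) \<le> exp (ln (1 + x i))" by simp
    then show "0 \<le> exp ((1 - M) * x i) \<and> exp ((1 - M) * x i) \<le> 1 + x i" using x by simp
  qed
  finally show "exp ((1 - M) * (\<Sum>i\<in>I. x i)) \<le> (\<Prod>i\<in>I. 1 + x i)" .
  have "(\<Prod>i\<in>I. 1 + x i) \<le> (\<Prod>i\<in>I. exp (x i))"
    by (rule prod_mono) (use assms(2) exp_ge_add_one_self in \<open>auto intro: add_nonneg_nonneg\<close>)
  then show "(\<Prod>i\<in>I. 1 + x i) \<le> exp (\<Sum>i\<in>I. x i)" using assms(1) by (simp add: exp_sum)
qed

lemma gaussian_integral: "(\<integral>x. exp (- x\<^sup>2 / 6) \<partial>lborel) = sqrt (6 * pi)"
proof -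
  have "(\<integral>x. normal_density 0 (sqrt 3) x \<partial>lborel) = 1" by (rule integral_normal_density) simp
  moreover have "normal_density 0 (sqrt 3) = (\<lambda>x. (1 / sqrt (6 * pi)) * exp (- x\<^sup>2 / 6))"
    by (simp add: normal_density_def fun_eq_iff)
  ultimately have "(\<integral>x. (1 / sqrt (6 * pi)) * exp (- x\<^sup>2 / 6) \<partial>lborel) = 1" by (simp only:)
  then have *: "(1 / sqrt (6 * pi)) * (\<integral>x. exp (- x\<^sup>2 / 6) \<partial>lborel) = 1"
    by (simp only: integral_mult_right_zero)
  have "sqrt (6 * pi) * ((1 / sqrt (6 * pi)) * (\<integral>x. exp (- x\<^sup>2 / 6) \<partial>lborel)) =
      (\<integral>x. exp (- x\<^sup>2 / 6) \<partial>lborel)" by simp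
  then show ?thesis unfolding * by simp
qed

text \<open>
  For \<open>t = \<tau> / d\<^sup>3\<^sup>/\<^sup>2\<close> the terms \<open>x j = ((d - 2 j) t)\<^sup>2\<close> are at most \<open>\<tau>\<^sup>2 / d\<close>, and their sum tends to
  \<open>\<tau>\<^sup>2 / 6\<close>. This gives the pointwise limit; the first-order part \<open>1 + \<Sum>j. x j\<close> of the product is
  already large enough for an integrable majorant.
\<close>

lemma degree_density_integral_asymp:
  "(\<lambda>d. real d powr (3 / 2) * (\<integral>t. degree_density d t \<partial>lborel)) \<longlonglongrightarrow> sqrt (6 * pi)"
proof -
  define f where "f d \<tau> = degree_density d (\<tau> / real d powr (3 / 2))" for d \<tau>
  let ?S = "\<lambda>d. {j. 2 * j < d} :: nat set"
  let ?x = "\<lambda>d \<tau> j. ((real d - 2 * real j) * (\<tau> / real d powr (3 / 2)))\<^sup>2"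
  let ?c = "\<lambda>d. (real d + 1) * (real d + 2) / (6 * (real d)\<^sup>2)"
  have fin: "finite (?S d)" for d by (rule finite_subset[of _ "{..d}"]) auto
  have f_eq: "f d \<tau> = 1 / (\<Prod>j\<in>?S d. 1 + ?x d \<tau> j)" for d \<tau>
    by (simp add: f_def degree_density_def)
  have powr: "(real d powr (3 / 2))\<^sup>2 = real d ^ 3" if "0 < d" for d
    using that by (simp add: powr_power powr_numeral)
  have x_eq: "?x d \<tau> j = (real d - 2 * real j)\<^sup>2 * \<tau>\<^sup>2 / real d ^ 3" if "0 < d" for d \<tau> j
    using powr[OF that] by (simp add: power_mult_distrib power_divide)
  have sum_x: "(\<Sum>j\<in>?S d. ?x d \<tau> j) = ?c d * \<tau>\<^sup>2" if "0 < d" for d \<tau>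
  proof -
    have "(\<Sum>j\<in>?S d. ?x d \<tau> j) = (\<Sum>j\<in>?S d. (real d - 2 * real j)\<^sup>2) * \<tau>\<^sup>2 / real d ^ 3"
      unfolding x_eq[OF that] sum_divide_distrib[symmetric] sum_distrib_right[symmetric] ..
    also have "\<dots> = ?c d * \<tau>\<^sup>2"
      unfolding sum_squares_half using that by (simp add: power2_eq_square power3_eq_cube)
    finally show ?thesis .
  qed
  have x_le: "?x d \<tau> j \<le> \<tau>\<^sup>2 / real d" if "0 < d" "j \<in> ?S d" for d \<tau> j
  proof -
    have "(real d - 2 * real j)\<^sup>2 \<le> (real d)\<^sup>2" by (rule power_mono) (use that in auto)
    then have "(real d - 2 * real j)\<^sup>2 * \<tau>\<^sup>2 / real d ^ 3 \<le> (real d)\<^sup>2 * \<tau>\<^sup>2 / real d ^ 3"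
      by (intro divide_right_mono mult_right_mono) auto
    also have "\<dots> = \<tau>\<^sup>2 / real d" using that by (simp add: power2_eq_square power3_eq_cube)
    finally show ?thesis unfolding x_eq[OF that(1)] .
  qed
  have "(\<lambda>d. \<integral>\<tau>. f (Suc d) \<tau> \<partial>lborel) \<longlonglongrightarrow> (\<integral>\<tau>. exp (- \<tau>\<^sup>2 / 6) \<partial>lborel)"
  proof (rule integral_dominated_convergence)
    show "f (Suc d) \<in> borel_measurable lborel" for d unfolding f_eq by measurable
    have base: "integrable lborel (\<lambda>t::real. inverse (1 + t\<^sup>2))"
      using integrable_inverse_1_plus_square by (simp add: set_integrable_def)
    then show "integrable lborel (\<lambda>\<tau>::real. 6 * inverse (1 + \<tau>\<^sup>2))" by simp
    have "norm (f d \<tau>) \<le> 6 * inverse (1 + \<tau>\<^sup>2)" if "0 < d" for d \<tau>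
    proof -
      have "(1 + \<tau>\<^sup>2) / 6 \<le> 1 + ?c d * \<tau>\<^sup>2"
      proof -
        have "1 / 6 \<le> ?c d" using that by (simp add: field_simps power2_eq_square)
        then have "1 / 6 * \<tau>\<^sup>2 \<le> ?c d * \<tau>\<^sup>2" by (rule mult_right_mono) simp
        then show ?thesis by simp
      qed
      also have "\<dots> \<le> (\<Prod>j\<in>?S d. 1 + ?x d \<tau> j)"
        unfolding sum_x[OF that, symmetric] by (rule prod_ge_1_plus_sum[OF fin]) simp
      finally have le: "(1 + \<tau>\<^sup>2) / 6 \<le> (\<Prod>j\<in>?S d. 1 + ?x d \<tau> j)" .
      have pos: "0 < (1 + \<tau>\<^sup>2) / 6" by (simp add: add_pos_nonneg)
      have "norm (f d \<tau>) = 1 / (\<Prod>j\<in>?S d. 1 + ?x d \<tau> j)"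
        unfolding f_eq using pos le by simp
      also have "\<dots> \<le> 1 / ((1 + \<tau>\<^sup>2) / 6)" by (rule divide_left_mono[OF le]) (use pos le in auto)
      also have "\<dots> = 6 * inverse (1 + \<tau>\<^sup>2)" by (simp add: field_simps)
      finally show ?thesis .
    qed
    then show "AE \<tau> in lborel. norm (f (Suc d) \<tau>) \<le> 6 * inverse (1 + \<tau>\<^sup>2)" for d by simp
    have "(\<lambda>d. f (Suc d) \<tau>) \<longlonglongrightarrow> exp (- \<tau>\<^sup>2 / 6)" for \<tau>
    proof (rule tendsto_sandwich)
      have bounds: "exp ((1 - \<tau>\<^sup>2 / real d) * (?c d * \<tau>\<^sup>2)) \<le> (\<Prod>j\<in>?S d. 1 + ?x d \<tau> j)"
          "(\<Prod>j\<in>?S d. 1 + ?x d \<tau> j) \<le> exp (?c d * \<tau>\<^sup>2)" if "0 < d" for d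
        unfolding sum_x[OF that, symmetric]
        by (rule prod_1_plus_bounds[OF fin]; use x_le[OF that] in simp)+
      have inv: "exp (- (?c d * \<tau>\<^sup>2)) \<le> f d \<tau>" "f d \<tau> \<le> exp (- ((1 - \<tau>\<^sup>2 / real d) * (?c d * \<tau>\<^sup>2)))"
        if "0 < d" for d
      proof -
        have pos: "0 < (\<Prod>j\<in>?S d. 1 + ?x d \<tau> j)" by (rule prod_pos) (simp add: add_pos_nonneg)
        show "exp (- (?c d * \<tau>\<^sup>2)) \<le> f d \<tau>"
          unfolding f_eq exp_minus inverse_eq_divide by (rule divide_left_mono[OF bounds(2)[OF that]]) (use pos in simp_all)
        show "f d \<tau> \<le> exp (- ((1 - \<tau>\<^sup>2 / real d) * (?c d * \<tau>\<^sup>2)))"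
          unfolding f_eq exp_minus inverse_eq_divide by (rule divide_left_mono[OF bounds(1)[OF that]]) (use pos in simp_all)
      qed
      show "\<forall>\<^sub>F d in sequentially. exp (- (?c (Suc d) * \<tau>\<^sup>2)) \<le> f (Suc d) \<tau>"
        by (intro always_eventually allI inv(1)) simp
      show "\<forall>\<^sub>F d in sequentially. f (Suc d) \<tau> \<le> exp (- ((1 - \<tau>\<^sup>2 / real (Suc d)) * (?c (Suc d) * \<tau>\<^sup>2)))"
        by (intro always_eventually allI inv(2)) simp
      have c: "(\<lambda>d. ?c d) \<longlonglongrightarrow> 1 / 6" by real_asymp
      have e: "(\<lambda>d. \<tau>\<^sup>2 / real d) \<longlonglongrightarrow> 0" by (rule lim_const_over_n)
      have "(\<lambda>d. exp (- (?c d * \<tau>\<^sup>2))) \<longlonglongrightarrow> exp (- (1 / 6 * \<tau>\<^sup>2))"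
        by (intro tendsto_intros c)
      then show "(\<lambda>d. exp (- (?c (Suc d) * \<tau>\<^sup>2))) \<longlonglongrightarrow> exp (- \<tau>\<^sup>2 / 6)"
        by (subst (asm) filterlim_sequentially_Suc[symmetric]) simp
      have "(\<lambda>d. exp (- ((1 - \<tau>\<^sup>2 / real d) * (?c d * \<tau>\<^sup>2)))) \<longlonglongrightarrow> exp (- ((1 - 0) * (1 / 6 * \<tau>\<^sup>2)))"
        by (intro tendsto_intros c e)
      then show "(\<lambda>d. exp (- ((1 - \<tau>\<^sup>2 / real (Suc d)) * (?c (Suc d) * \<tau>\<^sup>2)))) \<longlonglongrightarrow> exp (- \<tau>\<^sup>2 / 6)"
        by (subst (asm) filterlim_sequentially_Suc[symmetric]) simp
    qed
    then show "AE \<tau> in lborel. (\<lambda>d. f (Suc d) \<tau>) \<longlonglongrightarrow> exp (- \<tau>\<^sup>2 / 6)" by simp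
  qed simp
  then have lim: "(\<lambda>d. \<integral>\<tau>. f d \<tau> \<partial>lborel) \<longlonglongrightarrow> sqrt (6 * pi)"
    unfolding gaussian_integral by (rule filterlim_sequentially_Suc[THEN iffD1])
  have "\<forall>\<^sub>F d in sequentially. (\<integral>\<tau>. f d \<tau> \<partial>lborel) = real d powr (3 / 2) * (\<integral>t. degree_density d t \<partial>lborel)"
    using eventually_gt_at_top[of 0]
  proof eventually_elim
    case (elim d)
    then have "0 < real d powr (3 / 2)" by simp
    then show ?case
      using lborel_integral_real_affine[of "1 / real d powr (3 / 2)" "degree_density d" 0]
      by (simp add: f_def)
  qed
  then show ?thesis by (rule Lim_transform_eventually[OF lim])
qed

section \<open>The asymptotic degree\<close>

lemma degree_covariants_eq_integral:
  assumes d: "3 \<le> d"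
  shows "degree_covariants d = 1 / pi * (\<integral>t. degree_density d t \<partial>lborel)"
proof -
  let ?J = "\<lambda>z. \<integral>\<theta>. indicator {- pi / 2..pi / 2} \<theta> *\<^sub>R molien_integrand d z \<theta> \<partial>lborel"
  have Re_scale: "Re (of_real b * (of_real r * w)) = r * Re (of_real b * w)" for b r w
    by (simp add: algebra_simps)
  have series: "poincare_series d z = Re (of_real (1 / (2 * pi)) * ?J z)" if "0 \<le> z" "z < 1" for z
  proof -
    have "(\<lambda>i. real (cfun.dim (covariants_of_degree d i)) * z ^ i) sums Re (of_real (1 / (2 * pi)) * ?J z)"
      using sums_Re[OF hilbert_series_eq_integral[OF that, of d]]
      unfolding dim_covariants_of_degree Re_complex_of_real .
    then show ?thesis unfolding poincare_series_def by (rule sums_unique[symmetric])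
  qed
  have "((\<lambda>s. Re (of_real (1 / (2 * pi)) * (of_real (1 / s) ^ d * ?J (1 - 1 / s)))) \<longlongrightarrow>
      Re (of_real (1 / (2 * pi)) * of_real (2 * (\<integral>t. degree_density d t \<partial>lborel)))) at_top"
    by (intro tendsto_Re tendsto_mult tendsto_const molien_integral_tendsto[OF d])
  moreover have "Re (of_real (1 / (2 * pi)) * of_real (2 * (\<integral>t. degree_density d t \<partial>lborel))) =
      1 / pi * (\<integral>t. degree_density d t \<partial>lborel)"
    unfolding of_real_mult[symmetric] Re_complex_of_real by simp
  moreover have "\<forall>\<^sub>F s in at_top. Re (of_real (1 / (2 * pi)) * (of_real (1 / s) ^ d * ?J (1 - 1 / s))) =
      (1 - (1 - inverse s)) ^ d * poincare_series d (1 - inverse s)"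
    using eventually_gt_at_top[of 1]
  proof eventually_elim
    case (elim s)
    then have "poincare_series d (1 - 1 / s) = Re (of_real (1 / (2 * pi)) * ?J (1 - 1 / s))"
      by (intro series) simp_all
    moreover have "Re (of_real (1 / (2 * pi)) * (of_real (1 / s) ^ d * ?J (1 - 1 / s))) =
        (1 / s) ^ d * Re (of_real (1 / (2 * pi)) * ?J (1 - 1 / s))"
      unfolding of_real_power[symmetric] by (rule Re_scale)
    ultimately show ?case by (simp add: inverse_eq_divide)
  qed
  ultimately have "((\<lambda>s. (1 - (1 - inverse s)) ^ d * poincare_series d (1 - inverse s)) \<longlongrightarrow>
      1 / pi * (\<integral>t. degree_density d t \<partial>lborel)) at_top"
    by (simp add: Lim_transform_eventually)
  then have "((\<lambda>z. (1 - z) ^ d * poincare_series d z) \<longlongrightarrow>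
      1 / pi * (\<integral>t. degree_density d t \<partial>lborel)) (at_left 1)"
    by (simp add: filterlim_at_left_to_right filterlim_at_right_to_0[of _ _ "- 1"] filterlim_at_right_to_top)
  then show ?thesis unfolding degree_covariants_def by (intro tendsto_Lim) simp_all
qed

theorem mainTheorem4:
  "degree_covariants \<sim>[at_top] (\<lambda>d. sqrt (6 / pi) * (1 / real d powr (3 / 2)))"
proof (rule asymp_equivI')
  have "(\<lambda>d. 1 / pi * (real d powr (3 / 2) * (\<integral>t. degree_density d t \<partial>lborel)) / sqrt (6 / pi))
      \<longlonglongrightarrow> 1 / pi * sqrt (6 * pi) / sqrt (6 / pi)"
    by (intro tendsto_intros degree_density_integral_asymp) simp
  also have "1 / pi * sqrt (6 * pi) / sqrt (6 / pi) = 1"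
  proof -
    have "sqrt (6 * pi) = sqrt (6 / pi) * pi"
      using real_sqrt_mult[of "6 / pi" "pi\<^sup>2"] by (simp add: power2_eq_square)
    then show ?thesis by simp
  qed
  finally have lim: "(\<lambda>d. 1 / pi * (real d powr (3 / 2) * (\<integral>t. degree_density d t \<partial>lborel)) / sqrt (6 / pi)) \<longlonglongrightarrow> 1" .
  have "\<forall>\<^sub>F d in at_top. 1 / pi * (real d powr (3 / 2) * (\<integral>t. degree_density d t \<partial>lborel)) / sqrt (6 / pi) =
      degree_covariants d / (sqrt (6 / pi) * (1 / real d powr (3 / 2)))"
    using eventually_ge_at_top[of 3]
    by eventually_elim (simp add: degree_covariants_eq_integral)
  then show "((\<lambda>d. degree_covariants d / (sqrt (6 / pi) * (1 / real d powr (3 / 2)))) \<longlongrightarrow> 1) at_top"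
    by (rule Lim_transform_eventually[OF lim])
qed

end
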